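(* $\mathrm{nfc}(\mathcal{UHIT}_{\delta=6})^{\max} = \mathrm{nfc}(\mathcal{MU}_{\delta=6})^{\max} = \mathrm{minvdeg}(\mathcal{UHIT}_{\delta=6}) = \mathrm{minvdeg}(\mathcal{MU}_{\delta=6}) = 8 = \mathrm{N}(6) - 1$. Here $\mathrm{nfc}(\mathcal{D})^{\max}$ denotes the maximum (supremum) of $\mathrm{nfc}(F)$ over $F \in \mathcal{D}$.
   Context: Literals come with a fixed-point-free involution $x \mapsto \overline{x}$; variables are positive literals. A clause is a finite set $C$ of literals with $C \cap \overline{C} = \emptyset$; a clause-set is a finite set of clauses. $\mathrm{var}(F)$, $n(F) = |\mathrm{var}(F)|$, $c(F) = |F|$, $\delta(F) = c(F) - n(F)$. $F$ is satisfiable iff some assignment of truth values to variables makes a literal of every clause true. $\mathcal{MU}$ is the class of minimally unsatisfiable clause-sets ($F$ unsatisfiable, $F \setminus \{C\}$ satisfiable for all $C \in F$). $F$ is hitting if for all distinct $C, D \in F$ we have $C \cap \overline{D} \ne \emptyset$; $\mathcal{UHIT}$ is the class of unsatisfiable hitting clause-sets. $\mathcal{C}_{\delta = k} = \{F \in \mathcal{C} : \delta(F) = k\}$. A clause $C \in F$ is full if $\mathrm{var}(C) = \mathrm{var}(F)$; $\mathrm{nfc}(F)$ is the number of full clauses of $F$. $\mathrm{ld}_F(x)$ is the number of clauses of $F$ containing $x$, $\mathrm{vdeg}_F(v) = \mathrm{ld}_F(v)+\mathrm{ld}_F(\overline{v})$, $\mathrm{minvdeg}(F) = \min_{v \in \mathrm{var}(F)}\mathrm{vdeg}_F(v)$;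 for a class $\mathcal{D}$, $\mathrm{minvdeg}(\mathcal{D})$ is the supremum of $\mathrm{minvdeg}(F)$ over $F \in \mathcal{D}$ with $n(F) > 0$. $\mathrm{N}(1) = 2$, $\mathrm{N}(k) = \max_{i \in \{2,\dots,k\}} \min(2i, \mathrm{N}(k-i+1)+i)$ for $k \ge 2$ (so $\mathrm{N}(6) = 9$). *)

theory Defs
  imports Main "HOL-Library.Extended_Nat"
begin

datatype lit = Pos nat | Neg nat

fun comp :: "lit \<Rightarrow> lit" where
  "comp (Pos v) = Neg v"
| "comp (Neg v) = Pos v"

fun lvar :: "lit \<Rightarrow> nat" where
  "lvar (Pos v) = v"
| "lvar (Neg v) = v"

type_synonym clause = "lit set"
type_synonym clauseset = "clause set"

definition is_clause :: "clause \<Rightarrow> bool" where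
  "is_clause C \<longleftrightarrow> finite C \<and> C \<inter> comp ` C = {}"

definition is_clauseset :: "clauseset \<Rightarrow> bool" where
  "is_clauseset F \<longleftrightarrow> finite F \<and> (\<forall>C\<in>F. is_clause C)"

definition var_cl :: "clause \<Rightarrow> nat set" where
  "var_cl C = lvar ` C"

definition var :: "clauseset \<Rightarrow> nat set" where
  "var F = (\<Union>C\<in>F. var_cl C)"

definition n :: "clauseset \<Rightarrow> nat" where
  "n F = card (var F)"

definition c :: "clauseset \<Rightarrow> nat" where
  "c F = card F"

definition delta :: "clauseset \<Rightarrow> int" where
  "delta F = int (c F) - int (n F)"

fun lit_true :: "(nat \<Rightarrow> bool) \<Rightarrow> lit \<Rightarrow> bool" where
  "lit_true \<beta> (Pos v) = \<beta> v"
| "lit_true \<beta> (Neg v) = (\<not> \<beta> v)"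

definition satisfiable :: "clauseset \<Rightarrow> bool" where
  "satisfiable F \<longleftrightarrow> (\<exists>\<beta>. \<forall>C\<in>F. \<exists>x\<in>C. lit_true \<beta> x)"

definition MU :: "clauseset set" where
  "MU = {F. is_clauseset F \<and> \<not> satisfiable F \<and> (\<forall>C\<in>F. satisfiable (F - {C}))}"

definition hitting :: "clauseset \<Rightarrow> bool" where
  "hitting F \<longleftrightarrow> (\<forall>C\<in>F. \<forall>D\<in>F. C \<noteq> D \<longrightarrow> C \<inter> comp ` D \<noteq> {})"

definition UHIT :: "clauseset set" where
  "UHIT = {F. is_clauseset F \<and> \<not> satisfiable F \<and> hitting F}"

definition delta_eq :: "clauseset set \<Rightarrow> int \<Rightarrow> clauseset set" where
  "delta_eq \<C> k = {F\<in>\<C>. delta F = k}"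

definition nfc :: "clauseset \<Rightarrow> nat" where
  "nfc F = card {C\<in>F. var_cl C = var F}"

definition ld :: "clauseset \<Rightarrow> lit \<Rightarrow> nat" where
  "ld F x = card {C\<in>F. x \<in> C}"

definition vdeg :: "clauseset \<Rightarrow> nat \<Rightarrow> nat" where
  "vdeg F v = ld F (Pos v) + ld F (Neg v)"

definition minvdeg :: "clauseset \<Rightarrow> nat" where
  "minvdeg F = Min (vdeg F ` var F)"

text \<open>Supremum over a class (in the extended naturals, so unbounded gives \<infinity>).\<close>
definition nfc_max :: "clauseset set \<Rightarrow> enat" where
  "nfc_max \<D> = Sup ((\<lambda>F. enat (nfc F)) ` \<D>)"

definition minvdeg_class :: "clauseset set \<Rightarrow> enat" where
  "minvdeg_class \<D> = Sup ((\<lambda>F. enat (minvdeg F)) ` {F\<in>\<D>. n F > 0})"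

fun N :: "nat \<Rightarrow> nat" where
  "N 0 = 0"
| "N (Suc 0) = 2"
| "N (Suc (Suc m)) = Max ((\<lambda>i. min (2 * i) (N (Suc (Suc m) - i + 1) + i)) ` {2..Suc (Suc m)})"

end

theory Submission
  imports Defs
begin

text \<open>
  A full clause contains every variable, and an unsatisfiable hitting clause-set is minimally
  unsatisfiable, so everything follows from an unsatisfiable hitting clause-set of deficiency 6 with
  8 full clauses and from the bound 8 on the minimal variable degree in deficiency 6.

  Saturate a clause-set of deficiency \<open>k\<close> and set a literal occurring \<open>i\<close> times to true: if its
  variable has minimal degree, the result is minimally unsatisfiable of deficiency \<open>k - i + 1\<close>, and
  degrees drop by at most \<open>i\<close>; this gives the bound \<open>N k\<close>. If all degrees are at least \<open>N 6 = 9\<close>, a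
  variable of degree 9 has literals occurring 5 and 4 times, and setting the former to true
  leaves deficiency 2 and degrees at least 4. Saturating that clause-set yields a chain of unit clauses
  (after propagation) and a core all of whose variables have degree 4. The core variables must
  therefore occur in all 5 removed clauses. Counting the models that the chain and the core leave to
  those 5 clauses shows that the chain is empty, so the 5 clauses are full, and this holds for every
  variable. After a change of signs every clause that is not full is then negative with at least two
  literals, and there are too many assignments with at most two true variables to be falsified.
\<close>

section \<open>Literals, degrees and minimal unsatisfiability\<close>

text \<open>In the recursion for \<open>N 6\<close> only \<open>i = 5\<close> reaches 9, as
  \<open>N 2 + 5\<close>; both \<open>i = 4\<close> and \<open>i = 6\<close> give 8. A set with all
  degrees at least 9 therefore leaves no slack, but this tightness is needed at all variables of the
  split, not only at one of minimal degree. Saturated sets of deficiency 2 without unit clauses and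
  with degrees at least 4 are known to be an implication cycle together with two clauses that
  contain all variables, with opposite signs. Only the degrees are needed here: if some degree
  exceeded 4, contracting a cycle of degree-4 variables would leave deficiency 1, hence a variable
  of degree at most 2, although degrees drop by at most one. Unit clauses are the obstacle, since
  the variable of a unit occurs in every clause of a saturated set. They can be cut off one by one,
  but their variables need the separate count in deficiency 6.\<close>

lemma lvar_comp [simp]: "lvar (comp l) = lvar l"
  by (cases l) auto

lemma comp_comp [simp]: "comp (comp l) = l"
  by (cases l) auto

lemma comp_neq [simp]: "comp l \<noteq> l" "l \<noteq> comp l"
  by (cases l; simp)+

lemma comp_eq_iff [simp]: "comp l = comp m \<longleftrightarrow> l = m"
  by (metis comp_comp)

lemma lvar_eq_iff: "lvar l = lvar m \<longleftrightarrow> l = m \<or> l = comp m"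
  by (cases l; cases m) auto

lemma lit_true_comp [simp]: "lit_true \<beta> (comp l) \<longleftrightarrow> \<not> lit_true \<beta> l"
  by (cases l) auto

definition force :: "lit \<Rightarrow> (nat \<Rightarrow> bool) \<Rightarrow> nat \<Rightarrow> bool" where
  "force l \<beta> = \<beta>(lvar l := (l = Pos (lvar l)))"

lemma lit_true_force: "lit_true (force l \<beta>) m \<longleftrightarrow> (if lvar m = lvar l then m = l else lit_true \<beta> m)"
  by (cases l; cases m) (auto simp: force_def)

lemma lit_true_merge:
  "lit_true (\<lambda>v. if v \<in> W then \<tau> v else \<beta> v) l \<longleftrightarrow> (if lvar l \<in> W then lit_true \<tau> l else lit_true \<beta> l)"
  by (cases l) auto

definition falsif :: "(nat \<Rightarrow> bool) \<Rightarrow> clause \<Rightarrow> bool" where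
  "falsif \<beta> C \<longleftrightarrow> (\<forall>l\<in>C. \<not> lit_true \<beta> l)"

lemma satisfiable_falsif: "satisfiable F \<longleftrightarrow> (\<exists>\<beta>. \<forall>C\<in>F. \<not> falsif \<beta> C)"
  by (auto simp: satisfiable_def falsif_def)

lemma satisfiable_subset: "satisfiable F \<Longrightarrow> G \<subseteq> F \<Longrightarrow> satisfiable G"
  by (auto simp: satisfiable_def)

lemma falsif_cong:
  "(\<And>l. l \<in> C \<Longrightarrow> lit_true \<beta> l = lit_true \<gamma> l) \<Longrightarrow> falsif \<beta> C = falsif \<gamma> C"
  by (auto simp: falsif_def)

lemma is_clause_iff: "is_clause C \<longleftrightarrow> finite C \<and> (\<forall>l\<in>C. comp l \<notin> C)"
  by (force simp: is_clause_def)

lemma is_clause_subset: "is_clause C \<Longrightarrow> D \<subseteq> C \<Longrightarrow> is_clause D"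
  by (auto simp: is_clause_iff intro: finite_subset)

lemma is_clauseset_subset: "is_clauseset F \<Longrightarrow> G \<subseteq> F \<Longrightarrow> is_clauseset G"
  by (auto simp: is_clauseset_def intro: finite_subset)

lemma falsifying_assignment:
  assumes "is_clause C"
  obtains \<beta> where "falsif \<beta> C"
proof
  show "falsif (\<lambda>v. Neg v \<in> C) C"
    unfolding falsif_def
  proof
    fix l assume "l \<in> C"
    then show "\<not> lit_true (\<lambda>v. Neg v \<in> C) l"
      using assms by (cases l) (auto simp: is_clause_iff)
  qed
qed

lemma finite_var: "is_clauseset F \<Longrightarrow> finite (var F)"
  by (auto simp: var_def var_cl_def is_clauseset_def is_clause_def)

lemma var_iff: "v \<in> var F \<longleftrightarrow> (\<exists>C\<in>F. \<exists>l\<in>C. lvar l = v)"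
  by (auto simp: var_def var_cl_def)

lemma var_mono: "F \<subseteq> G \<Longrightarrow> var F \<subseteq> var G"
  by (auto simp: var_def)

text \<open>Counting by clauses makes the degree monotone when clauses grow, which is how it is
  compared before and after saturation. It agrees with \<open>vdeg\<close> because clauses are not
  tautological.\<close>

definition deg :: "clauseset \<Rightarrow> nat \<Rightarrow> nat" where
  "deg F v = card {C \<in> F. v \<in> var_cl C}"

lemma clauses_containing_var:
  "{C \<in> F. lvar x \<in> var_cl C} = {C \<in> F. x \<in> C} \<union> {C \<in> F. comp x \<in> C}"
  by (auto simp: var_cl_def lvar_eq_iff image_iff intro: bexI[of _ "comp x"])

lemma deg_eq_ld:
  assumes "is_clauseset F"
  shows "deg F (lvar x) = ld F x + ld F (comp x)"
proof -
  have "{C \<in> F. x \<in> C} \<inter> {C \<in> F. comp x \<in> C} = {}"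
    using assms by (auto simp: is_clauseset_def is_clause_iff)
  moreover have "finite F"
    using assms by (auto simp: is_clauseset_def)
  ultimately show ?thesis
    unfolding deg_def ld_def clauses_containing_var by (subst card_Un_disjoint) auto
qed

lemma vdeg_eq_deg: "is_clauseset F \<Longrightarrow> vdeg F v = deg F v"
  using deg_eq_ld[of F "Pos v"] by (simp add: vdeg_def)

lemma deg_pos: "is_clauseset F \<Longrightarrow> v \<in> var F \<Longrightarrow> 0 < deg F v"
  by (auto simp: deg_def var_def card_gt_0_iff is_clauseset_def)

lemma deg_pos_var: "0 < deg F v \<Longrightarrow> v \<in> var F"
  by (auto simp: deg_def var_def card_gt_0_iff)

lemma MU_clauseset: "F \<in> MU \<Longrightarrow> is_clauseset F"
  by (auto simp: MU_def)

lemma MU_finite: "F \<in> MU \<Longrightarrow> finite F"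
  by (auto simp: MU_def is_clauseset_def)

lemma MU_clause: "F \<in> MU \<Longrightarrow> C \<in> F \<Longrightarrow> is_clause C"
  by (auto simp: MU_def is_clauseset_def)

lemma MU_unsat: "F \<in> MU \<Longrightarrow> \<not> satisfiable F"
  by (auto simp: MU_def)

lemma MU_falsified: "F \<in> MU \<Longrightarrow> \<exists>C\<in>F. falsif \<beta> C"
  by (auto simp: MU_def satisfiable_falsif)

lemma MU_psubset_sat: "F \<in> MU \<Longrightarrow> G \<subseteq> F \<Longrightarrow> C \<in> F \<Longrightarrow> C \<notin> G \<Longrightarrow> satisfiable G"
  unfolding MU_def by (blast intro: satisfiable_subset)

lemma MU_private:
  assumes "F \<in> MU" "C \<in> F"
  obtains \<beta> where "falsif \<beta> C" "\<And>D. D \<in> F \<Longrightarrow> D \<noteq> C \<Longrightarrow> \<not> falsif \<beta> D"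
proof -
  obtain \<beta> where b: "\<forall>D\<in>F - {C}. \<not> falsif \<beta> D"
    using assms by (auto simp: MU_def satisfiable_falsif)
  moreover obtain D where "D \<in> F" "falsif \<beta> D"
    using MU_falsified assms(1) by blast
  ultimately show ?thesis
    using that by blast
qed

lemma MU_antichain: "F \<in> MU \<Longrightarrow> C \<in> F \<Longrightarrow> D \<in> F \<Longrightarrow> C \<subseteq> D \<Longrightarrow> C = D"
  by (erule MU_private[of F D]) (auto simp: falsif_def subset_iff, metis+)

text \<open>Otherwise making \<open>x\<close> true in an assignment that falsifies only
  \<open>C\<close> would repair \<open>C\<close> without falsifying another clause.\<close>

lemma MU_comp_occurs:
  assumes F: "F \<in> MU" and C: "C \<in> F" "x \<in> C"
  shows "\<exists>D\<in>F. comp x \<in> D"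
proof (rule ccontr)
  assume no: "\<not> ?thesis"
  obtain \<beta> where b: "\<And>D. D \<in> F \<Longrightarrow> D \<noteq> C \<Longrightarrow> \<not> falsif \<beta> D"
    using MU_private[OF F C(1)] by metis
  obtain D where D: "D \<in> F" "falsif (force x \<beta>) D"
    using MU_falsified F by blast
  have "D \<noteq> C"
    using D C by (auto simp: falsif_def lit_true_force)
  then obtain l where l: "l \<in> D" "lit_true \<beta> l"
    using b D by (auto simp: falsif_def)
  then show False
    using D no by (auto simp: falsif_def lit_true_force lvar_eq_iff split: if_splits)
qed

lemma MU_ld_pos:
  assumes "F \<in> MU" "lvar x \<in> var F"
  shows "0 < ld F x"
proof -
  obtain C l where "C \<in> F" "l \<in> C" "lvar l = lvar x"
    using assms by (auto simp: var_iff)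
  then have "\<exists>D\<in>F. x \<in> D"
    using MU_comp_occurs[of F C l] assms(1) by (auto simp: lvar_eq_iff)
  then show ?thesis
    using MU_finite[OF assms(1)] by (auto simp: ld_def card_gt_0_iff)
qed

lemma MU_no_vars:
  assumes F: "F \<in> MU" and "var F = {}"
  shows "F = {{}}"
proof -
  have "F \<subseteq> {{}}"
    using assms by (auto simp: var_def var_cl_def)
  moreover have "F \<noteq> {}"
    using MU_falsified[OF F] by auto
  ultimately show ?thesis
    by auto
qed

lemma unsat_contains_MU:
  assumes "is_clauseset F" "\<not> satisfiable F"
  shows "\<exists>G\<subseteq>F. G \<in> MU"
  using assms
proof (induction "card F" arbitrary: F rule: less_induct)
  case less
  show ?case
  proof (cases "F \<in> MU")
    case False
    then obtain C where "C \<in> F" "\<not> satisfiable (F - {C})"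
      using less.prems by (auto simp: MU_def)
    moreover have "card (F - {C}) < card F"
      using less.prems \<open>C \<in> F\<close> by (intro psubset_card_mono) (auto simp: is_clauseset_def)
    ultimately show ?thesis
      using less.hyps[of "F - {C}"] less.prems is_clauseset_subset[of F "F - {C}"] by blast
  qed blast
qed

section \<open>Saturation and splitting\<close>

definition saturated :: "clauseset \<Rightarrow> bool" where
  "saturated F \<longleftrightarrow> (\<forall>C\<in>F. \<forall>x. lvar x \<in> var F \<longrightarrow> x \<notin> C \<longrightarrow> comp x \<notin> C \<longrightarrow>
     satisfiable (insert (insert x C) (F - {C})))"

definition SMU :: "clauseset set" where
  "SMU = {F \<in> MU. saturated F}"

lemma SMU_MU: "F \<in> SMU \<Longrightarrow> F \<in> MU"
  by (simp add: SMU_def)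

text \<open>The form in which saturation is used: an assignment falsifying only \<open>C\<close>
  exists with any prescribed value of a variable outside \<open>C\<close>.\<close>

lemma SMU_witness:
  assumes "F \<in> SMU" "C \<in> F" "lvar x \<in> var F" "x \<notin> C" "comp x \<notin> C"
  obtains \<beta> where "falsif \<beta> C" "lit_true \<beta> x" "\<And>D. D \<in> F \<Longrightarrow> D \<noteq> C \<Longrightarrow> \<not> falsif \<beta> D"
proof -
  have "satisfiable (insert (insert x C) (F - {C}))"
    using assms by (auto simp: SMU_def saturated_def)
  then obtain \<beta> where b: "\<not> falsif \<beta> (insert x C)" "\<And>D. D \<in> F \<Longrightarrow> D \<noteq> C \<Longrightarrow> \<not> falsif \<beta> D"
    by (auto simp: satisfiable_falsif)
  obtain D where "D \<in> F" "falsif \<beta> D"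
    using MU_falsified SMU_MU assms(1) by blast
  then have "falsif \<beta> C"
    using b by blast
  then show ?thesis
    using that[of \<beta>] b by (auto simp: falsif_def)
qed

lemma saturation_step:
  assumes F: "F \<in> MU" and C: "C \<in> F" and x: "lvar x \<in> var F" "x \<notin> C" "comp x \<notin> C"
    and u: "\<not> satisfiable (insert (insert x C) (F - {C}))"
  defines "\<psi> \<equiv> \<lambda>D. if D = C then insert x C else D"
  shows "inj_on \<psi> F" "\<psi> ` F \<in> MU" "var (\<psi> ` F) = var F"
proof -
  have img: "\<psi> ` F = insert (insert x C) (F - {C})"
    using C by (auto simp: \<psi>_def)
  \<comment> \<open>No clause contains another, so the enlarged clause does not collide with an
    existing one and the number of clauses is kept.\<close>
  have new: "insert x C \<notin> F"
    using MU_antichain[OF F C, of "insert x C"] x by blast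
  show "inj_on \<psi> F"
    using new by (auto simp: \<psi>_def inj_on_def)
  show "var (\<psi> ` F) = var F"
    using C x by (auto simp: img var_def var_cl_def)
  have "is_clauseset (\<psi> ` F)"
    unfolding img using MU_clauseset[OF F] C x by (auto simp: is_clauseset_def is_clause_iff)
  moreover have "satisfiable (\<psi> ` F - {D})" if "D \<in> \<psi> ` F" for D
  proof (cases "D = insert x C")
    case True
    have "satisfiable (F - {C})"
      using F C by (auto simp: MU_def)
    then show ?thesis
      by (rule satisfiable_subset) (auto simp: img True)
  next
    case False
    then have D: "D \<in> F" "D \<noteq> C"
      using that by (auto simp: img)
    obtain \<beta> where "\<And>E. E \<in> F \<Longrightarrow> E \<noteq> D \<Longrightarrow> \<not> falsif \<beta> E"
      using MU_private[OF F D(1)] by metis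
    then have "\<not> falsif \<beta> C" "\<forall>E\<in>F - {D}. \<not> falsif \<beta> E"
      using C D by blast+
    then have "\<forall>E\<in>\<psi> ` F - {D}. \<not> falsif \<beta> E"
      unfolding img by (auto simp: falsif_def)
    then show ?thesis
      by (auto simp: satisfiable_falsif)
  qed
  ultimately show "\<psi> ` F \<in> MU"
    using u by (auto simp: MU_def img)
qed

text \<open>The map \<open>\<phi>\<close> is kept, and not just its image, because later a clause is
  compared with its own saturation. The number of literals missing from the clauses decreases in
  each step.\<close>

lemma saturation:
  assumes "F \<in> MU"
  obtains \<phi> where "inj_on \<phi> F" "\<phi> ` F \<in> SMU" "var (\<phi> ` F) = var F" "\<And>C. C \<in> F \<Longrightarrow> C \<subseteq> \<phi> C"
proof -
  have "\<exists>\<phi>. inj_on \<phi> F \<and> \<phi> ` F \<in> SMU \<and> var (\<phi> ` F) = var F \<and> (\<forall>C\<in>F. C \<subseteq> \<phi> C)"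
    using assms
  proof (induction "\<Sum>C\<in>F. card ({l. lvar l \<in> var F} - C)" arbitrary: F rule: less_induct)
    case less
    show ?case
    proof (cases "saturated F")
      case True
      then show ?thesis
        using less.prems by (intro exI[of _ id]) (auto simp: SMU_def)
    next
      case False
      then obtain C x where C: "C \<in> F" and x: "lvar x \<in> var F" "x \<notin> C" "comp x \<notin> C"
        and u: "\<not> satisfiable (insert (insert x C) (F - {C}))"
        by (auto simp: saturated_def)
      define \<psi> where "\<psi> = (\<lambda>D. if D = C then insert x C else D)"
      note step = saturation_step[OF less.prems C x u, folded \<psi>_def]
      let ?L = "{l. lvar l \<in> var F}"
      have "?L \<subseteq> Pos ` var F \<union> Neg ` var F"
      proof
        fix l assume "l \<in> ?L" then show "l \<in> Pos ` var F \<union> Neg ` var F" by (cases l) auto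
      qed
      then have finL: "finite ?L"
        using finite_var[OF MU_clauseset[OF less.prems]] finite_subset by blast
      have "(\<Sum>D\<in>\<psi> ` F. card (?L - D)) = (\<Sum>D\<in>F. card (?L - \<psi> D))"
        using step(1) by (simp add: sum.reindex)
      also have "\<dots> < (\<Sum>D\<in>F. card (?L - D))"
      proof (rule sum_strict_mono_ex1)
        show "finite F" using less.prems MU_finite by blast
        show "\<forall>D\<in>F. card (?L - \<psi> D) \<le> card (?L - D)"
          using finL by (auto intro!: card_mono simp: \<psi>_def)
        have "card (?L - \<psi> C) < card (?L - C)"
          using finL x by (intro psubset_card_mono) (auto simp: \<psi>_def)
        then show "\<exists>D\<in>F. card (?L - \<psi> D) < card (?L - D)"
          using C by blast
      qed
      finally have "(\<Sum>D\<in>\<psi> ` F. card ({l. lvar l \<in> var (\<psi> ` F)} - D)) < (\<Sum>D\<in>F. card (?L - D))"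
        using step(3) by simp
      from less.hyps[OF this step(2)] obtain \<phi> where
        p: "inj_on \<phi> (\<psi> ` F)" "\<phi> ` \<psi> ` F \<in> SMU" "var (\<phi> ` \<psi> ` F) = var F" "\<forall>D\<in>\<psi> ` F. D \<subseteq> \<phi> D"
        using step(3) by auto
      have "\<forall>D\<in>F. D \<subseteq> \<phi> (\<psi> D)"
      proof
        fix D assume "D \<in> F"
        then have "\<psi> D \<subseteq> \<phi> (\<psi> D)" using p(4) by blast
        then show "D \<subseteq> \<phi> (\<psi> D)" by (auto simp: \<psi>_def split: if_splits)
      qed
      then show ?thesis
        using p step(1) by (intro exI[of _ "\<phi> \<circ> \<psi>"]) (auto simp: comp_inj_on image_comp)
    qed
  qed
  then show ?thesis
    using that by blast
qed

lemma deg_mono_image: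
  assumes "inj_on \<phi> F" "finite F" "\<And>C. C \<in> F \<Longrightarrow> C \<subseteq> \<phi> C"
  shows "deg F v \<le> deg (\<phi> ` F) v"
proof -
  have "card {C \<in> F. v \<in> var_cl C} = card (\<phi> ` {C \<in> F. v \<in> var_cl C})"
    using assms(1) by (intro card_image[symmetric] inj_on_subset[OF assms(1)]) auto
  also have "\<dots> \<le> card {C \<in> \<phi> ` F. v \<in> var_cl C}"
    using assms by (intro card_mono) (auto simp: var_cl_def)
  finally show ?thesis
    by (simp add: deg_def)
qed

section \<open>Setting a literal to true\<close>

definition split :: "clauseset \<Rightarrow> lit \<Rightarrow> clauseset" where
  "split F x = (\<lambda>C. C - {comp x}) ` {C \<in> F. x \<notin> C}"

text \<open>Two clauses equal up to \<open>comp x\<close> would be comparable. So a split loses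
  exactly the clauses containing \<open>x\<close>.\<close>

lemma split_inj:
  assumes F: "F \<in> MU"
  shows "inj_on (\<lambda>C. C - {comp x}) F"
proof (rule inj_onI)
  fix C D assume CD: "C \<in> F" "D \<in> F" "C - {comp x} = D - {comp x}"
  then have "C \<subseteq> D \<or> D \<subseteq> C"
    by blast
  then show "C = D"
    using MU_antichain[OF F] CD by blast
qed

text \<open>Minimality needs, for each remaining clause \<open>C\<close>, an assignment with
  \<open>x\<close> true that falsifies no clause other than \<open>C\<close>. If
  \<open>comp x\<close> is in \<open>C\<close>, this is automatic; if the variable is absent from
  \<open>C\<close>, saturation supplies it.\<close>

lemma split_MU:
  assumes F: "F \<in> SMU" and x: "lvar x \<in> var F"
  shows "split F x \<in> MU"
proof -
  note M = SMU_MU[OF F]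
  have cs: "is_clauseset (split F x)"
    using MU_clauseset[OF M] unfolding split_def
    by (auto simp: is_clauseset_def intro: is_clause_subset)
  have uns: "\<not> satisfiable (split F x)"
  proof
    assume "satisfiable (split F x)"
    then obtain \<beta> where b: "\<And>C. C \<in> F \<Longrightarrow> x \<notin> C \<Longrightarrow> \<not> falsif \<beta> (C - {comp x})"
      by (auto simp: satisfiable_falsif split_def)
    obtain C where C: "C \<in> F" "falsif (force x \<beta>) C"
      using MU_falsified[OF M] by blast
    then have "x \<notin> C"
      by (auto simp: falsif_def lit_true_force)
    then obtain l where "l \<in> C" "l \<noteq> comp x" "lit_true \<beta> l"
      using b[OF C(1)] by (auto simp: falsif_def)
    then show False
      using C \<open>x \<notin> C\<close> by (auto simp: falsif_def lit_true_force lvar_eq_iff split: if_splits)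
  qed
  have "satisfiable (split F x - {D})" if "D \<in> split F x" for D
  proof -
    obtain C where C: "C \<in> F" "x \<notin> C" "D = C - {comp x}"
      using \<open>D \<in> split F x\<close> by (auto simp: split_def)
    have "\<exists>\<beta>. lit_true \<beta> x \<and> (\<forall>E\<in>F. E \<noteq> C \<longrightarrow> \<not> falsif \<beta> E)"
    proof (cases "comp x \<in> C")
      case True
      then show ?thesis
        using MU_private[OF M C(1)] by (metis falsif_def lit_true_comp)
    next
      case False
      then show ?thesis
        using SMU_witness[OF F C(1) x C(2)] by metis
    qed
    then obtain \<beta> where b: "lit_true \<beta> x" "\<And>E. E \<in> F \<Longrightarrow> E \<noteq> C \<Longrightarrow> \<not> falsif \<beta> E"
      by blast
    have "\<not> falsif \<beta> E'" if "E' \<in> split F x - {D}" for E'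
    proof -
      obtain E where E: "E \<in> F" "x \<notin> E" "E' = E - {comp x}" "E \<noteq> C"
        using \<open>E' \<in> split F x - {D}\<close> C by (auto simp: split_def)
      then show ?thesis
        using b(1) b(2)[OF E(1,4)] by (auto simp: falsif_def)
    qed
    then show ?thesis
      by (auto simp: satisfiable_falsif)
  qed
  then show ?thesis
    using cs uns by (auto simp: MU_def)
qed

lemma card_split:
  assumes F: "F \<in> MU"
  shows "card (split F x) + ld F x = card F"
proof -
  have "card (split F x) = card {C \<in> F. x \<notin> C}"
    unfolding split_def by (rule card_image, rule inj_on_subset[OF split_inj[OF F]]) auto
  moreover have "card {C \<in> F. x \<notin> C} + card {C \<in> F. x \<in> C} = card ({C \<in> F. x \<notin> C} \<union> {C \<in> F. x \<in> C})"
    using MU_finite[OF F] by (intro card_Un_disjoint[symmetric]) auto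
  moreover have "{C \<in> F. x \<notin> C} \<union> {C \<in> F. x \<in> C} = F"
    by auto
  ultimately show ?thesis
    by (simp add: ld_def)
qed

lemma deg_split:
  assumes F: "F \<in> MU" and v: "v \<noteq> lvar x"
  shows "deg (split F x) v + card {C \<in> F. x \<in> C \<and> v \<in> var_cl C} = deg F v"
proof -
  have "{D \<in> split F x. v \<in> var_cl D} = (\<lambda>C. C - {comp x}) ` {C \<in> F. x \<notin> C \<and> v \<in> var_cl C}"
    using v by (auto simp: split_def var_cl_def)
  then have "deg (split F x) v = card {C \<in> F. x \<notin> C \<and> v \<in> var_cl C}"
    unfolding deg_def by (simp, intro card_image inj_on_subset[OF split_inj[OF F]]) auto
  moreover have "card {C \<in> F. x \<notin> C \<and> v \<in> var_cl C} + card {C \<in> F. x \<in> C \<and> v \<in> var_cl C} =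
      card ({C \<in> F. x \<notin> C \<and> v \<in> var_cl C} \<union> {C \<in> F. x \<in> C \<and> v \<in> var_cl C})"
    using MU_finite[OF F] by (intro card_Un_disjoint[symmetric]) auto
  moreover have "{C \<in> F. x \<notin> C \<and> v \<in> var_cl C} \<union> {C \<in> F. x \<in> C \<and> v \<in> var_cl C} = {C \<in> F. v \<in> var_cl C}"
    by auto
  ultimately show ?thesis
    by (simp add: deg_def)
qed

lemma deg_split_le:
  assumes F: "F \<in> MU" and v: "v \<noteq> lvar x"
  shows "deg F v \<le> deg (split F x) v + ld F x"
proof -
  have "card {C \<in> F. x \<in> C \<and> v \<in> var_cl C} \<le> ld F x"
    unfolding ld_def using MU_finite[OF F] by (intro card_mono) auto
  then show ?thesis
    using deg_split[OF F v] by linarith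
qed

lemma var_split_subset: "is_clauseset F \<Longrightarrow> var (split F x) \<subseteq> var F - {lvar x}"
  by (auto simp: split_def var_def var_cl_def lvar_eq_iff)

lemma var_split:
  assumes F: "F \<in> MU" and "\<And>v. v \<in> var F \<Longrightarrow> v \<noteq> lvar x \<Longrightarrow> ld F x < deg F v"
  shows "var (split F x) = var F - {lvar x}"
proof
  show "var F - {lvar x} \<subseteq> var (split F x)"
  proof
    fix v assume v: "v \<in> var F - {lvar x}"
    then have "0 < deg (split F x) v"
      using deg_split_le[OF F, of v x] assms(2)[of v] by simp
    then show "v \<in> var (split F x)"
      by (rule deg_pos_var)
  qed
qed (use var_split_subset MU_clauseset[OF F] in blast)

text \<open>The complement occurs as well, so the occurrences of \<open>x\<close> are fewer than the
  minimal degree and cannot use up those of another variable.\<close>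

lemma min_deg_ld_less:
  assumes F: "F \<in> MU" and x: "lvar x \<in> var F" and min: "\<And>v. v \<in> var F \<Longrightarrow> deg F (lvar x) \<le> deg F v"
    and v: "v \<in> var F"
  shows "ld F x < deg F v"
  using MU_ld_pos[OF F, of "comp x"] x deg_eq_ld[OF MU_clauseset[OF F], of x] min[OF v] by simp

text \<open>Splitting a saturated set at a variable of minimal degree loses exactly that variable,
  but at least one clause.\<close>

theorem Tarsi:
  assumes "F \<in> MU"
  shows "card (var F) < card F"
  using assms
proof (induction "card (var F)" arbitrary: F rule: less_induct)
  case less
  show ?case
  proof (cases "var F = {}")
    case True
    then show ?thesis
      using MU_no_vars[OF less.prems] by simp
  next
    case ne: False
    obtain \<phi> where p: "inj_on \<phi> F" "\<phi> ` F \<in> SMU" "var (\<phi> ` F) = var F"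
      using saturation[OF less.prems] by metis
    define G where "G = \<phi> ` F"
    have G: "G \<in> SMU" "var G = var F" "card G = card F"
      using p by (auto simp: G_def card_image)
    note M = SMU_MU[OF G(1)]
    have fin: "finite (var G)"
      using finite_var MU_clauseset[OF M] by blast
    obtain v where v: "v \<in> var G" "\<And>w. w \<in> var G \<Longrightarrow> deg G v \<le> deg G w"
      using ex_is_arg_min_if_finite[OF fin, of "deg G"] ne G(2) by (auto simp: is_arg_min_linorder)
    have vs: "var (split G (Pos v)) = var G - {v}"
      using var_split[OF M, of "Pos v"] min_deg_ld_less[OF M, of "Pos v"] v by simp
    then have c1: "card (var (split G (Pos v))) + 1 = card (var F)"
      using v(1) fin G(2) by (metis Suc_eq_plus1 card_Suc_Diff1)
    have "card (var (split G (Pos v))) < card (split G (Pos v))"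
      using c1 split_MU[OF G(1), of "Pos v"] v(1) by (intro less.hyps) auto
    moreover have "0 < ld G (Pos v)"
      using MU_ld_pos[OF M] v(1) by simp
    ultimately show ?thesis
      using card_split[OF M, of "Pos v"] c1 G(3) by linarith
  qed
qed

section \<open>The degree bound given by \<open>N\<close>\<close>

lemma N_ge: "2 \<le> i \<Longrightarrow> i \<le> k \<Longrightarrow> min (2 * i) (N (k - i + 1) + i) \<le> N k"
proof -
  assume i: "2 \<le> i" "i \<le> k"
  then obtain m where k: "k = Suc (Suc m)"
    by (metis Suc_le_D add_2_eq_Suc le_Suc_ex le_trans)
  show ?thesis
    unfolding k N.simps using i by (intro Max_ge) (auto simp: k)
qed

lemma N_ge_2: "1 \<le> k \<Longrightarrow> 2 \<le> N k"
proof (cases "k = 1")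
  case False
  assume "1 \<le> k"
  then have "min (2 * 2) (N (k - 2 + 1) + 2) \<le> N k"
    using False by (intro N_ge) auto
  then show ?thesis
    by simp
qed simp

text \<open>The split has deficiency \<open>k - ld F x + 1\<close>; the last bound is Tarsi's
  inequality for it.\<close>

lemma SMU_min_deg_ld:
  assumes F: "F \<in> SMU" and x: "lvar x \<in> var F" and min: "\<And>v. v \<in> var F \<Longrightarrow> deg F (lvar x) \<le> deg F v"
    and k: "card F = card (var F) + k"
  shows "split F x \<in> MU" "var (split F x) = var F - {lvar x}"
    "card (split F x) + ld F x = card (var (split F x)) + k + 1" "ld F x \<le> k"
proof -
  note M = SMU_MU[OF F]
  show 1: "split F x \<in> MU"
    using split_MU F x by blast
  show 2: "var (split F x) = var F - {lvar x}"
    using var_split[OF M] min_deg_ld_less[OF M x min] by blast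
  have "card (var (split F x)) + 1 = card (var F)"
    using x finite_var[OF MU_clauseset[OF M]] by (simp add: 2 card_Suc_Diff1 del: card_Diff_insert)
  then show 3: "card (split F x) + ld F x = card (var (split F x)) + k + 1"
    using card_split[OF M, of x] k by linarith
  show "ld F x \<le> k"
    using Tarsi[OF 1] 3 by linarith
qed

theorem low_degree_variable:
  assumes "F \<in> MU" "var F \<noteq> {}" "card F = card (var F) + k"
  shows "\<exists>v\<in>var F. deg F v \<le> N k"
  using assms
proof (induction k arbitrary: F rule: less_induct)
  case (less k)
  obtain \<phi> where p: "inj_on \<phi> F" "\<phi> ` F \<in> SMU" "var (\<phi> ` F) = var F" "\<And>C. C \<in> F \<Longrightarrow> C \<subseteq> \<phi> C"
    using saturation[OF less.prems(1)] by metis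
  define G where "G = \<phi> ` F"
  have G: "G \<in> SMU" "var G = var F" "card G = card (var G) + k"
    using p less.prems by (auto simp: G_def card_image)
  have le: "deg F v \<le> deg G v" for v
    unfolding G_def using deg_mono_image p MU_finite[OF less.prems(1)] by blast
  note M = SMU_MU[OF G(1)]
  have k1: "1 \<le> k"
    using Tarsi[OF M] G(3) by simp
  have fin: "finite (var G)"
    using finite_var MU_clauseset[OF M] by blast
  obtain v where v: "v \<in> var G" "\<And>w. w \<in> var G \<Longrightarrow> deg G v \<le> deg G w"
    using ex_is_arg_min_if_finite[OF fin, of "deg G"] less.prems(2) G(2) by (auto simp: is_arg_min_linorder)
  \<comment> \<open>For the more frequent literal, \<open>2 * ld G x\<close> bounds the degree of
    \<open>v\<close>; this is the first argument of the minimum in \<open>N\<close>.\<close>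
  define x where "x = (if ld G (Pos v) \<ge> ld G (Neg v) then Pos v else Neg v)"
  have x: "lvar x = v" "ld G (comp x) \<le> ld G x"
    by (auto simp: x_def)
  have d: "deg G v \<le> 2 * ld G x"
    using deg_eq_ld[OF MU_clauseset[OF M], of x] x by simp
  have s: "lvar x \<in> var G" "\<And>w. w \<in> var G \<Longrightarrow> deg G (lvar x) \<le> deg G w"
    using v x by auto
  note S = SMU_min_deg_ld[OF G(1) s G(3)]
  have ex: "\<exists>w\<in>var G. deg G w \<le> N k"
  proof (cases "ld G x \<le> 1")
    case True
    then show ?thesis
      using d N_ge_2[OF k1] v(1) by (intro bexI[of _ v]) auto
  next
    case False
    show ?thesis
    proof (cases "var (split G x) = {}")
      case True
      \<comment> \<open>With a single variable both literals occur \<open>k\<close> times among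
        \<open>k + 1\<close> clauses, so \<open>k\<close> is at most 1.\<close>
      note S' = SMU_min_deg_ld[OF G(1), of "comp x", simplified, OF s G(3)]
      have "card (split G x) = 1" "card (split G (comp x)) = 1" "var (split G (comp x)) = {}"
        using MU_no_vars[OF S(1) True] MU_no_vars[OF S'(1)] S(2) S'(2) True by auto
      then have "ld G x = k" "ld G (comp x) = k" "card (var G) = 1" 
        using S(2,3) S'(2,3) True card_split[OF M, of x] G(3) by (auto simp: card_eq_0_iff)
      moreover have "ld G x + ld G (comp x) \<le> card G"
        using deg_eq_ld[OF MU_clauseset[OF M], of x] MU_finite[OF M]
        by (metis (no_types, lifting) card_mono deg_def mem_Collect_eq subsetI)
      ultimately show ?thesis
        using G(3) False by simp
    next
      case ne: False
      have "card (split G x) = card (var (split G x)) + (k - ld G x + 1)"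
        using S(3,4) by linarith
      then obtain w where w: "w \<in> var (split G x)" "deg (split G x) w \<le> N (k - ld G x + 1)"
        using less.IH[of "k - ld G x + 1" "split G x"] S(1,4) ne False by fastforce
      have "w \<in> var G" "w \<noteq> lvar x"
        using w(1) S(2) by auto
      then have "deg G w \<le> N (k - ld G x + 1) + ld G x"
        using deg_split_le[OF M, of w x] w(2) by linarith
      moreover have "min (2 * ld G x) (N (k - ld G x + 1) + ld G x) \<le> N k"
        using False S(4) by (intro N_ge) auto
      ultimately show ?thesis
        using d v(1) \<open>w \<in> var G\<close> by (meson le_trans min_le_iff_disj)
    qed
  qed
  then show ?case
    using le le_trans G(2) by blast
qed

lemma N_values: "N 1 = 2" "N 2 = 4" "N 3 = 5" "N 4 = 6" "N 5 = 8" "N 6 = 9"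
proof -
  show 1: "N 1 = 2" by simp
  have m: "{2..2::nat} = {2}" "{2..3::nat} = {2,3}" "{2..4::nat} = {2,3,4}" "{2..5::nat} = {2,3,4,5}"
    "{2..6::nat} = {2,3,4,5,6}" by auto
  have r: "N k = Max ((\<lambda>i. min (2 * i) (N (k - i + 1) + i)) ` {2..k})" if "2 \<le> k" for k
    using that by (cases k rule: N.cases) auto
  show 2: "N 2 = 4" using 1 by (subst r) (simp_all add: m)
  show 3: "N 3 = 5" using 1 2 by (subst r) (simp_all add: m)
  show 4: "N 4 = 6" using 1 2 3 by (subst r) (simp_all add: m)
  show 5: "N 5 = 8" using 1 2 3 4 by (subst r) (simp_all add: m)
  show "N 6 = 9" using 1 2[unfolded numeral_2_eq_2] 2 3 4 5 by (subst r) (simp_all add: m del: N.simps)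
qed

section \<open>Deficiency 1\<close>

lemma lvar_in_var: "C \<in> F \<Longrightarrow> l \<in> C \<Longrightarrow> lvar l \<in> var F"
  by (auto simp: var_iff)

lemma card_var_Un_le:
  assumes "is_clauseset S" "is_clauseset T"
  shows "card (var (S \<union> T)) \<le> card (var S) + card (var T - var S)"
proof -
  have "var (S \<union> T) = var S \<union> (var T - var S)"
    by (auto simp: var_def)
  then show ?thesis
    by (metis card_Un_le)
qed

text \<open>Tarsi's inequality for a minimally unsatisfiable part of the clauses restricted to
  literals outside \<open>W\<close>. Restriction may identify clauses, so \<open>S\<close> takes one
  preimage of each.\<close>

lemma surplus_subset:
  assumes P: "is_clauseset P" and uns: "\<And>\<beta>. \<exists>C\<in>P. \<forall>l\<in>C. lvar l \<notin> W \<longrightarrow> \<not> lit_true \<beta> l"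
  shows "\<exists>S\<subseteq>P. card (var S - W) < card S"
proof -
  define h where "h = (\<lambda>C. {l \<in> C. lvar l \<notin> W})"
  have "is_clauseset (h ` P)"
    using P unfolding is_clauseset_def by (auto simp: h_def intro: is_clause_subset)
  moreover have "\<not> satisfiable (h ` P)"
  proof -
    have "\<exists>C\<in>h ` P. falsif \<beta> C" for \<beta>
      using uns[of \<beta>] by (auto simp: falsif_def h_def)
    then show ?thesis
      by (auto simp: satisfiable_falsif)
  qed
  ultimately obtain Q where Q: "Q \<subseteq> h ` P" "Q \<in> MU"
    using unsat_contains_MU by blast
  then obtain S where S: "S \<subseteq> P" "inj_on h S" "Q = h ` S"
    by (auto simp: subset_image_inj)
  have "var Q = var S - W"
    by (auto simp: S(3) h_def var_def var_cl_def)
  then show ?thesis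
    using Tarsi[OF Q(2)] S by (metis card_image)
qed

text \<open>A counterexample \<open>S\<close> has a model, so the remaining clauses are
  unsatisfiable outside \<open>var S\<close>, and a surplus part of them can be added to
  \<open>S\<close>. This raises the deficiency by at least one; repeated, it ends at
  \<open>F\<close> with deficiency at least 2.\<close>

lemma proper_subset_deficiency:
  assumes F: "F \<in> MU" "card F = card (var F) + 1" and S: "S \<subseteq> F" "S \<noteq> F"
  shows "card S \<le> card (var S)"
  using S
proof (induction "card (F - S)" arbitrary: S rule: less_induct)
  case less
  note fin = MU_finite[OF F(1)]
  show ?case
  proof (rule ccontr)
    assume big: "\<not> card S \<le> card (var S)"
    obtain C where "C \<in> F" "C \<notin> S"
      using less.prems by blast
    then obtain \<tau> where \<tau>: "\<And>D. D \<in> S \<Longrightarrow> \<not> falsif \<tau> D"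
      using MU_psubset_sat[OF F(1) less.prems(1)] unfolding satisfiable_falsif by blast
    have cs: "is_clauseset (F - S)" "is_clauseset S"
      using MU_clauseset[OF F(1)] is_clauseset_subset less.prems(1) by blast+
    have "\<exists>D\<in>F - S. \<forall>l\<in>D. lvar l \<notin> var S \<longrightarrow> \<not> lit_true \<beta> l" for \<beta>
    proof -
      let ?m = "\<lambda>v. if v \<in> var S then \<tau> v else \<beta> v"
      obtain D where D: "D \<in> F" "falsif ?m D"
        using MU_falsified[OF F(1)] by blast
      have "D \<notin> S"
      proof
        assume "D \<in> S"
        then have "falsif ?m D = falsif \<tau> D"
          unfolding falsif_def lit_true_merge by (simp add: lvar_in_var)
        then show False
          using \<tau> D \<open>D \<in> S\<close> by blast
      qed
      then show ?thesis
        using D by (intro bexI[of _ D]) (auto simp: falsif_def lit_true_merge)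
    qed
    from surplus_subset[OF cs(1) this] obtain S' where S': "S' \<subseteq> F - S" "card (var S' - var S) < card S'"
      by blast
    have "is_clauseset S'"
      using cs(1) S'(1) is_clauseset_subset by blast
    then have v: "card (var (S \<union> S')) \<le> card (var S) + card (var S' - var S)"
      using card_var_Un_le cs(2) by blast
    have c: "card (S \<union> S') = card S + card S'"
      using S'(1) less.prems(1) fin by (intro card_Un_disjoint) (auto intro: finite_subset)
    show False
    proof (cases "S \<union> S' = F")
      case True
      then show ?thesis
        using v c S'(2) big F(2) by simp
    next
      case False
      have "card (F - (S \<union> S')) < card (F - S)"
      proof (rule psubset_card_mono)
        have "S' \<noteq> {}"
          using S'(2) by auto
        then show "F - (S \<union> S') \<subset> F - S"
          using S'(1) by blast
      qed (use fin in auto)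
      then have "card (S \<union> S') \<le> card (var (S \<union> S'))"
        using False S'(1) less.prems(1) by (intro less.hyps) auto
      then show ?thesis
        using v c S'(2) big by linarith
    qed
  qed
qed

text \<open>Resolving on a variable that occurs once in each sign removes one clause and one
  variable, so the deficiency is kept. The key is \<open>lift\<close>: a model of the other clauses
  that satisfies one parent without its literal of \<open>lvar y\<close> extends to
  \<open>F\<close>, since the value of \<open>lvar y\<close> can be spent on the other
  parent.\<close>

lemma resolve_MU:
  assumes F: "F \<in> MU" and C: "C \<in> F" "y \<in> C" "\<And>E. E \<in> F \<Longrightarrow> y \<in> E \<Longrightarrow> E = C"
    and D: "D \<in> F" "comp y \<in> D" "\<And>E. E \<in> F \<Longrightarrow> comp y \<in> E \<Longrightarrow> E = D"
  defines "E \<equiv> (C - {y}) \<union> (D - {comp y})"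
  defines "G \<equiv> insert E (F - {C, D})"
  shows "G \<in> MU" "E \<notin> F - {C, D}" "var G = var F - {lvar y}" "card G + 1 = card F"
proof -
  have cl: "is_clause C" "is_clause D"
    using MU_clause[OF F] C(1) D(1) by auto
  have CD: "C \<noteq> D"
    using cl C(2) D(2) by (auto simp: is_clause_iff)
  have nC: "comp y \<notin> C" and nD: "y \<notin> D"
    using cl C(2) D(2) by (auto simp: is_clause_iff)
  have no_y: "lvar l \<noteq> lvar y" if "B \<in> F - {C, D}" "l \<in> B" for B l
    using that C(3)[of B] D(3)[of B] by (auto simp: lvar_eq_iff)
  have no_y_E: "lvar l \<noteq> lvar y" if "l \<in> E" for l
    using that nC nD by (auto simp: E_def lvar_eq_iff)
  have keep: "falsif (force m \<beta>) B = falsif \<beta> B" if "B \<in> F - {C, D}" "lvar m = lvar y" for B m \<beta>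
    using no_y[OF that(1)] that(2) by (intro falsif_cong) (auto simp: lit_true_force)
  have lift: "satisfiable F" if "\<And>B. B \<in> F - {C, D} \<Longrightarrow> \<not> falsif \<beta> B"
    and "\<not> falsif \<beta> (C - {y}) \<or> \<not> falsif \<beta> (D - {comp y})" for \<beta>
  proof -
    define m where "m = (if falsif \<beta> (C - {y}) then y else comp y)"
    have m: "lvar m = lvar y"
      by (auto simp: m_def)
    have "\<not> falsif (force m \<beta>) B" if B: "B \<in> F" for B
    proof -
      consider "B \<in> F - {C, D}" | "B = C" | "B = D"
        using B by blast
      then show ?thesis
      proof cases
        case 1
        then show ?thesis using keep[OF 1 m] \<open>\<And>B. B \<in> F - {C, D} \<Longrightarrow> \<not> falsif \<beta> B\<close> by blast
      next
        case 2
        have "lvar l \<noteq> lvar y" if "l \<in> C - {y}" for l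
          using nC that by (auto simp: lvar_eq_iff)
        then show ?thesis
          using C(2) by (auto simp: 2 falsif_def lit_true_force m_def)
      next
        case 3
        have "lvar l \<noteq> lvar y" if "l \<in> D - {comp y}" for l
          using nD that by (auto simp: lvar_eq_iff)
        then show ?thesis
          using \<open>\<not> falsif \<beta> (C - {y}) \<or> \<not> falsif \<beta> (D - {comp y})\<close> D(2)
          by (auto simp: 3 falsif_def lit_true_force m_def)
      qed
    qed
    then show ?thesis
      by (auto simp: satisfiable_falsif)
  qed
  have uns: "\<exists>B\<in>G. falsif \<beta> B" for \<beta>
  proof (rule ccontr)
    assume "\<not> ?thesis"
    then have "\<And>B. B \<in> F - {C, D} \<Longrightarrow> \<not> falsif \<beta> B" "\<not> falsif \<beta> E"
      by (auto simp: G_def)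
    then show False
      using lift[of \<beta>] MU_unsat[OF F] by (auto simp: falsif_def E_def)
  qed
  have sat: "satisfiable (F - {C, D})"
    using C(1) by (intro MU_psubset_sat[OF F, of _ C]) auto
  then show new: "E \<notin> F - {C, D}"
    using uns by (auto simp: satisfiable_falsif G_def insert_absorb)
  \<comment> \<open>A tautological resolvent would be true under every assignment, so any model of
    the other clauses would extend to \<open>F\<close>.\<close>
  have "comp l \<notin> E" if l: "l \<in> E" for l
  proof
    assume "comp l \<in> E"
    obtain \<beta> where b: "\<And>B. B \<in> F - {C, D} \<Longrightarrow> \<not> falsif \<beta> B"
      using sat by (auto simp: satisfiable_falsif)
    obtain m where "m \<in> E" "lit_true \<beta> m"
      using l \<open>comp l \<in> E\<close> by (metis lit_true_comp)
    then have "\<not> falsif \<beta> (C - {y}) \<or> \<not> falsif \<beta> (D - {comp y})"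
      unfolding E_def falsif_def by blast
    then show False
      using lift[OF b] MU_unsat[OF F] by blast
  qed
  then have "is_clause E"
    using cl by (auto simp: is_clause_iff E_def)
  then have cs: "is_clauseset G"
    using MU_clauseset[OF F] by (auto simp: is_clauseset_def G_def)
  have "satisfiable (G - {B})" if B: "B \<in> G" for B
  proof (cases "B = E")
    case True
    have "satisfiable (F - {C, D})" by (rule sat)
    then show ?thesis
      by (rule satisfiable_subset) (auto simp: G_def True)
  next
    case False
    then have B: "B \<in> F" "B \<noteq> C" "B \<noteq> D"
      using that by (auto simp: G_def)
    obtain \<beta> where b: "\<And>A. A \<in> F \<Longrightarrow> A \<noteq> B \<Longrightarrow> \<not> falsif \<beta> A"
      using MU_private[OF F B(1)] by metis
    have "\<not> falsif \<beta> C" "\<not> falsif \<beta> D"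
      using b C(1) D(1) B by auto
    then obtain l m where lm: "l \<in> C" "lit_true \<beta> l" "m \<in> D" "lit_true \<beta> m"
      unfolding falsif_def by blast
    then have "l \<noteq> y \<or> m \<noteq> comp y"
      by auto
    then have "l \<in> E \<or> m \<in> E"
      unfolding E_def using lm by blast
    then have "\<not> falsif \<beta> E"
      using lm unfolding falsif_def by blast
    then have "\<forall>A\<in>G - {B}. \<not> falsif \<beta> A"
      using b by (auto simp: G_def)
    then show ?thesis
      by (auto simp: satisfiable_falsif)
  qed
  then show "G \<in> MU"
    using cs uns by (auto simp: MU_def satisfiable_falsif)
  show "var G = var F - {lvar y}"
  proof
    show "var G \<subseteq> var F - {lvar y}"
    proof
      fix v assume "v \<in> var G"
      then obtain B l where "B \<in> G" "l \<in> B" "lvar l = v"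
        by (auto simp: var_iff)
      then show "v \<in> var F - {lvar y}"
        using no_y no_y_E C(1) D(1) by (auto simp: G_def var_iff E_def)
    qed
    show "var F - {lvar y} \<subseteq> var G"
    proof
      fix v assume v: "v \<in> var F - {lvar y}"
      then obtain B l where B: "B \<in> F" "l \<in> B" "lvar l = v"
        by (auto simp: var_iff)
      have "l \<noteq> y" "l \<noteq> comp y"
        using B v by auto
      then show "v \<in> var G"
        using B by (cases "B = C \<or> B = D") (auto simp: var_iff G_def E_def)
    qed
  qed
  have "card (F - {C, D}) + 2 = card F"
    using C(1) D(1) CD MU_finite[OF F] card_mono[of F "{C, D}"]
    by (subst card_Diff_subset) auto
  then show "card G + 1 = card F"
    using new MU_finite[OF F] by (simp add: G_def)
qed

text \<open>Without saturation the clauses of a subtree need not contain the root literal. The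
  subtrees are instead described by the value of \<open>x\<close> under which each is unsatisfiable,
  and by sharing no variable but the root.\<close>

definition root_split :: "clauseset \<Rightarrow> lit \<Rightarrow> clauseset \<Rightarrow> clauseset \<Rightarrow> bool" where
  "root_split F x L R \<longleftrightarrow> L \<union> R = F \<and> L \<inter> R = {} \<and> (\<forall>C\<in>L. comp x \<notin> C) \<and> (\<forall>C\<in>R. x \<notin> C) \<and>
     var L \<inter> var R \<subseteq> {lvar x} \<and>
     (\<forall>\<beta>. \<not> lit_true \<beta> x \<longrightarrow> (\<exists>C\<in>L. falsif \<beta> C)) \<and>
     (\<forall>\<beta>. lit_true \<beta> x \<longrightarrow> (\<exists>C\<in>R. falsif \<beta> C))"

lemma root_split_sym: "root_split F x L R \<Longrightarrow> root_split F (comp x) R L"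
  by (auto simp: root_split_def)

lemma low_degree_once:
  assumes F: "F \<in> MU" and y: "lvar y \<in> var F" "deg F (lvar y) \<le> 2"
  shows "\<exists>C\<in>F. y \<in> C \<and> (\<forall>E\<in>F. y \<in> E \<longrightarrow> E = C)"
proof -
  have "ld F y + ld F (comp y) \<le> 2"
    using deg_eq_ld[OF MU_clauseset[OF F], of y] y by simp
  moreover have "0 < ld F y" "0 < ld F (comp y)"
    using MU_ld_pos[OF F] y by auto
  ultimately have "ld F y = 1"
    by linarith
  then obtain C where "{E \<in> F. y \<in> E} = {C}"
    unfolding ld_def by (auto simp: card_1_singleton_iff)
  then show ?thesis
    by blast
qed

text \<open>Saturating would turn a clause-set of deficiency 1 into the set of root-to-leaf paths of a
  binary tree; \<open>x\<close> is the label of the root of that tree.\<close>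

lemma root_split_exists:
  assumes "F \<in> MU" "card F = card (var F) + 1" "var F \<noteq> {}"
  shows "\<exists>x L R. root_split F x L R"
  using assms
proof (induction "card (var F)" arbitrary: F rule: less_induct)
  case less
  note F = less.prems(1)
  obtain v where v: "v \<in> var F" "deg F v \<le> 2"
    using low_degree_variable[OF less.prems(1,3,2)] by auto
  define y where "y = Pos v"
  have y: "lvar y \<in> var F" "deg F (lvar y) \<le> 2"
    using v by (auto simp: y_def)
  obtain C where C: "C \<in> F" "y \<in> C" "\<And>E. E \<in> F \<Longrightarrow> y \<in> E \<Longrightarrow> E = C"
    using low_degree_once[OF F y] by blast
  obtain D where D: "D \<in> F" "comp y \<in> D" "\<And>E. E \<in> F \<Longrightarrow> comp y \<in> E \<Longrightarrow> E = D"
    using low_degree_once[OF F, of "comp y"] y by auto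
  have cl: "is_clause C" "is_clause D"
    using MU_clause[OF F] C(1) D(1) by auto
  then have CD: "C \<noteq> D" "comp y \<notin> C" "y \<notin> D"
    using C(2) D(2) by (auto simp: is_clause_iff)
  define E where "E = (C - {y}) \<union> (D - {comp y})"
  define G where "G = insert E (F - {C, D})"
  note res = resolve_MU[OF F C D, folded E_def, folded G_def]
  show ?case
  proof (cases "var G = {}")
    case True
    have "E \<in> G"
      by (simp add: G_def)
    then have "E = {}" "G = {{}}"
      using MU_no_vars[OF res(1) True] by auto
    then have "F - {C, D} = {}"
      using res(2) by (auto simp: G_def)
    then have FCD: "F = {C, D}"
      using C(1) D(1) by blast
    have "C = {y}" "D = {comp y}"
      using \<open>E = {}\<close> C(2) D(2) by (auto simp: E_def)
    then have "root_split F y {C} {D}"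
      using FCD by (auto simp: root_split_def falsif_def var_def var_cl_def)
    then show ?thesis
      by blast
  next
    case False
    have "card (var G) + 1 = card (var F)"
      using res(3) y(1) finite_var[OF MU_clauseset[OF F]] by (simp add: card_Suc_Diff1 del: card_Diff_insert)
    then have "\<exists>x L R. root_split G x L R"
      using res False less.prems(2) by (intro less.hyps) auto
    moreover have "E \<in> G"
      by (simp add: G_def)
    ultimately obtain x L R where "root_split G x L R" "E \<in> L \<or> E \<in> R"
      by (auto simp: root_split_def)
    then obtain x L R where r: "root_split G x L R" "E \<in> L"
      using root_split_sym by blast
    \<comment> \<open>The parents replace the resolvent on its side. Their extra variable
      \<open>lvar y\<close> occurs in no other clause, so the sides still share only the root
      variable.\<close>
    define L' where "L' = (L - {E}) \<union> {C, D}"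
    have G: "L \<union> R = G" "L \<inter> R = {}"
      using r(1) by (auto simp: root_split_def)
    have R: "R \<subseteq> F - {C, D}"
      using G r(2) by (auto simp: G_def)
    have lE: "l \<in> E \<or> l = y \<or> l = comp y" if "l \<in> C \<or> l \<in> D" for l
      using that by (auto simp: E_def)
    have yG: "lvar y \<notin> var G"
      using res(3) by blast
    \<comment> \<open>If the root variable did not occur, making \<open>x\<close> true would leave
      \<open>E\<close> the only falsified clause, yet \<open>R\<close> would have to contain
      one.\<close>
    have "x \<in> \<Union>G \<or> comp x \<in> \<Union>G"
    proof (rule ccontr)
      assume no: "\<not> ?thesis"
      obtain \<beta> where b: "falsif \<beta> E" "\<And>D. D \<in> G \<Longrightarrow> D \<noteq> E \<Longrightarrow> \<not> falsif \<beta> D"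
        using MU_private[OF res(1) \<open>E \<in> G\<close>] by metis
      have f: "falsif (force x \<beta>) A = falsif \<beta> A" if "A \<in> G" for A
        using no that by (intro falsif_cong) (auto simp: lit_true_force lvar_eq_iff)
      obtain A where "A \<in> R" "falsif (force x \<beta>) A"
        using r(1) unfolding root_split_def by (metis lit_true_force)
      then show False
        using f[of A] b(2)[of A] G r(2) by blast
    qed
    then have xy: "lvar x \<noteq> lvar y"
      using yG by (metis UnionE lvar_comp var_iff)
    have "root_split F x L' R"
      unfolding root_split_def
    proof (intro conjI)
      show "L' \<union> R = F" "L' \<inter> R = {}"
        using G R C(1) D(1) res(2) r(2) by (auto simp: L'_def G_def)
      show "\<forall>A\<in>L'. comp x \<notin> A"
        using r lE xy unfolding root_split_def L'_def
        by (metis Diff_iff UnE insertE lvar_comp singletonD)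
      show "\<forall>A\<in>R. x \<notin> A"
        using r(1) by (auto simp: root_split_def)
      have "var L' \<subseteq> insert (lvar y) (var L)"
      proof
        fix v assume "v \<in> var L'"
        then obtain A l where "A \<in> L'" "l \<in> A" "lvar l = v"
          by (auto simp: var_iff)
        then show "v \<in> insert (lvar y) (var L)"
          using lE[of l] lvar_in_var[OF r(2), of l] lvar_in_var[of A L l] by (auto simp: L'_def)
      qed
      moreover have "lvar y \<notin> var R"
        using yG G var_mono[of R G] by blast
      ultimately show "var L' \<inter> var R \<subseteq> {lvar x}"
        using r(1) by (auto simp: root_split_def)
      show "\<forall>\<beta>. \<not> lit_true \<beta> x \<longrightarrow> (\<exists>A\<in>L'. falsif \<beta> A)"
      proof (intro allI impI)
        fix \<beta> assume "\<not> lit_true \<beta> x"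
        then obtain A where A: "A \<in> L" "falsif \<beta> A"
          using r(1) by (auto simp: root_split_def)
        show "\<exists>A\<in>L'. falsif \<beta> A"
        proof (cases "A = E")
          case True
          then have f: "\<not> lit_true \<beta> l" if "l \<in> E" for l
            using A that by (simp add: falsif_def)
          have "falsif \<beta> C" if "\<not> lit_true \<beta> y"
            unfolding falsif_def using f that by (metis DiffI E_def UnI1 singletonD)
          moreover have "falsif \<beta> D" if "lit_true \<beta> y"
            unfolding falsif_def using f that by (metis DiffI E_def UnI2 lit_true_comp singletonD)
          ultimately have "falsif \<beta> C \<or> falsif \<beta> D"
            by blast
          then show ?thesis
            unfolding L'_def by blast
        qed (use A in \<open>auto simp: L'_def\<close>)
      qed
      show "\<forall>\<beta>. lit_true \<beta> x \<longrightarrow> (\<exists>A\<in>R. falsif \<beta> A)"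
        using r(1) by (auto simp: root_split_def)
    qed
    then show ?thesis
      by blast
  qed
qed

text \<open>An assignment falsifying only a clause of \<open>L\<close> makes \<open>x\<close> false,
  since otherwise \<open>R\<close> would contribute a falsified clause; so minimality survives the
  deletion of \<open>x\<close>.\<close>

lemma root_split_half:
  assumes F: "F \<in> MU" "card F = card (var F) + 1" and r: "root_split F x L R"
  shows "inj_on (\<lambda>C. C - {x}) L" "(\<lambda>C. C - {x}) ` L \<in> MU" "var ((\<lambda>C. C - {x}) ` L) = var L - {lvar x}"
proof -
  have LR: "L \<union> R = F" "L \<inter> R = {}" "\<And>C. C \<in> L \<Longrightarrow> comp x \<notin> C"
    using r by (auto simp: root_split_def)
  show inj: "inj_on (\<lambda>C. C - {x}) L"
    using split_inj[OF F(1), of "comp x"] LR(1) by (auto intro: inj_on_subset)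
  show "var ((\<lambda>C. C - {x}) ` L) = var L - {lvar x}"
  proof -
    have "l \<noteq> x \<longleftrightarrow> lvar l \<noteq> lvar x" if "C \<in> L" "l \<in> C" for C l
      using LR(3) that by (auto simp: lvar_eq_iff)
    then show ?thesis
      by (fastforce simp: var_iff)
  qed
  have "is_clauseset L"
    using MU_clauseset[OF F(1)] LR(1) is_clauseset_subset by blast
  then have cs: "is_clauseset ((\<lambda>C. C - {x}) ` L)"
    by (auto simp: is_clauseset_def intro: is_clause_subset)
  have uns: "\<exists>B\<in>(\<lambda>C. C - {x}) ` L. falsif \<beta> B" for \<beta>
  proof -
    have "\<not> lit_true (force (comp x) \<beta>) x"
      by (simp add: lit_true_force)
    then obtain C where C: "C \<in> L" "falsif (force (comp x) \<beta>) C"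
      using r by (auto simp: root_split_def)
    then have "falsif \<beta> (C - {x})"
      using LR(3)[of C] by (auto simp: falsif_def lit_true_force lvar_eq_iff split: if_splits)
    then show ?thesis
      using C by blast
  qed
  have "satisfiable ((\<lambda>C. C - {x}) ` L - {B})" if B: "B \<in> (\<lambda>C. C - {x}) ` L" for B
  proof -
    obtain C where C: "C \<in> L" "B = C - {x}"
      using B by blast
    obtain \<beta> where b: "\<And>D. D \<in> F \<Longrightarrow> D \<noteq> C \<Longrightarrow> \<not> falsif \<beta> D"
      using MU_private[OF F(1), of C] C LR(1) by blast
    have x: "\<not> lit_true \<beta> x"
    proof
      assume "lit_true \<beta> x"
      then obtain D where "D \<in> R" "falsif \<beta> D"
        using r by (auto simp: root_split_def)
      then show False
        using b[of D] C LR by blast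
    qed
    have "\<not> falsif \<beta> A" if A: "A \<in> (\<lambda>C. C - {x}) ` L - {B}" for A
    proof -
      obtain D where "D \<in> L" "A = D - {x}" "D \<noteq> C"
        using A C by blast
      then show ?thesis
        using b[of D] LR(1) x by (auto simp: falsif_def)
    qed
    then show ?thesis
      by (auto simp: satisfiable_falsif)
  qed
  then show "(\<lambda>C. C - {x}) ` L \<in> MU"
    using cs uns by (auto simp: MU_def satisfiable_falsif)
qed

text \<open>Both halves satisfy Tarsi's inequality. As \<open>F\<close> has deficiency 1 and the
  root accounts for only one further variable, neither half has slack.\<close>

lemma root_split_card:
  assumes F: "F \<in> MU" "card F = card (var F) + 1" and r: "root_split F x L R"
  shows "card L = card (var L - {lvar x}) + 1"
proof -
  have LR: "L \<union> R = F" "L \<inter> R = {}"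
    using r by (auto simp: root_split_def)
  have fin: "finite L" "finite R" "finite (var L)" "finite (var R)"
    using LR(1) MU_finite[OF F(1)] finite_var[OF MU_clauseset[OF F(1)]] var_mono[of L F] var_mono[of R F]
    by (auto intro: finite_subset)
  have "card (var L - {lvar x}) < card L"
    using Tarsi root_split_half[OF F r] by (metis card_image)
  moreover have "card (var R - {lvar x}) < card R"
    using Tarsi root_split_half[OF F root_split_sym[OF r]] by (metis card_image lvar_comp)
  moreover have "card L + card R = card F"
    using fin LR by (metis card_Un_disjoint)
  moreover have "card (var F) \<le> 1 + card (var L - {lvar x}) + card (var R - {lvar x})"
  proof -
    have "var F \<subseteq> {lvar x} \<union> (var L - {lvar x}) \<union> (var R - {lvar x})"
      using LR(1) by (auto simp: var_def)
    then have "card (var F) \<le> card ({lvar x} \<union> (var L - {lvar x}) \<union> (var R - {lvar x}))"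
      using fin by (intro card_mono) auto
    also have "\<dots> \<le> card ({lvar x} \<union> (var L - {lvar x})) + card (var R - {lvar x})"
      by (rule card_Un_le)
    also have "card ({lvar x} \<union> (var L - {lvar x})) \<le> 1 + card (var L - {lvar x})"
      using card_Un_le[of "{lvar x}" "var L - {lvar x}"] by (metis card.empty card.insert finite.emptyI empty_iff One_nat_def)
    finally show ?thesis
      by simp
  qed
  ultimately show ?thesis
    using F(2) by linarith
qed

text \<open>Without \<open>x\<close> the half has deficiency 1, hence a variable of degree at most
  2; being private to the half, it has the same degree in \<open>F\<close>.\<close>

lemma root_split_low_degree:
  assumes F: "F \<in> MU" "card F = card (var F) + 1" and r: "root_split F x L R"
    and ne: "var L - {lvar x} \<noteq> {}"
  shows "\<exists>y\<in>var L - {lvar x}. y \<notin> var R \<and> deg F y \<le> 2"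
proof -
  let ?h = "\<lambda>C. C - {x}"
  note h = root_split_half[OF F r]
  have "card (?h ` L) = card (var (?h ` L)) + 1"
    using root_split_card[OF F r] h by (simp add: card_image)
  then obtain y where y: "y \<in> var L - {lvar x}" "deg (?h ` L) y \<le> 2"
    using low_degree_variable[OF h(2)] ne h(3) by auto
  have LR: "L \<union> R = F" "y \<notin> var R"
    using r y(1) by (auto simp: root_split_def)
  have "{C \<in> ?h ` L. y \<in> var_cl C} = ?h ` {C \<in> F. y \<in> var_cl C}"
    using LR y(1) by (auto simp: var_def var_cl_def)
  moreover have "inj_on ?h {C \<in> F. y \<in> var_cl C}"
    using LR by (intro inj_on_subset[OF h(1)]) (auto simp: var_def)
  ultimately have "deg (?h ` L) y = deg F y"
    by (simp add: deg_def card_image)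
  then show ?thesis
    using y LR by auto
qed

lemma root_split_unit:
  assumes F: "F \<in> MU" "card F = card (var F) + 1" "var F \<noteq> {}" and r: "root_split F x L R"
    and e: "var L - {lvar x} = {}"
  shows "L = {{x}}"
proof -
  have "card L = 1"
    using root_split_card[OF F(1,2) r] by (simp add: e)
  then obtain C where C: "L = {C}"
    by (auto simp: card_1_singleton_iff)
  have "(\<lambda>C. C - {x}) ` L = {{}}"
    using MU_no_vars root_split_half[OF F(1,2) r] e by metis
  then have "C = {} \<or> C = {x}"
    using C by auto
  moreover have "C \<noteq> {}"
  proof
    assume "C = {}"
    then have "F = {{}}"
      using MU_antichain[OF F(1), of "{}"] C r by (auto simp: root_split_def)
    then show False
      using F(3) by (auto simp: var_def var_cl_def)
  qed
  ultimately show ?thesis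
    using C by auto
qed

text \<open>Under \<open>\<alpha>\<close>, where \<open>x\<close> is false, the clauses of \<open>L\<close> are satisfied by variables private to \<open>L\<close>.\<close>

lemma root_split_mix:
  assumes r: "root_split F x L R" and x: "\<not> lit_true \<alpha> x"
    and \<alpha>: "\<And>C. C \<in> L \<Longrightarrow> C \<noteq> A \<Longrightarrow> \<not> falsif \<alpha> C" and \<beta>: "\<And>C. C \<in> R \<Longrightarrow> C \<noteq> B \<Longrightarrow> \<not> falsif \<beta> C"
  defines "\<gamma> \<equiv> \<lambda>v. if v \<in> var L - {lvar x} then \<alpha> v else \<beta> v"
  assumes C: "C \<in> F" "C \<noteq> A" "C \<noteq> B"
  shows "\<not> falsif \<gamma> C"
proof (cases "C \<in> L")
  case True
  then obtain l where l: "l \<in> C" "lit_true \<alpha> l"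
    using \<alpha> C by (auto simp: falsif_def)
  then have "lvar l \<noteq> lvar x"
    using x r True by (auto simp: root_split_def lvar_eq_iff)
  then have "lit_true \<gamma> l"
    using l True unfolding \<gamma>_def lit_true_merge by (simp add: lvar_in_var)
  then show ?thesis
    using l by (auto simp: falsif_def)
next
  case False
  then have R: "C \<in> R"
    using r C by (auto simp: root_split_def)
  then obtain l where l: "l \<in> C" "lit_true \<beta> l"
    using \<beta> C by (auto simp: falsif_def)
  have "lvar l \<notin> var L - {lvar x}"
    using r lvar_in_var[OF R l(1)] by (auto simp: root_split_def)
  then have "lit_true \<gamma> l"
    using l unfolding \<gamma>_def lit_true_merge by argo
  then show ?thesis
    using l by (auto simp: falsif_def)
qed

section \<open>Deficiency 2\<close>

locale deficiency_two =
  fixes G :: clauseset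
  assumes SMU: "G \<in> SMU"
    and card_G: "card G = card (var G) + 2"
    and deg_ge: "\<And>v. v \<in> var G \<Longrightarrow> 4 \<le> deg G v"
    and no_unit: "\<And>l. {l} \<notin> G"
begin

lemma MU: "G \<in> MU"
  using SMU SMU_MU by blast

lemma fin: "finite G" "finite (var G)"
  using MU_finite[OF MU] finite_var[OF MU_clauseset[OF MU]] by auto

definition V4 :: "nat set" where
  "V4 = {v \<in> var G. deg G v = 4}"

lemma V4_var: "v \<in> V4 \<Longrightarrow> v \<in> var G"
  by (simp add: V4_def)

lemma V4_nonempty: "V4 \<noteq> {}"
proof -
  have "var G \<noteq> {}"
    using MU_no_vars[OF MU] card_G by auto
  then obtain v where "v \<in> var G" "deg G v \<le> 4"
    using low_degree_variable[OF MU _ card_G] N_values(2) by auto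
  then show ?thesis
    using deg_ge[of v] by (auto simp: V4_def)
qed

text \<open>Each sign occurs at most as often as the deficiency, and both together occur 4
  times.\<close>

lemma ld_V4:
  assumes "lvar l \<in> V4"
  shows "ld G l = 2"
proof -
  have l: "lvar l \<in> var G" "deg G (lvar l) = 4"
    using assms by (auto simp: V4_def)
  have "ld G m \<le> 2" if "lvar m = lvar l" for m
    using SMU_min_deg_ld(4)[OF SMU, of m] that l deg_ge card_G by simp
  from this[of l] this[of "comp l"] have "ld G l \<le> 2" "ld G (comp l) \<le> 2"
    by simp_all
  moreover have "ld G l + ld G (comp l) = 4"
    using deg_eq_ld[OF MU_clauseset[OF MU], of l] l by simp
  ultimately show ?thesis
    by linarith
qed

lemma pair:
  assumes "lvar l \<in> V4"
  obtains A B where "{C \<in> G. l \<in> C} = {A, B}" "A \<noteq> B"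
  using ld_V4[OF assms] by (auto simp: ld_def card_2_iff)

lemma split_V4:
  assumes "lvar l \<in> V4"
  shows "split G l \<in> MU" "var (split G l) = var G - {lvar l}"
    "card (split G l) = card (var (split G l)) + 1" "var (split G l) \<noteq> {}"
proof -
  have l: "lvar l \<in> var G" "deg G (lvar l) = 4"
    using assms by (auto simp: V4_def)
  note s = SMU_min_deg_ld[OF SMU l(1) _ card_G]
  show 1: "split G l \<in> MU" "var (split G l) = var G - {lvar l}"
    using s(1,2) l deg_ge by auto
  show 2: "card (split G l) = card (var (split G l)) + 1"
    using s(3) l deg_ge ld_V4[OF assms] by simp
  obtain A B where AB: "{C \<in> G. comp l \<in> C} = {A, B}" "A \<noteq> B"
    using pair[of "comp l"] assms by auto
  have "l \<notin> C" if "C \<in> {A, B}" for C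
    using that AB(1) MU_clause[OF MU] by (auto simp: is_clause_iff)
  then have "{A - {comp l}, B - {comp l}} \<subseteq> split G l"
    using AB(1) unfolding split_def by blast
  moreover have "A - {comp l} \<noteq> B - {comp l}"
    using split_inj[OF MU, of l] AB by (auto simp: inj_on_def)
  ultimately have "2 \<le> card (split G l)"
    using MU_finite[OF 1(1)] by (metis card_2_iff card_mono)
  then show "var (split G l) \<noteq> {}"
    using 2 by auto
qed

text \<open>Having degree at least 4 in \<open>G\<close>, the variable lost two occurrences, so it
  lies in both removed clauses. Equal signs there would use up both occurrences of a literal that
  still has to occur in the split.\<close>

lemma low_degree_in_pair:
  assumes l: "lvar l \<in> V4" and AB: "{C \<in> G. l \<in> C} = {A, B}" "A \<noteq> B"
    and y: "y \<in> var (split G l)" "deg (split G l) y \<le> 2"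
  obtains z where "lvar z = y" "z \<in> A" "comp z \<in> B" "y \<in> V4"
proof -
  note S = split_V4[OF l]
  have y_ne: "y \<noteq> lvar l" "y \<in> var G"
    using y S(2) by auto
  have d: "deg (split G l) y + card {C \<in> G. l \<in> C \<and> y \<in> var_cl C} = deg G y"
    using deg_split[OF MU y_ne(1)] .
  have sub: "{C \<in> G. l \<in> C \<and> y \<in> var_cl C} \<subseteq> {A, B}"
    using AB by auto
  have "card {A, B} = 2"
    using AB(2) by simp
  then have "card {C \<in> G. l \<in> C \<and> y \<in> var_cl C} \<le> 2"
    using card_mono[OF _ sub] by simp
  then have e: "card {C \<in> G. l \<in> C \<and> y \<in> var_cl C} = 2" "deg G y = 4" 
    using d y(2) deg_ge[OF y_ne(2)] by linarith+
  then have V4: "y \<in> V4"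
    using y_ne by (simp add: V4_def)
  have "{C \<in> G. l \<in> C \<and> y \<in> var_cl C} = {A, B}"
    using sub e(1) \<open>card {A, B} = 2\<close> by (metis card_subset_eq finite.emptyI finite.insertI)
  then have "y \<in> var_cl A" "y \<in> var_cl B"
    by blast+
  then obtain z where z: "z \<in> A" "lvar z = y" and "z \<in> B \<or> comp z \<in> B"
    by (auto simp: var_cl_def lvar_eq_iff)
  moreover have "z \<notin> B"
  proof
    assume "z \<in> B"
    have AG: "A \<in> G" "l \<in> A" "B \<in> G" "l \<in> B"
      using AB by auto
    have "{A, B} \<subseteq> {C \<in> G. z \<in> C}"
      using AG z \<open>z \<in> B\<close> by auto
    moreover have "card {C \<in> G. z \<in> C} = 2"
      using ld_V4[of z] V4 z by (simp add: ld_def)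
    ultimately have "{A, B} = {C \<in> G. z \<in> C}"
      using \<open>card {A, B} = 2\<close> fin(1) by (intro card_subset_eq) auto
    moreover have "0 < ld (split G l) z"
      using MU_ld_pos[OF S(1)] y z by simp
    then obtain C where "C \<in> G" "l \<notin> C" "z \<in> C"
      by (auto simp: ld_def card_gt_0_iff split_def)
    ultimately show False
      using AG by blast
  qed
  ultimately show ?thesis
    using that[of z] V4 by blast
qed

text \<open>Setting \<open>l\<close> to true leaves deficiency 1, hence a variable of degree at most
  2, which lies in both removed clauses; in \<open>{l, m}\<close> only \<open>m\<close> can supply
  it.\<close>

lemma binary_clause:
  assumes C: "{l, m} \<in> G" "lvar l \<noteq> lvar m" and l: "lvar l \<in> V4"
    and B: "B \<in> G" "l \<in> B" "B \<noteq> {l, m}"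
  shows "lvar m \<in> V4" "comp m \<in> B"
proof -
  note S = split_V4[OF l]
  obtain y where y: "y \<in> var (split G l)" "deg (split G l) y \<le> 2"
    using low_degree_variable[OF S(1,4,3)] by auto
  have "{{l, m}, B} \<subseteq> {C \<in> G. l \<in> C}"
    using C(1) B by auto
  moreover have "card {C \<in> G. l \<in> C} = 2" "card {{l, m}, B} = 2"
    using ld_V4[OF l] B(3) by (auto simp: ld_def)
  ultimately have "{{l, m}, B} = {C \<in> G. l \<in> C}"
    using fin(1) by (intro card_subset_eq) auto
  then have "{C \<in> G. l \<in> C} = {{l, m}, B}"
    by (rule sym)
  then obtain z where z: "lvar z = y" "z \<in> {l, m}" "comp z \<in> B" "y \<in> V4"
    using low_degree_in_pair[OF l _ _ y] B(3) by metis
  moreover have "y \<noteq> lvar l"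
    using y S(2) by auto
  ultimately have "z = m"
    by auto
  then show "lvar m \<in> V4" "comp m \<in> B"
    using z by auto
qed

lemma split_clause:
  assumes "E \<in> split G l" "E \<noteq> A - {comp l}" "E \<noteq> B - {comp l}"
    and "{C \<in> G. comp l \<in> C} = {A, B}"
  shows "E \<in> G" "l \<notin> E" "comp l \<notin> E"
proof -
  obtain C where C: "C \<in> G" "l \<notin> C" "E = C - {comp l}"
    using assms(1) by (auto simp: split_def)
  then have "comp l \<notin> C"
    using assms(2-4) by blast
  then show "E \<in> G" "l \<notin> E" "comp l \<notin> E"
    using C by auto
qed

lemma in_split: "E \<in> G \<Longrightarrow> l \<notin> E \<Longrightarrow> comp l \<notin> E \<Longrightarrow> E \<in> split G l"
  by (force simp: split_def)

text \<open>The part \<open>L\<close> is tight, that is, it has as many clauses as variables, and a model of \<open>L\<close>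
  satisfies one of the two clauses containing \<open>comp l\<close>; the remaining clauses of \<open>split G l\<close> would
  have to be unsatisfiable outside of \<open>var L\<close>, which needs a subset of too large deficiency.\<close>

lemma root_separates:
  assumes l: "lvar l \<in> V4" and AB: "{C \<in> G. l \<in> C} = {A, B}" "A \<noteq> B"
    and r: "root_split (split G (comp l)) x L R"
  shows "A - {l} \<notin> R \<or> B - {l} \<notin> R"
proof (rule ccontr)
  assume "\<not> ?thesis"
  then have AR: "A - {l} \<in> R" "B - {l} \<in> R"
    by auto
  define T where "T = split G (comp l)"
  define T' where "T' = split G l"
  have l': "lvar (comp l) \<in> V4"
    using l by simp
  note S = split_V4[OF l', folded T_def]
  note S' = split_V4[OF l, folded T'_def]
  note r = r[folded T_def]
  have LR: "L \<union> R = T" "L \<inter> R = {}"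
    using r by (auto simp: root_split_def)
  have LG: "E \<in> G" "l \<notin> E" "comp l \<notin> E" if "E \<in> L" for E
    using split_clause[of E "comp l" A B] that LR AR AB(1) by (auto simp: T_def)
  \<comment> \<open>A side consisting of the unit \<open>{x}\<close> would be a unit clause of
    \<open>G\<close>.\<close>
  have "var L - {lvar x} \<noteq> {}"
    using root_split_unit[OF S(1,3,4) r] LG(1) no_unit by auto
  then obtain y where y: "y \<in> var L" "y \<noteq> lvar x" "y \<notin> var R" "deg T y \<le> 2"
    using root_split_low_degree[OF S(1,3) r] by auto
  have "y \<in> var T"
    using y(1) LR var_mono[of L T] by blast
  obtain C D where CD: "{E \<in> G. comp l \<in> E} = {C, D}" "C \<noteq> D"
    using pair[OF l'] by blast
  obtain z where z: "lvar z = y" "z \<in> C" "comp z \<in> D"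
    using low_degree_in_pair[OF l' CD] y \<open>y \<in> var T\<close> unfolding T_def by metis
  have "satisfiable L"
    using LR AR by (intro MU_psubset_sat[OF S(1), of _ "A - {l}"]) auto
  then obtain \<tau> where \<tau>: "\<And>E. E \<in> L \<Longrightarrow> \<not> falsif \<tau> E"
    by (auto simp: satisfiable_falsif)
  obtain E m where E: "E \<in> G" "comp l \<in> E" "m \<in> E" "lvar m = y" "lit_true \<tau> m"
  proof (cases "lit_true \<tau> z")
    case True
    then show ?thesis using that[of C z] z CD by blast
  next
    case False
    then show ?thesis using that[of D "comp z"] z CD by auto
  qed
  define E' where "E' = E - {comp l}"
  have lE: "l \<notin> E"
    using MU_clause[OF MU E(1)] E(2) by (auto simp: is_clause_iff)
  then have E'T: "E' \<in> T'"
    using E(1) by (auto simp: T'_def E'_def split_def)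
  have E'L: "E' \<notin> L"
    using MU_antichain[OF MU _ E(1), of E'] LG(1) E(2) by (auto simp: E'_def)
  have LT: "L \<subseteq> T'"
    using LG in_split by (auto simp: T'_def)
  have "y \<noteq> lvar l"
    using \<open>y \<in> var T\<close> S(2) by auto
  then have mE: "m \<in> E'"
    using E by (auto simp: E'_def)
  define P where "P = T' - insert E' L"
  have cs: "is_clauseset T'" "is_clauseset P" "is_clauseset L"
    using MU_clauseset[OF S'(1)] is_clauseset_subset[of T'] LT by (auto simp: P_def)
  have "\<exists>F\<in>P. \<forall>k\<in>F. lvar k \<notin> var L \<longrightarrow> \<not> lit_true \<beta> k" for \<beta>
  proof -
    let ?m = "\<lambda>v. if v \<in> var L then \<tau> v else \<beta> v"
    obtain F where F: "F \<in> T'" "falsif ?m F"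
      using MU_falsified[OF S'(1)] by blast
    have "F \<notin> L"
    proof
      assume "F \<in> L"
      then have "falsif ?m F = falsif \<tau> F"
        unfolding falsif_def lit_true_merge by (simp add: lvar_in_var)
      then show False
        using \<tau> F \<open>F \<in> L\<close> by blast
    qed
    moreover have "F \<noteq> E'"
    proof
      assume "F = E'"
      then have "\<not> lit_true ?m m"
        using F mE by (simp add: falsif_def)
      then show False
        using E(4,5) y(1) unfolding lit_true_merge by simp
    qed
    ultimately show ?thesis
      using F unfolding P_def falsif_def lit_true_merge by (intro bexI[of _ F]) auto
  qed
  from surplus_subset[OF cs(2) this] obtain Q where Q: "Q \<subseteq> P" "card (var Q - var L) < card Q"
    by blast
  have "is_clauseset Q"
    using Q(1) cs(2) is_clauseset_subset by blast
  then have "card (var (L \<union> Q)) \<le> card (var L) + card (var Q - var L)"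
    using card_var_Un_le cs(3) by blast
  moreover have "card (L \<union> Q) = card L + card Q"
    using Q(1) MU_finite[OF S'(1)] LT
    by (intro card_Un_disjoint) (auto simp: P_def intro: finite_subset[of _ T'])
  moreover have "card (var L) \<le> card L"
    using root_split_card[OF S(1,3) r] diff_card_le_card_Diff[of "{lvar x}" "var L"] by simp
  moreover have "card (L \<union> Q) \<le> card (var (L \<union> Q))"
    using Q(1) LT E'T E'L by (intro proper_subset_deficiency[OF S'(1,3)]) (auto simp: P_def)
  ultimately show False
    using Q(2) by linarith
qed

text \<open>The two clauses with \<open>l\<close> lie on different sides of the root of the split at
  \<open>comp l\<close>. If a side is a single unit, its clause with \<open>l\<close> is binary.
  Otherwise each side has a private low-degree variable, and both of these lie in the two clauses
  with \<open>comp l\<close>. Those two clauses tie the values of the two variables together, while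
  the sides can be assigned independently.\<close>

lemma binary_clause_exists:
  assumes l: "lvar l \<in> V4"
  shows "\<exists>m. {l, m} \<in> G \<and> lvar m \<noteq> lvar l"
proof -
  define T where "T = split G (comp l)"
  define T' where "T' = split G l"
  have l': "lvar (comp l) \<in> V4"
    using l by simp
  note S = split_V4[OF l', folded T_def]
  note S' = split_V4[OF l, folded T'_def]
  obtain x L R where r0: "root_split T x L R"
    using root_split_exists[OF S(1,3,4)] by blast
  obtain A0 B0 where AB0: "{C \<in> G. l \<in> C} = {A0, B0}" "A0 \<noteq> B0"
    using pair[OF l] by blast
  have inT: "C - {l} \<in> L \<union> R" if "C \<in> {A0, B0}" for C
  proof -
    have "C \<in> G" "comp l \<notin> C"
      using that AB0(1) MU_clause[OF MU] by (auto simp: is_clause_iff)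
    then show ?thesis
      using r0 by (auto simp: root_split_def T_def split_def)
  qed
  have "\<exists>A B. {C \<in> G. l \<in> C} = {A, B} \<and> A \<noteq> B \<and> A - {l} \<in> L \<and> B - {l} \<in> R"
  proof -
    have "A0 - {l} \<notin> R \<or> B0 - {l} \<notin> R"
      using root_separates[OF l AB0] r0 unfolding T_def by blast
    moreover have "A0 - {l} \<notin> L \<or> B0 - {l} \<notin> L"
      using root_separates[OF l AB0] root_split_sym[OF r0] unfolding T_def by blast
    ultimately consider "A0 - {l} \<in> L" "B0 - {l} \<in> R" | "B0 - {l} \<in> L" "A0 - {l} \<in> R"
      using inT by blast
    then show ?thesis
    proof cases
      case 1
      then show ?thesis using AB0 by blast
    next
      case 2
      moreover have "{C \<in> G. l \<in> C} = {B0, A0}"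
        unfolding AB0(1) by (rule insert_commute)
      ultimately show ?thesis
        using AB0(2) by blast
    qed
  qed
  then obtain A B where AB: "{C \<in> G. l \<in> C} = {A, B}" "A \<noteq> B" "A - {l} \<in> L" "B - {l} \<in> R"
    by blast
  have xl: "lvar x \<noteq> lvar l" if "x \<in> \<Union>T \<or> comp x \<in> \<Union>T"
    using that S(2) by (metis Diff_iff UnionE insertI1 lvar_comp lvar_in_var)
  have inG: "insert l (A - {l}) \<in> G" "insert l (B - {l}) \<in> G"
    using AB(1) by (auto simp: insert_absorb)
  have LR: "L \<union> R = T" "L \<inter> R = {}"
    using r0 by (auto simp: root_split_def)
  consider "var L - {lvar x} = {}" | "var R - {lvar x} = {}"
    | "var L - {lvar x} \<noteq> {}" "var R - {lvar x} \<noteq> {}"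
    by blast
  then show ?thesis
  proof cases
    case 1
    have "L = {{x}}"
      using root_split_unit[OF S(1,3,4) r0 1] .
    then show ?thesis
      using AB(3) inG(1) xl LR by (intro exI[of _ x]) auto
  next
    case 2
    have "R = {{comp x}}"
      using root_split_unit[OF S(1,3,4) root_split_sym[OF r0]] 2 by simp
    then show ?thesis
      using AB(4) inG(2) xl LR by (intro exI[of _ "comp x"]) auto
  next
    case 3
    obtain y1 where y1: "y1 \<in> var L - {lvar x}" "deg T y1 \<le> 2"
      using root_split_low_degree[OF S(1,3) r0 3(1)] by blast
    obtain y2 where y2: "y2 \<in> var R" "y2 \<notin> var L" "deg T y2 \<le> 2"
      using root_split_low_degree[OF S(1,3) root_split_sym[OF r0]] 3(2) by auto
    have y12: "y1 \<in> var T" "y2 \<in> var T"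
      using y1 y2 LR var_mono[of L T] var_mono[of R T] by auto
    obtain C D where CD: "{E \<in> G. comp l \<in> E} = {C, D}" "C \<noteq> D"
      using pair[OF l'] by blast
    obtain z1 where z1: "lvar z1 = y1" "z1 \<in> C" "comp z1 \<in> D"
      using low_degree_in_pair[OF l' CD] y1 y12 unfolding T_def by metis
    obtain z2 where z2: "lvar z2 = y2" "z2 \<in> C" "comp z2 \<in> D"
      using low_degree_in_pair[OF l' CD] y2 y12 unfolding T_def by metis
    let ?A = "A - {l}" and ?B = "B - {l}" and ?C = "C - {comp l}" and ?D = "D - {comp l}"
    have zl: "lvar z1 \<noteq> lvar l" "lvar z2 \<noteq> lvar l"
      using y12 S(2) z1 z2 by auto
    then have z': "z1 \<in> ?C" "z2 \<in> ?C" "comp z1 \<in> ?D" "comp z2 \<in> ?D"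
      using z1 z2 by auto
    have TT': "E \<in> T'" if "E \<in> T" "E \<noteq> ?A" "E \<noteq> ?B" for E
      using split_clause[of E "comp l" A B] that AB(1) in_split[of E l] by (simp add: T_def T'_def)
    have T'T: "E \<in> T" "E \<noteq> ?A" "E \<noteq> ?B" if "E \<in> T'" "E \<noteq> ?C" "E \<noteq> ?D" for E
    proof -
      have E: "E \<in> G" "l \<notin> E" "comp l \<notin> E"
        using split_clause[of E l C D] that CD(1) by (simp_all add: T'_def)
      then show "E \<in> T"
        using in_split[of E "comp l"] by (simp add: T_def)
      have "A \<in> G" "B \<in> G" "l \<in> A" "l \<in> B"
        using AB(1) by auto
      then show "E \<noteq> ?A" "E \<noteq> ?B"
        using MU_antichain[OF MU E(1), of A] MU_antichain[OF MU E(1), of B] E(2) by auto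
    qed
    \<comment> \<open>The assignments satisfying all clauses without the variable of
      \<open>l\<close>, which are common to both splits.\<close>
    define M where "M = (\<lambda>\<beta>. \<forall>E\<in>T. E \<noteq> ?A \<longrightarrow> E \<noteq> ?B \<longrightarrow> \<not> falsif \<beta> E)"
    \<comment> \<open>The split at \<open>l\<close> is unsatisfiable, so one of the reduced
      \<open>C\<close> and \<open>D\<close> is falsified, and either one gives both literals the
      same value.\<close>
    have eq: "lit_true \<beta> z1 = lit_true \<beta> z2" if "M \<beta>" for \<beta>
    proof -
      obtain E where E: "E \<in> T'" "falsif \<beta> E"
        using MU_falsified[OF S'(1)] by blast
      then have "E = ?C \<or> E = ?D"
        using T'T[of E] that by (auto simp: M_def)
      then show ?thesis
        using E(2) z' unfolding falsif_def by (metis lit_true_comp)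
    qed
    have CDT': "?C \<in> T'" "?D \<in> T'" "?C \<noteq> ?D"
    proof -
      have "C \<in> G" "D \<in> G" "l \<notin> C" "l \<notin> D"
        using CD(1) MU_clause[OF MU] by (auto simp: is_clause_iff)
      then show "?C \<in> T'" "?D \<in> T'" "?C \<noteq> ?D"
        using CD(2) split_inj[OF MU, of l] by (auto simp: T'_def split_def inj_on_def)
    qed
    \<comment> \<open>Private assignments of the two reduced clauses realize both values.\<close>
    have both: "\<exists>\<beta>. M \<beta> \<and> lit_true \<beta> z1 = b" for b
    proof -
      define E where "E = (if b then ?D else ?C)"
      have "E \<in> T'"
        using CDT' by (simp add: E_def)
      then obtain \<beta> where b: "falsif \<beta> E" "\<And>F. F \<in> T' \<Longrightarrow> F \<noteq> E \<Longrightarrow> \<not> falsif \<beta> F"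
        using MU_private[OF S'(1)] by metis
      have "E \<notin> T \<or> E = ?A \<or> E = ?B"
      proof (rule ccontr)
        assume "\<not> ?thesis"
        then have "E \<in> G"
          using split_clause(1)[of E "comp l" A B] AB(1) by (simp add: T_def)
        moreover have "C \<in> G" "D \<in> G" "comp l \<in> C" "comp l \<in> D"
          using CD(1) by auto
        ultimately show False
          using MU_antichain[OF MU, of E C] MU_antichain[OF MU, of E D] by (auto simp: E_def split: if_splits)
      qed
      then have "M \<beta>"
        using b(2) TT' unfolding M_def by metis
      moreover have "lit_true \<beta> z1 = b"
        using b(1) z'(1,3) unfolding E_def falsif_def by (metis (full_types) lit_true_comp)
      ultimately show ?thesis
        by blast
    qed
    obtain \<alpha>1 where a1: "falsif \<alpha>1 ?A" "\<And>E. E \<in> T \<Longrightarrow> E \<noteq> ?A \<Longrightarrow> \<not> falsif \<alpha>1 E"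
      using MU_private[OF S(1), of ?A] AB(3) LR by blast
    have x1: "\<not> lit_true \<alpha>1 x"
    proof
      assume "lit_true \<alpha>1 x"
      then obtain E where "E \<in> R" "falsif \<alpha>1 E"
        using r0 by (auto simp: root_split_def)
      then show False
        using a1(2)[of E] AB(3) LR by blast
    qed
    \<comment> \<open>The variables private to \<open>L\<close> take their values from
      \<open>\<alpha>\<close>, the others from \<open>\<beta>\<close>. Applying \<open>eq\<close> to
      the mixture links \<open>z1\<close> under the former with \<open>z2\<close> under the
      latter.\<close>
    have mix: "lit_true \<alpha> z1 = lit_true \<beta> z2"
      if "\<not> lit_true \<alpha> x" "M \<alpha>" "M \<beta>" for \<alpha> \<beta>
    proof -
      let ?m = "\<lambda>v. if v \<in> var L - {lvar x} then \<alpha> v else \<beta> v"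
      have LB: "E \<in> T" "E \<noteq> ?B" if "E \<in> L" for E
        using that LR AB(4) by auto
      have RA: "E \<in> T" "E \<noteq> ?A" if "E \<in> R" for E
        using that LR AB(3) by auto
      have "\<not> falsif \<alpha> E" if "E \<in> L" "E \<noteq> ?A" for E
        using \<open>M \<alpha>\<close> that(2) LB[OF that(1)] by (simp add: M_def)
      moreover have "\<not> falsif \<beta> E" if "E \<in> R" "E \<noteq> ?B" for E
        using \<open>M \<beta>\<close> that(2) RA[OF that(1)] by (simp add: M_def)
      ultimately have "\<not> falsif ?m E" if "E \<in> T" "E \<noteq> ?A" "E \<noteq> ?B" for E
        using root_split_mix[OF r0 \<open>\<not> lit_true \<alpha> x\<close>, of ?A ?B \<beta> E] that by blast
      then have "M ?m"
        by (simp add: M_def)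
      from eq[OF this] show ?thesis
        unfolding lit_true_merge using y1(1) y2(2) z1(1) z2(1) by simp
    qed
    have "M \<alpha>1"
      using a1(2) by (auto simp: M_def)
    obtain \<beta> where \<beta>: "M \<beta>" "lit_true \<beta> z1 = (\<not> lit_true \<alpha>1 z1)"
      using both by blast
    have "lit_true \<alpha>1 z1 = lit_true \<beta> z2"
      using mix[OF x1 \<open>M \<alpha>1\<close> \<beta>(1)] .
    then show ?thesis
      using eq[OF \<beta>(1)] \<beta>(2) by simp
  qed
qed

text \<open>The second literals must be complementary. Setting \<open>l\<close> to false then leaves
  two contradictory units, so \<open>G\<close> has only two variables, both of degree 4.\<close>

lemma two_binary_clauses:
  assumes l: "lvar l \<in> V4" and m: "{l, m} \<in> G" "lvar m \<noteq> lvar l"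
    and k: "{l, k} \<in> G" "lvar k \<noteq> lvar l" and "m \<noteq> k"
  shows "var G \<subseteq> V4"
proof -
  have "{l, k} \<noteq> {l, m}"
    using \<open>m \<noteq> k\<close> by (auto simp: doubleton_eq_iff)
  then have b: "lvar m \<in> V4" "comp m \<in> {l, k}"
    using binary_clause[OF m(1) _ l k(1)] m(2) by auto
  then have "k = comp m"
    using m(2) by auto
  have l': "lvar (comp l) \<in> V4"
    using l by simp
  note S = split_V4[OF l']
  have "{{m}, {comp m}} \<subseteq> split G (comp l)"
  proof -
    have "{l, m} - {l} = {m}" "{l, k} - {l} = {comp m}"
      using m(2) k(2) \<open>k = comp m\<close> by auto
    moreover have "comp l \<notin> {l, m}" "comp l \<notin> {l, k}"
      using m(2) k(2) by (auto simp: lvar_eq_iff)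
    ultimately show ?thesis
      using m(1) k(1) image_eqI[of "{m}" "\<lambda>C. C - {l}" "{l, m}"] image_eqI[of "{comp m}" "\<lambda>C. C - {l}" "{l, k}"]
      by (simp add: split_def)
  qed
  moreover have "\<not> satisfiable {{m}, {comp m}}"
    by (auto simp: satisfiable_def)
  ultimately have "split G (comp l) = {{m}, {comp m}}"
    using MU_psubset_sat[OF S(1)] by blast
  then have "var (split G (comp l)) = {lvar m}"
    by (simp add: var_def var_cl_def)
  then have "var G - {lvar l} = {lvar m}"
    using S(2) by simp
  then have "var G \<subseteq> {lvar l, lvar m}"
    by blast
  then show ?thesis
    using l b(1) by blast
qed

end

section \<open>Contracting an implication cycle\<close>

locale deficiency_two_large = deficiency_two +
  assumes not_V4: "\<not> var G \<subseteq> V4"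
begin

definition \<rho> :: "lit \<Rightarrow> lit" where
  "\<rho> l = (SOME m. {l, m} \<in> G \<and> lvar m \<noteq> lvar l)"

definition long :: "lit \<Rightarrow> clause" where
  "long l = (SOME C. C \<in> G \<and> l \<in> C \<and> C \<noteq> {l, \<rho> l})"

lemma \<rho>: "lvar l \<in> V4 \<Longrightarrow> {l, \<rho> l} \<in> G" "lvar l \<in> V4 \<Longrightarrow> lvar (\<rho> l) \<noteq> lvar l"
  using someI_ex[OF binary_clause_exists[of l]] by (auto simp: \<rho>_def)

lemma \<rho>_unique: "lvar l \<in> V4 \<Longrightarrow> {l, m} \<in> G \<Longrightarrow> lvar m \<noteq> lvar l \<Longrightarrow> m = \<rho> l"
  using two_binary_clauses[OF _ _ _ \<rho>] not_V4 by metis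

lemma clauses_V4:
  assumes l: "lvar l \<in> V4"
  shows "long l \<in> G" "l \<in> long l" "long l \<noteq> {l, \<rho> l}"
    "C \<in> G \<Longrightarrow> l \<in> C \<Longrightarrow> C = {l, \<rho> l} \<or> C = long l"
proof -
  obtain A B where AB: "{C \<in> G. l \<in> C} = {A, B}" "A \<noteq> B"
    using pair[OF l] by blast
  have "{l, \<rho> l} \<in> {C \<in> G. l \<in> C}"
    using \<rho>(1)[OF l] by simp
  then have in_AB: "{l, \<rho> l} = A \<or> {l, \<rho> l} = B"
    unfolding AB(1) by simp
  have "A \<in> {C \<in> G. l \<in> C}" "B \<in> {C \<in> G. l \<in> C}"
    unfolding AB(1) by simp_all
  then have "\<exists>C. C \<in> G \<and> l \<in> C \<and> C \<noteq> {l, \<rho> l}"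
    using AB(2) by (metis (no_types, lifting) mem_Collect_eq)
  then have L: "long l \<in> G \<and> l \<in> long l \<and> long l \<noteq> {l, \<rho> l}"
    unfolding long_def by (rule someI_ex)
  then show "long l \<in> G" "l \<in> long l" "long l \<noteq> {l, \<rho> l}"
    by auto
  have "long l \<in> {C \<in> G. l \<in> C}"
    using L by simp
  then have "long l = A \<or> long l = B"
    unfolding AB(1) by simp
  moreover assume "C \<in> G" "l \<in> C"
  then have "C \<in> {C \<in> G. l \<in> C}"
    by simp
  then have "C = A \<or> C = B"
    unfolding AB(1) by simp
  ultimately show "C = {l, \<rho> l} \<or> C = long l"
    using L in_AB by metis
qed

lemma \<rho>_V4:
  assumes l: "lvar l \<in> V4"
  shows "lvar (\<rho> l) \<in> V4" "comp (\<rho> l) \<in> long l"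
  using binary_clause[OF \<rho>(1)[OF l] _ l clauses_V4(1-3)[OF l]] \<rho>(2)[OF l] by auto

lemma \<rho>_\<rho>:
  assumes l: "lvar l \<in> V4"
  shows "\<rho> (\<rho> l) = l"
  using \<rho>_unique[OF \<rho>_V4(1)[OF l], of l] \<rho>[OF l] by (simp add: insert_commute)

text \<open>The clause \<open>{l, \<rho> l}\<close> is the implication from
  \<open>next_lit l\<close> to \<open>l\<close>.\<close>

definition next_lit :: "lit \<Rightarrow> lit" where
  "next_lit l = comp (\<rho> l)"

lemma lvar_next: "lvar l \<in> V4 \<Longrightarrow> lvar (next_lit l) \<in> V4"
  by (simp add: next_lit_def \<rho>_V4)

text \<open>The long clause contains \<open>next_lit l\<close> and is not its binary clause, since
  it would then be a second binary clause containing \<open>l\<close>. So one long clause serves a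
  whole cycle.\<close>

lemma long_next:
  assumes l: "lvar l \<in> V4"
  shows "long (next_lit l) = long l"
proof -
  have n: "lvar (next_lit l) \<in> V4" "next_lit l \<in> long l"
    using l by (auto simp: lvar_next next_lit_def \<rho>_V4)
  have "long l \<noteq> {next_lit l, \<rho> (next_lit l)}"
  proof
    assume e: "long l = {next_lit l, \<rho> (next_lit l)}"
    then have "l \<in> {next_lit l, \<rho> (next_lit l)}"
      using clauses_V4(2)[OF l] by simp
    moreover have "l \<noteq> next_lit l"
      using \<rho>(2)[OF l] by (metis lvar_comp next_lit_def)
    ultimately have "{l, next_lit l} \<in> G"
      using e clauses_V4(1)[OF l] by (simp add: insert_commute)
    then have "next_lit l = \<rho> l"
      using \<rho>(2)[OF l] by (intro \<rho>_unique[OF l]) (simp_all add: next_lit_def)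
    then show False
      by (simp add: next_lit_def)
  qed
  then show ?thesis
    using clauses_V4(4)[OF n(1) clauses_V4(1)[OF l] n(2)] by blast
qed

lemma next_inj: "inj_on next_lit {l. lvar l \<in> V4}"
  by (rule inj_onI) (metis \<rho>_\<rho> comp_eq_iff mem_Collect_eq next_lit_def)

text \<open>Setting one literal of \<open>Q\<close> to true forces all of \<open>Q\<close>, along the binary clauses.\<close>

lemma minimal_cycle:
  obtains Q b0 b1 where "Q \<noteq> {}" "finite Q" "\<And>q. q \<in> Q \<Longrightarrow> lvar q \<in> V4"
    "\<And>q. q \<in> Q \<Longrightarrow> long q = b0" "\<And>q. q \<in> Q \<Longrightarrow> long (comp q) = b1"
    "next_lit ` Q = Q" "\<And>P. P \<subseteq> Q \<Longrightarrow> P \<noteq> {} \<Longrightarrow> next_lit ` P \<subseteq> P \<Longrightarrow> P = Q"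
proof -
  obtain v where "v \<in> V4"
    using V4_nonempty by blast
  define l where "l = Pos v"
  \<comment> \<open>Closed under \<open>next_lit\<close>, since the long clause is constant along a
    cycle; the complements form a cycle in the reverse direction.\<close>
  define K where "K = {q. lvar q \<in> V4 \<and> long q = long l \<and> long (comp q) = long (comp l)}"
  have "{q. lvar q \<in> V4} \<subseteq> Pos ` V4 \<union> Neg ` V4"
  proof
    fix q assume "q \<in> {q. lvar q \<in> V4}" then show "q \<in> Pos ` V4 \<union> Neg ` V4" by (cases q) auto
  qed
  moreover have "finite V4"
    using fin(2) V4_var by (auto intro: finite_subset)
  ultimately have "finite K"
    by (auto simp: K_def intro: finite_subset)
  have "next_lit ` K \<subseteq> K"
  proof (rule image_subsetI)
    fix q assume q: "q \<in> K"
    then have V: "lvar q \<in> V4"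
      by (simp add: K_def)
    have "next_lit (\<rho> q) = comp q"
      by (simp add: next_lit_def \<rho>_\<rho>[OF V])
    then have "long (comp q) = long (comp (next_lit q))"
      using long_next[OF \<rho>_V4(1)[OF V]] by (simp add: next_lit_def)
    then show "next_lit q \<in> K"
      using q lvar_next[OF V] long_next[OF V] by (simp add: K_def)
  qed
  moreover have "l \<in> K"
    using \<open>v \<in> V4\<close> by (simp add: K_def l_def)
  ultimately have "K \<subseteq> K \<and> K \<noteq> {} \<and> next_lit ` K \<subseteq> K"
    by blast
  \<comment> \<open>A smallest nonempty closed set is a single orbit; minimality replaces iterating
    \<open>next_lit\<close>.\<close>
  then obtain Q where "Q \<subseteq> K \<and> Q \<noteq> {} \<and> next_lit ` Q \<subseteq> Q"
    and least: "\<forall>P. P \<subseteq> K \<and> P \<noteq> {} \<and> next_lit ` P \<subseteq> P \<longrightarrow> card Q \<le> card P"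
    using ex_has_least_nat[of "\<lambda>P. P \<subseteq> K \<and> P \<noteq> {} \<and> next_lit ` P \<subseteq> P" K card] by metis
  then have Q: "Q \<subseteq> K" "Q \<noteq> {}" "next_lit ` Q \<subseteq> Q"
    and min: "\<And>P. P \<subseteq> K \<Longrightarrow> P \<noteq> {} \<Longrightarrow> next_lit ` P \<subseteq> P \<Longrightarrow> card Q \<le> card P"
    by simp_all
  have finQ: "finite Q"
    using Q(1) \<open>finite K\<close> finite_subset by blast
  show ?thesis
  proof (rule that[of Q "long l" "long (comp l)"])
    have "inj_on next_lit Q"
      using Q(1) by (intro inj_on_subset[OF next_inj]) (auto simp: K_def)
    then show "next_lit ` Q = Q"
      using Q(3) finQ endo_inj_surj by blast
    show "P = Q" if P: "P \<subseteq> Q" "P \<noteq> {}" "next_lit ` P \<subseteq> P" for P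
    proof -
      have "card Q \<le> card P"
        using P Q(1) by (intro min) auto
      then show ?thesis
        by (rule card_seteq[OF finQ P(1)])
    qed
  qed (use Q finQ in \<open>auto simp: K_def\<close>)
qed

text \<open>The clauses touching the cycle are \<open>card Q\<close> binary ones and the long
  clauses \<open>b0\<close> and \<open>b1\<close>. Making all of \<open>Q\<close> true satisfies the
  binary clauses and \<open>b0\<close> and reduces \<open>b1\<close> to \<open>\<gamma>\<close>.
  Contracting the cycle in this way leaves deficiency 1 and degrees at least 3, which is
  impossible.\<close>

lemma contradiction: False
proof -
  obtain Q b0 b1 where Q: "Q \<noteq> {}" "finite Q" "\<And>q. q \<in> Q \<Longrightarrow> lvar q \<in> V4"
    and b0: "\<And>q. q \<in> Q \<Longrightarrow> long q = b0" and b1: "\<And>q. q \<in> Q \<Longrightarrow> long (comp q) = b1"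
    and img: "next_lit ` Q = Q"
    and min: "\<And>P. P \<subseteq> Q \<Longrightarrow> P \<noteq> {} \<Longrightarrow> next_lit ` P \<subseteq> P \<Longrightarrow> P = Q"
    using minimal_cycle by metis
  have b0G: "b0 \<in> G" "q \<in> b0" if "q \<in> Q" for q
    using clauses_V4[of q] Q(3) b0 that by auto
  have b1G: "b1 \<in> G" "comp q \<in> b1" if "q \<in> Q" for q
    using clauses_V4[of "comp q"] Q(3)[of q] b1[of q] that by auto
  have cons: "comp q \<notin> Q" if "q \<in> Q" for q
    using b0G(1)[OF that] b0G(2)[OF that] b0G(2)[of "comp q"] MU_clause[OF MU, of b0]
    by (metis is_clause_iff)
  have \<rho>Q: "comp (\<rho> q) \<in> Q" if "q \<in> Q" for q
    using img that by (auto simp: next_lit_def)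
  have pred: "\<exists>p\<in>Q. comp q = \<rho> p \<and> \<rho> (comp q) = p" if "q \<in> Q" for q
  proof -
    have "q \<in> next_lit ` Q"
      unfolding img by (rule that)
    then obtain p where p: "p \<in> Q" "q = next_lit p"
      by (rule imageE)
    have "comp q = \<rho> p"
      unfolding p(2) next_lit_def by simp
    moreover have "\<rho> (\<rho> p) = p"
      by (rule \<rho>_\<rho>[OF Q(3)[OF p(1)]])
    ultimately have "comp q = \<rho> p" "\<rho> (comp q) = p"
      by simp_all
    then show ?thesis
      using p(1) by blast
  qed
  define Bin where "Bin = (\<lambda>q. {q, \<rho> q}) ` Q"
  have touch: "C \<in> Bin \<or> C = b0 \<or> C = b1" if C: "C \<in> G" "m \<in> C" "lvar m \<in> lvar ` Q" for C m
  proof -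
    obtain q where q: "q \<in> Q" "m = q \<or> m = comp q"
      using C(3) by (auto simp: lvar_eq_iff)
    from q(2) show ?thesis
    proof
      assume "m = q"
      then show ?thesis
        using clauses_V4(4)[OF Q(3)[OF q(1)] C(1)] C(2) b0 q(1) by (auto simp: Bin_def)
    next
      assume m: "m = comp q"
      have V: "lvar (comp q) \<in> V4"
        using Q(3)[OF q(1)] by simp
      obtain p where p: "p \<in> Q" "comp q = \<rho> p" "\<rho> (comp q) = p"
        using pred[OF q(1)] by blast
      have "C = {comp q, \<rho> (comp q)} \<or> C = b1"
        using clauses_V4(4)[OF V C(1)] C(2) b1 q(1) m by auto
      moreover have "{comp q, \<rho> (comp q)} = {p, \<rho> p}"
        using p by auto
      ultimately show ?thesis
        using p(1) by (auto simp: Bin_def)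
    qed
  qed
  have BinG: "Bin \<subseteq> G"
    using \<rho>(1) Q(3) by (auto simp: Bin_def)
  have inj_Bin: "inj_on (\<lambda>q. {q, \<rho> q}) Q"
  proof (rule inj_onI)
    fix q p assume op: "q \<in> Q" "p \<in> Q" "{q, \<rho> q} = {p, \<rho> p}"
    have "q \<noteq> \<rho> p"
      using \<rho>Q[OF op(2)] cons[OF op(1)] by auto
    then show "q = p"
      using op(3) by auto
  qed
  have "b0 \<notin> Bin"
  proof
    assume "b0 \<in> Bin"
    then obtain q where q: "q \<in> Q" "b0 = {q, \<rho> q}"
      by (auto simp: Bin_def)
    show False
      using clauses_V4(3)[OF Q(3)[OF q(1)]] b0[OF q(1)] q(2) by simp
  qed
  have "b1 \<notin> Bin"
  proof
    assume "b1 \<in> Bin"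
    then obtain q where q: "q \<in> Q" "b1 = {q, \<rho> q}"
      by (auto simp: Bin_def)
    have V: "lvar q \<in> V4"
      using Q(3) q(1) .
    have "long (\<rho> q) = b1"
      using b1[OF \<rho>Q[OF q(1)]] by simp
    then show False
      using clauses_V4(3)[OF \<rho>_V4(1)[OF V]] q(2) \<rho>_\<rho>[OF V] by auto
  qed
  obtain o0 where o0: "o0 \<in> Q"
    using Q(1) by blast
  have "b0 \<noteq> b1"
    using b0G[OF o0] b1G[OF o0] MU_clause[OF MU, of b0] by (metis is_clause_iff)
  have b1_out: "m \<notin> Q" if "m \<in> b1" for m
  proof
    assume m: "m \<in> Q"
    then have "b1 = {m, \<rho> m} \<or> b1 = b0"
      using clauses_V4(4)[OF Q(3)[OF m] b1G(1)[OF o0] that] b0[OF m] by simp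
    then show False
      using m \<open>b1 \<notin> Bin\<close> \<open>b0 \<noteq> b1\<close> by (auto simp: Bin_def)
  qed
  define Rest where "Rest = G - insert b0 (insert b1 Bin)"
  define V where "V = lvar ` Q"
  define \<gamma> where "\<gamma> = {m \<in> b1. lvar m \<notin> V}"
  define H where "H = insert \<gamma> Rest"
  have cardV: "card V = card Q"
    unfolding V_def using cons by (intro card_image inj_onI) (auto simp: lvar_eq_iff)
  have VG: "V \<subseteq> V4"
    using Q(3) by (auto simp: V_def)
  have finB: "finite Bin" "card Bin = card Q"
    using Q(2) inj_Bin by (auto simp: Bin_def card_image)
  have "card (insert b0 (insert b1 Bin)) = card Q + 2"
    using finB \<open>b0 \<notin> Bin\<close> \<open>b1 \<notin> Bin\<close> \<open>b0 \<noteq> b1\<close> by simp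
  moreover have sub: "insert b0 (insert b1 Bin) \<subseteq> G"
    using BinG b0G(1)[OF o0] b1G(1)[OF o0] by auto
  ultimately have "card Rest + (card Q + 2) = card G"
    unfolding Rest_def using fin(1) card_mono[OF fin(1) sub] by (subst card_Diff_subset) (auto intro: finite_subset)
  moreover have "V \<subseteq> var G"
    using VG V4_var by blast
  then have "card (var G - V) + card V = card (var G)"
    using fin(2) card_mono[of "var G" V] finite_subset[of V "var G"] by (simp add: card_Diff_subset)
  ultimately have card_Rest: "card Rest = card (var G - V)"
    using card_G cardV by linarith
  have Rest_out: "lvar m \<notin> V" if "C \<in> Rest" "m \<in> C" for C m
    using touch[of C m] that by (auto simp: Rest_def V_def)
  define sett where "sett = (\<lambda>\<beta> v. if Pos v \<in> Q then True else if Neg v \<in> Q then False else \<beta> v)"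
  have sett: "lit_true (sett \<beta>) m = (if lvar m \<in> V then m \<in> Q else lit_true \<beta> m)" for \<beta> m
  proof (cases m)
    case (Pos v)
    then show ?thesis
      by (auto simp: sett_def V_def image_iff) (metis lvar.simps lit.exhaust)+
  next
    case (Neg v)
    have "Neg v \<in> Q \<Longrightarrow> Pos v \<notin> Q"
      using cons[of "Neg v"] by simp
    then show ?thesis
      using Neg by (auto simp: sett_def V_def image_iff) (metis lvar.simps lit.exhaust)+
  qed
  have RestG: "Rest \<subseteq> G" "b0 \<notin> Rest" "b1 \<notin> Rest"
    by (auto simp: Rest_def)
  have sat_Rest: "satisfiable Rest"
    using MU_psubset_sat[OF MU RestG(1) b0G(1)[OF o0] RestG(2)] .
  have uns: "\<exists>C\<in>H. falsif \<beta> C" for \<beta>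
  proof (rule ccontr)
    assume "\<not> ?thesis"
    then have s: "\<not> falsif \<beta> \<gamma>" "\<And>C. C \<in> Rest \<Longrightarrow> \<not> falsif \<beta> C"
      by (auto simp: H_def)
    obtain C where C: "C \<in> G" "falsif (sett \<beta>) C"
      using MU_falsified[OF MU] by blast
    have "C \<noteq> b0"
      using C(2) b0G(2)[OF o0] o0 by (auto simp: falsif_def sett V_def)
    moreover have "C \<notin> Bin"
      using C(2) by (auto simp: falsif_def sett V_def Bin_def)
    moreover have "C \<noteq> b1"
      using C(2) s(1) by (auto simp: falsif_def sett \<gamma>_def)
    ultimately have "C \<in> Rest"
      using C(1) by (auto simp: Rest_def)
    then have "falsif (sett \<beta>) C = falsif \<beta> C"
      using Rest_out by (intro falsif_cong) (auto simp: sett)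
    then show False
      using C(2) s(2) \<open>C \<in> Rest\<close> by blast
  qed
  have new: "\<gamma> \<notin> Rest"
    using uns sat_Rest by (auto simp: H_def satisfiable_falsif insert_absorb)
  have cs: "is_clauseset H"
    using MU_clauseset[OF MU] is_clauseset_subset[OF _ RestG(1)] is_clause_subset[of b1 \<gamma>] b1G(1)[OF o0]
    by (auto simp: H_def is_clauseset_def \<gamma>_def)
  have minH: "satisfiable (H - {E})" if E: "E \<in> H" for E
  proof (cases "E = \<gamma>")
    case True
    then show ?thesis
      using sat_Rest satisfiable_subset[of Rest "H - {E}"] by (auto simp: H_def)
  next
    case False
    then have ER: "E \<in> Rest"
      using E by (auto simp: H_def)
    \<comment> \<open>Saturation gives an assignment in which only \<open>E\<close> is falsified and
      one cycle literal is true. The implications make all of \<open>Q\<close> true, so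
      \<open>b1\<close> must be satisfied by a literal of \<open>\<gamma>\<close>.\<close>
    have "o0 \<notin> E" "comp o0 \<notin> E"
      using Rest_out[OF ER] o0 by (force simp: V_def)+
    moreover have "lvar o0 \<in> var G"
      using Q(3)[OF o0] V4_var by blast
    ultimately obtain \<beta> where b: "lit_true \<beta> o0" "\<And>D. D \<in> G \<Longrightarrow> D \<noteq> E \<Longrightarrow> \<not> falsif \<beta> D"
      using SMU_witness[OF SMU, of E o0] ER RestG(1) by blast
    define P where "P = {q \<in> Q. \<not> lit_true \<beta> q}"
    have "next_lit ` P \<subseteq> P"
    proof (rule image_subsetI)
      fix q assume q: "q \<in> P"
      then have oO: "q \<in> Q" and "\<not> lit_true \<beta> q"
        by (auto simp: P_def)
      have "{q, \<rho> q} \<in> Bin"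
        using oO by (auto simp: Bin_def)
      then have "\<not> falsif \<beta> {q, \<rho> q}"
        using b(2) BinG ER by (auto simp: Rest_def)
      then have "lit_true \<beta> (\<rho> q)"
        using \<open>\<not> lit_true \<beta> q\<close> by (auto simp: falsif_def)
      then show "next_lit q \<in> P"
        using \<rho>Q[OF oO] by (auto simp: P_def next_lit_def)
    qed
    moreover have "P \<noteq> Q" "P \<subseteq> Q"
      using b(1) o0 by (auto simp: P_def)
    ultimately have "P = {}"
      using min by blast
    have "b1 \<noteq> E"
      using ER by (auto simp: Rest_def)
    then obtain m where m: "m \<in> b1" "lit_true \<beta> m"
      using b(2) b1G(1)[OF o0] by (auto simp: falsif_def)
    have "lvar m \<notin> V"
    proof
      assume "lvar m \<in> V"
      then have "comp m \<in> Q"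
        using b1_out[OF m(1)] by (auto simp: V_def lvar_eq_iff)
      then show False
        using \<open>P = {}\<close> m(2) by (auto simp: P_def)
    qed
    then have "\<not> falsif \<beta> \<gamma>"
      using m by (auto simp: falsif_def \<gamma>_def)
    then have "\<forall>C\<in>H - {E}. \<not> falsif \<beta> C"
      using b(2) RestG(1) by (auto simp: H_def)
    then show ?thesis
      by (auto simp: satisfiable_falsif)
  qed
  have HMU: "H \<in> MU"
    using cs uns minH by (auto simp: MU_def satisfiable_falsif)
  \<comment> \<open>A variable off the cycle can lose only its occurrence in \<open>b0\<close>; that
    in \<open>b1\<close> survives in \<open>\<gamma>\<close>.\<close>
  have deg_H: "deg G z \<le> deg H z + 1" if z: "z \<in> var G - V" for z
  proof -
    have nB: "z \<notin> var_cl C" if "C \<in> Bin" for C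
    proof -
      obtain q where q: "q \<in> Q" "C = {q, \<rho> q}"
        using \<open>C \<in> Bin\<close> by (auto simp: Bin_def)
      then have "lvar (\<rho> q) \<in> V"
        using \<rho>Q[OF q(1)] by (metis V_def imageI lvar_comp)
      then show ?thesis
        using q z by (auto simp: var_cl_def V_def)
    qed
    define Y where "Y = {C \<in> Rest. z \<in> var_cl C}"
    define W where "W = (if z \<in> var_cl b1 then {b1} else {})"
    have "{C \<in> G. z \<in> var_cl C} \<subseteq> insert b0 (W \<union> Y)"
      using nB by (auto simp: Y_def W_def Rest_def)
    then have "deg G z \<le> card (insert b0 (W \<union> Y))"
      unfolding deg_def using fin(1) RestG(1)
      by (intro card_mono) (auto simp: Y_def W_def intro: finite_subset)
    also have "\<dots> \<le> Suc (card (W \<union> Y))"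
      by (rule card_insert_le_m1[THEN order_trans]) auto
    also have "card (W \<union> Y) \<le> card W + card Y"
      by (rule card_Un_le)
    also have "card W + card Y \<le> deg H z"
    proof -
      have e: "{C \<in> H. z \<in> var_cl C} = (if z \<in> var_cl b1 then insert \<gamma> Y else Y)"
        using z by (auto simp: H_def Y_def \<gamma>_def var_cl_def)
      have "\<gamma> \<notin> Y" "finite Y"
        using new fin(1) RestG(1) by (auto simp: Y_def intro: finite_subset)
      then show ?thesis
        by (auto simp: deg_def e W_def)
    qed
    finally show ?thesis
      by simp
  qed
  have varH: "var H = var G - V"
  proof
    show "var H \<subseteq> var G - V"
    proof
      fix v assume "v \<in> var H"
      then obtain C m where "C \<in> H" "m \<in> C" "lvar m = v"
        by (auto simp: var_iff)
      then show "v \<in> var G - V"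
        using RestG(1) Rest_out b1G(1)[OF o0] by (auto simp: H_def \<gamma>_def var_iff)
    qed
    show "var G - V \<subseteq> var H"
    proof
      fix z assume z: "z \<in> var G - V"
      then have "0 < deg H z"
        using deg_H[OF z] deg_ge[of z] by simp
      then show "z \<in> var H"
        by (rule deg_pos_var)
    qed
  qed
  have "card H = card (var H) + 1"
    using new card_Rest varH finite_subset[OF RestG(1) fin(1)] by (simp add: H_def)
  moreover have "var H \<noteq> {}"
    using varH VG not_V4 by blast
  ultimately obtain z where "z \<in> var H" "deg H z \<le> 2"
    using low_degree_variable[OF HMU, of 1] by auto
  then show False
    using deg_H[of z] deg_ge[of z] varH by simp
qed

end

lemma (in deficiency_two) all_deg_4:
  assumes "v \<in> var G"
  shows "deg G v = 4"
proof -
  have "\<not> deficiency_two_large G"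
    using deficiency_two_large.contradiction by blast
  then have "var G \<subseteq> V4"
    using deficiency_two_axioms
    unfolding deficiency_two_large_def deficiency_two_large_axioms_def by blast
  then show ?thesis
    using assms by (auto simp: V4_def)
qed

section \<open>Chains of unit clauses\<close>

lemma lit_true_flip:
  "lit_true (\<lambda>v. if v \<in> W then \<not> \<tau> v else \<tau> v) l \<longleftrightarrow> (if lvar l \<in> W then \<not> lit_true \<tau> l else lit_true \<tau> l)"
  by (cases l) auto

text \<open>If \<open>comp u\<close> were missing from another clause, saturation would give an
  assignment with \<open>u\<close> false that falsifies only that clause, yet it falsifies
  \<open>{u}\<close> too. So the variable of the unit is in every clause, and propagating the unit
  removes only \<open>{u}\<close>.\<close>

lemma SMU_unit:
  assumes F: "F \<in> SMU" and u: "{u} \<in> F"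
  shows "\<And>C. C \<in> F \<Longrightarrow> C \<noteq> {u} \<Longrightarrow> u \<notin> C \<and> comp u \<in> C"
    and "split F u \<in> SMU" and "F = insert {u} (insert (comp u) ` split F u)"
    and "var (split F u) = var F - {lvar u}" and "card (split F u) + 1 = card F"
    and "\<And>v. v \<noteq> lvar u \<Longrightarrow> deg (split F u) v = deg F v"
proof -
  note M = SMU_MU[OF F]
  have uV: "lvar u \<in> var F"
    using lvar_in_var[OF u] by simp
  show other: "u \<notin> C \<and> comp u \<in> C" if C: "C \<in> F" "C \<noteq> {u}" for C
  proof
    show "u \<notin> C"
      using MU_antichain[OF M u C(1)] C(2) by auto
    show "comp u \<in> C"
    proof (rule ccontr)
      assume "comp u \<notin> C"
      then obtain \<beta> where b: "lit_true \<beta> (comp u)" "\<And>D. D \<in> F \<Longrightarrow> D \<noteq> C \<Longrightarrow> \<not> falsif \<beta> D"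
        using SMU_witness[OF F C(1), of "comp u"] uV \<open>u \<notin> C\<close> by auto
      have "\<not> falsif \<beta> {u}"
        using b(2)[OF u] C(2) by blast
      then show False
        using b(1) by (simp add: falsif_def)
    qed
  qed
  have uu: "{C \<in> F. u \<in> C} = {{u}}"
    using other u by auto
  show "F = insert {u} (insert (comp u) ` split F u)"
  proof (intro set_eqI iffI)
    fix C assume C: "C \<in> F"
    show "C \<in> insert {u} (insert (comp u) ` split F u)"
    proof (cases "C = {u}")
      case False
      then have "C - {comp u} \<in> split F u" "C = insert (comp u) (C - {comp u})"
        using other[OF C] C by (auto simp: split_def)
      then show ?thesis
        by blast
    qed simp
  next
    fix C assume "C \<in> insert {u} (insert (comp u) ` split F u)"
    then consider "C = {u}" | D where "D \<in> F" "u \<notin> D" "C = insert (comp u) (D - {comp u})"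
      by (auto simp: split_def)
    then show "C \<in> F"
    proof cases
      case 2
      then have "comp u \<in> D"
        using other[of D] by auto
      then show ?thesis
        using 2 by (simp add: insert_absorb)
    qed (use u in simp)
  qed
  have no_v: "{C \<in> F. u \<in> C \<and> v \<in> var_cl C} = {}" if "v \<noteq> lvar u" for v
    using other that by (auto simp: var_cl_def)
  show dg: "deg (split F u) v = deg F v" if "v \<noteq> lvar u" for v
    using deg_split[OF M that] unfolding no_v[OF that] by simp
  show vs: "var (split F u) = var F - {lvar u}"
  proof
    show "var F - {lvar u} \<subseteq> var (split F u)"
    proof
      fix v assume "v \<in> var F - {lvar u}"
      then have "0 < deg (split F u) v"
        using dg[of v] deg_pos[OF MU_clauseset[OF M], of v] by simp
      then show "v \<in> var (split F u)"
        by (rule deg_pos_var)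
    qed
  qed (use var_split_subset[OF MU_clauseset[OF M]] in blast)
  show "card (split F u) + 1 = card F"
    using card_split[OF M, of u] by (simp add: ld_def uu)
  have "saturated (split F u)"
    unfolding saturated_def
  proof (intro ballI allI impI)
    fix C x assume C: "C \<in> split F u" and x: "lvar x \<in> var (split F u)" "x \<notin> C" "comp x \<notin> C"
    obtain D where D: "D \<in> F" "u \<notin> D" "C = D - {comp u}"
      using C by (auto simp: split_def)
    have xu: "lvar x \<noteq> lvar u" "lvar x \<in> var F"
      using x(1) vs by auto
    then have "x \<notin> D" "comp x \<notin> D"
      using x D(3) by auto
    then obtain \<beta> where b: "lit_true \<beta> x" "\<And>E. E \<in> F \<Longrightarrow> E \<noteq> D \<Longrightarrow> \<not> falsif \<beta> E"
      using SMU_witness[OF F D(1) xu(2)] by blast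
    have "\<not> falsif \<beta> {u}"
      using b(2)[OF u] D(2) by blast
    then have ut: "lit_true \<beta> u"
      by (simp add: falsif_def)
    have "\<not> falsif \<beta> E'" if E': "E' \<in> insert (insert x C) (split F u - {C})" for E'
    proof (cases "E' = insert x C")
      case True
      then show ?thesis
        using b(1) by (auto simp: falsif_def)
    next
      case False
      then obtain E where E: "E \<in> F" "u \<notin> E" "E' = E - {comp u}" "E \<noteq> D"
        using E' D(3) by (auto simp: split_def)
      then obtain m where "m \<in> E" "lit_true \<beta> m"
        using b(2)[of E] by (auto simp: falsif_def)
      then show ?thesis
        using ut E(3) by (auto simp: falsif_def)
    qed
    then show "satisfiable (insert (insert x C) (split F u - {C}))"
      unfolding satisfiable_falsif by blast
  qed
  then show "split F u \<in> SMU"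
    using split_MU[OF F uV] by (simp add: SMU_def)
qed

text \<open>The unit met after \<open>i\<close> propagations, with the literals that became false
  put back. The list holds these falsified literals, so the units are their complements.\<close>

definition chain_clause :: "lit list \<Rightarrow> nat \<Rightarrow> clause" where
  "chain_clause ws i = insert (comp (ws ! i)) (set (take i ws))"

definition unit_chain :: "clauseset \<Rightarrow> lit list \<Rightarrow> bool" where
  "unit_chain G ws \<longleftrightarrow> distinct (map lvar ws) \<and> lvar ` set ws \<subseteq> var G \<and>
     (\<forall>C\<in>G. set ws \<subseteq> C \<or> (\<exists>i<length ws. C = chain_clause ws i)) \<and>
     (\<forall>i<length ws. chain_clause ws i \<in> G) \<and>
     (\<forall>v\<in>var G - lvar ` set ws. deg G v = 4)"

lemma chain_clause_Cons:
  "chain_clause (w # ws) 0 = {comp w}"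
  "chain_clause (w # ws) (Suc i) = insert w (chain_clause ws i)"
  by (auto simp: chain_clause_def)

theorem SMU_unit_chain:
  assumes "G \<in> SMU" "card G = card (var G) + 2" "\<And>v. v \<in> var G \<Longrightarrow> 4 \<le> deg G v"
  shows "\<exists>ws. unit_chain G ws"
  using assms
proof (induction "card (var G)" arbitrary: G rule: less_induct)
  case less
  show ?case
  proof (cases "\<exists>u. {u} \<in> G")
    case False
    then interpret deficiency_two G
      using less.prems by unfold_locales auto
    show ?thesis
      using all_deg_4 by (intro exI[of _ "[]"]) (auto simp: unit_chain_def)
  next
    case True
    then obtain u where u: "{u} \<in> G"
      by blast
    note U = SMU_unit[OF less.prems(1) u]
    let ?H = "split G u"
    have "lvar u \<in> var G"
      using lvar_in_var[OF u] by simp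
    moreover have "finite (var G)"
      using finite_var MU_clauseset SMU_MU less.prems(1) by blast
    ultimately have c: "card (var ?H) + 1 = card (var G)"
      unfolding U(4) by (metis Suc_eq_plus1 card_Suc_Diff1)
    have H_deg: "4 \<le> deg ?H v" if "v \<in> var ?H" for v
      using that less.prems(3)[of v] U(6)[of v] by (simp add: U(4))
    have "\<exists>ws. unit_chain ?H ws"
    proof (rule less.hyps)
      show "card (var ?H) < card (var G)" "card ?H = card (var ?H) + 2"
        using c U(5) less.prems(2) by linarith+
    qed (use U(2) H_deg in auto)
    then obtain ws where ws: "unit_chain ?H ws"
      by blast
    then have wsV: "lvar ` set ws \<subseteq> var G - {lvar u}"
      by (simp add: unit_chain_def U(4))
    have "unit_chain G (comp u # ws)"
      unfolding unit_chain_def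
    proof (intro conjI ballI allI impI)
      show "distinct (map lvar (comp u # ws))" "lvar ` set (comp u # ws) \<subseteq> var G"
        using ws wsV \<open>lvar u \<in> var G\<close> by (auto simp: unit_chain_def)
      fix C assume "C \<in> G"
      then consider "C = {u}" | D where "D \<in> ?H" "C = insert (comp u) D"
        using U(3) by blast
      then show "set (comp u # ws) \<subseteq> C \<or> (\<exists>i<length (comp u # ws). C = chain_clause (comp u # ws) i)"
      proof cases
        case 1
        then show ?thesis
          by (intro disjI2 exI[of _ 0]) (simp add: chain_clause_Cons)
      next
        case 2
        then have "set ws \<subseteq> D \<or> (\<exists>i<length ws. D = chain_clause ws i)"
          using ws by (simp add: unit_chain_def)
        then show ?thesis
        proof (elim disjE exE conjE)
          fix i assume "i < length ws" "D = chain_clause ws i"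
          then show ?thesis
            using 2(2) by (intro disjI2 exI[of _ "Suc i"]) (simp add: chain_clause_Cons)
        qed (use 2(2) in auto)
      qed
    next
      fix i assume i: "i < length (comp u # ws)"
      show "chain_clause (comp u # ws) i \<in> G"
      proof (cases i)
        case 0
        then show ?thesis
          using u by (simp add: chain_clause_Cons)
      next
        case (Suc j)
        then have "chain_clause ws j \<in> ?H"
          using i ws by (simp add: unit_chain_def)
        then have "insert (comp u) (chain_clause ws j) \<in> insert {u} (insert (comp u) ` ?H)"
          by blast
        then show ?thesis
          unfolding Suc chain_clause_Cons U(3)[symmetric] .
      qed
    next
      fix v assume "v \<in> var G - lvar ` set (comp u # ws)"
      then show "deg G v = 4"
        using ws U(4) U(6)[of v] by (simp add: unit_chain_def)
    qed
    then show ?thesis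
      by blast
  qed
qed

section \<open>Deficiency 6\<close>

locale deficiency_six =
  fixes F :: clauseset
  assumes SMU: "F \<in> SMU"
    and card_F: "card F = card (var F) + 6"
    and deg_ge: "\<And>v. v \<in> var F \<Longrightarrow> 9 \<le> deg F v"
    and no_unit: "\<And>l. {l} \<notin> F"
begin

lemma MU: "F \<in> MU"
  using SMU SMU_MU by blast

lemma fin: "finite F" "finite (var F)"
  using MU_finite[OF MU] finite_var[OF MU_clauseset[OF MU]] by auto

definition five :: "lit \<Rightarrow> bool" where
  "five x \<longleftrightarrow> lvar x \<in> var F \<and> ld F x = 5 \<and> ld F (comp x) = 4"

text \<open>Some literal occurs at least 5 times, and at most 6 times by the deficiency. If 6 times,
  the split has deficiency 1 and a variable of degree at most 2, whose degree was at most 8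
  before.\<close>

lemma five_exists:
  assumes v: "v \<in> var F" "deg F v = 9"
  shows "\<exists>x. lvar x = v \<and> five x"
proof -
  have "\<exists>x. lvar x = v \<and> ld F (comp x) \<le> ld F x"
    by (cases "ld F (Pos v) \<le> ld F (Neg v)") (force intro: exI[of _ "Neg v"] exI[of _ "Pos v"])+
  then obtain x where x: "lvar x = v" "ld F (comp x) \<le> ld F x"
    by blast
  have sum: "ld F x + ld F (comp x) = 9"
    using deg_eq_ld[OF MU_clauseset[OF MU], of x] v x by simp
  note S = SMU_min_deg_ld[OF SMU _ _ card_F, of x]
  have S: "split F x \<in> MU" "var (split F x) = var F - {lvar x}"
    "card (split F x) + ld F x = card (var (split F x)) + 6 + 1" "ld F x \<le> 6"
    using S v x deg_ge by auto
  have "ld F x \<noteq> 6"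
  proof
    assume l6: "ld F x = 6"
    have "9 \<le> card F"
      using v fin(1) unfolding deg_def by (metis (no_types, lifting) card_mono mem_Collect_eq subsetI)
    then have "2 \<le> card (var F)"
      using card_F by simp
    then have "\<not> var F \<subseteq> {lvar x}"
      using card_mono[of "{lvar x}" "var F"] by auto
    then have "var (split F x) \<noteq> {}"
      using S(2) by blast
    then obtain w where w: "w \<in> var (split F x)" "deg (split F x) w \<le> 2"
      using low_degree_variable[OF S(1), of 1] S(3) l6 by auto
    then have "deg F w \<le> 8"
      using deg_split_le[OF MU, of w x] l6 S(2) by simp
    then show False
      using deg_ge[of w] w S(2) by simp
  qed
  then show ?thesis
    using S(4) sum x v by (intro exI[of _ x]) (auto simp: five_def)
qed

end

text \<open>Here \<open>split F x\<close> has deficiency 2, \<open>\<phi>\<close> saturates it, and \<open>ws\<close> is the resulting chain of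
  units.\<close>

locale five_split = deficiency_six +
  fixes x :: lit and \<phi> :: "clause \<Rightarrow> clause" and ws :: "lit list"
  assumes five: "five x"
    and inj_\<phi>: "inj_on \<phi> (split F x)"
    and \<phi>_SMU: "\<phi> ` split F x \<in> SMU"
    and var_\<phi>: "var (\<phi> ` split F x) = var (split F x)"
    and \<phi>_ge: "\<And>C. C \<in> split F x \<Longrightarrow> C \<subseteq> \<phi> C"
    and chain: "unit_chain (\<phi> ` split F x) ws"
begin

definition "F1 = split F x"
definition "G = \<phi> ` F1"
definition "upper = {C \<in> F. x \<in> C}"
definition "core = {C \<in> F1. set ws \<subseteq> \<phi> C}"
definition "X = var F1 - lvar ` set ws"

lemma x: "lvar x \<in> var F" "ld F x = 5" "ld F (comp x) = 4"
  using five by (auto simp: five_def)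

lemma card_upper: "card upper = 5" "finite upper"
  using x fin(1) by (auto simp: upper_def ld_def)

lemma deg_x: "deg F (lvar x) = 9"
  using deg_eq_ld[OF MU_clauseset[OF MU], of x] x by simp

lemma F1: "F1 \<in> MU" "var F1 = var F - {lvar x}"
  using SMU_min_deg_ld[OF SMU x(1) _ card_F] deg_x deg_ge by (auto simp: F1_def)

lemma G: "G \<in> MU" "var G = var F1"
  using \<phi>_SMU SMU_MU var_\<phi> by (auto simp: G_def F1_def)

lemma \<phi>_clause: "C \<in> F1 \<Longrightarrow> is_clause (\<phi> C)"
  using MU_clause[OF G(1)] by (auto simp: G_def)

lemma ws_vars: "distinct (map lvar ws)" "lvar ` set ws \<subseteq> var F1"
  using chain var_\<phi> by (auto simp: unit_chain_def F1_def)

lemma ws_nth_eq: "i < length ws \<Longrightarrow> j < length ws \<Longrightarrow> lvar (ws ! i) = lvar (ws ! j) \<Longrightarrow> i = j"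
  using ws_vars(1) by (simp add: distinct_conv_nth) (metis length_map nth_map)

lemma chain_clause_eq:
  assumes "comp (ws ! i) \<in> chain_clause ws j" "i < length ws" "j < length ws"
  shows "i = j"
proof (cases "comp (ws ! i) = comp (ws ! j)")
  case True
  then show ?thesis
    using ws_nth_eq[of i j] assms by simp
next
  case False
  then obtain k where "k < j" "comp (ws ! i) = ws ! k"
    using assms by (auto simp: chain_clause_def in_set_conv_nth)
  moreover from this have "i = k"
    using ws_nth_eq[of i k] assms by (metis lvar_comp less_trans)
  ultimately show ?thesis
    by simp
qed

text \<open>The degree is 4 after saturation, at most 5 occurrences were removed by the split, and
  there were at least 9; so neither the split nor saturation has any slack at
  \<open>v\<close>.\<close>

lemma upper_X:
  assumes v: "v \<in> X"
  shows "deg F v = 9" "\<And>A. A \<in> upper \<Longrightarrow> v \<in> var_cl A" "\<And>C. C \<in> F1 \<Longrightarrow> v \<in> var_cl (\<phi> C) \<Longrightarrow> v \<in> var_cl C"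
proof -
  have vF: "v \<in> var F" "v \<noteq> lvar x"
    using v F1(2) by (auto simp: X_def)
  have 4: "deg G v = 4"
    using chain v var_\<phi> by (simp add: unit_chain_def X_def G_def F1_def)
  have le: "deg F1 v \<le> deg G v"
    unfolding G_def using deg_mono_image inj_\<phi> \<phi>_ge MU_finite[OF F1(1)] by (metis F1_def)
  have d: "deg F1 v + card {C \<in> F. x \<in> C \<and> v \<in> var_cl C} = deg F v"
    unfolding F1_def by (rule deg_split[OF MU vF(2)])
  have sub: "{C \<in> F. x \<in> C \<and> v \<in> var_cl C} \<subseteq> upper"
    by (auto simp: upper_def)
  have "card {C \<in> F. x \<in> C \<and> v \<in> var_cl C} \<le> 5"
    using card_mono[OF card_upper(2) sub] card_upper(1) by simp
  then have eq: "deg F1 v = 4" "card {C \<in> F. x \<in> C \<and> v \<in> var_cl C} = 5"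
    using 4 le d deg_ge[OF vF(1)] by linarith+
  then show "deg F v = 9"
    using d by simp
  show "v \<in> var_cl A" if "A \<in> upper" for A
  proof -
    have "{C \<in> F. x \<in> C \<and> v \<in> var_cl C} = upper"
      using card_subset_eq[OF card_upper(2) sub] eq(2) card_upper(1) by simp
    then show ?thesis
      using that by blast
  qed
  fix C assume C: "C \<in> F1" "v \<in> var_cl (\<phi> C)"
  let ?S = "{C \<in> F1. v \<in> var_cl C}"
  have "card (\<phi> ` ?S) = 4"
    using inj_\<phi> eq(1) by (subst card_image) (auto simp: F1_def deg_def intro: inj_on_subset)
  moreover have "\<phi> ` ?S \<subseteq> {D \<in> G. v \<in> var_cl D}"
    using \<phi>_ge by (fastforce simp: G_def F1_def var_cl_def)
  moreover have "card {D \<in> G. v \<in> var_cl D} = 4" "finite {D \<in> G. v \<in> var_cl D}"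
    using 4 MU_finite[OF G(1)] by (auto simp: deg_def)
  ultimately have "\<phi> ` ?S = {D \<in> G. v \<in> var_cl D}"
    by (intro card_subset_eq) auto
  then have "\<phi> C \<in> \<phi> ` ?S"
    using C by (auto simp: G_def)
  then show "v \<in> var_cl C"
    using C(1) inj_\<phi> by (auto simp: F1_def inj_on_def)
qed

lemma lit_X:
  assumes "C \<in> F1" "l \<in> \<phi> C" "lvar l \<in> X"
  shows "l \<in> C"
proof -
  have "lvar l \<in> var_cl C"
    using upper_X(3)[OF assms(3,1)] assms(2) by (auto simp: var_cl_def)
  then have "l \<in> C \<or> comp l \<in> C"
    by (auto simp: var_cl_def lvar_eq_iff)
  moreover have "comp l \<notin> C"
    using \<phi>_clause[OF assms(1)] assms(2) \<phi>_ge[of C] assms(1) by (auto simp: F1_def is_clause_iff)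
  ultimately show ?thesis
    by blast
qed

lemma chain_cases: "C \<in> F1 \<Longrightarrow> set ws \<subseteq> \<phi> C \<or> (\<exists>i<length ws. \<phi> C = chain_clause ws i)"
  using chain by (simp add: unit_chain_def F1_def)

text \<open>Both signs of a chain variable occur in the split, so some clause there contains
  \<open>comp (ws ! i)\<close>; after saturation only the chain clause at \<open>i\<close> can
  contain it.\<close>

lemma not_core:
  assumes "C \<in> F1" "C \<notin> core"
  obtains i where "i < length ws" "\<phi> C = chain_clause ws i" "comp (ws ! i) \<in> C"
proof -
  obtain i where i: "i < length ws" "\<phi> C = chain_clause ws i"
    using chain_cases[OF assms(1)] assms by (auto simp: core_def)
  have "lvar (comp (ws ! i)) \<in> var F1"
    using ws_vars(2) i(1) by auto
  then have "0 < ld F1 (comp (ws ! i))"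
    by (rule MU_ld_pos[OF F1(1)])
  then obtain D where D: "D \<in> F1" "comp (ws ! i) \<in> D"
    by (auto simp: ld_def card_gt_0_iff)
  then have cD: "comp (ws ! i) \<in> \<phi> D"
    using \<phi>_ge by (auto simp: F1_def)
  then have "\<not> set ws \<subseteq> \<phi> D"
    using \<phi>_clause[OF D(1)] nth_mem[OF i(1)] by (metis comp_comp is_clause_iff subsetD)
  then obtain j where j: "j < length ws" "\<phi> D = chain_clause ws j"
    using chain_cases[OF D(1)] by blast
  then have "i = j"
    using chain_clause_eq cD i(1) by simp
  then have "C = D"
    using inj_\<phi> assms(1) D(1) i j by (auto simp: F1_def inj_on_def)
  then show ?thesis
    using that i D(2) by blast
qed

lemma core_lits:
  assumes "C \<in> core" "l \<in> \<phi> C" "l \<notin> set ws"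
  shows "lvar l \<in> X" "l \<in> C"
proof -
  have C: "C \<in> F1" "set ws \<subseteq> \<phi> C"
    using assms by (auto simp: core_def)
  have "lvar l \<notin> lvar ` set ws"
  proof
    assume "lvar l \<in> lvar ` set ws"
    then obtain w where "w \<in> set ws" "l = comp w"
      using assms(3) by (auto simp: lvar_eq_iff)
    then show False
      using C assms(2) \<phi>_clause[OF C(1)] by (auto simp: is_clause_iff)
  qed
  moreover have "lvar l \<in> var F1"
    using lvar_in_var[of "\<phi> C" G l] assms(2) C(1) G(2) by (simp add: G_def)
  ultimately show "lvar l \<in> X"
    by (simp add: X_def)
  then show "l \<in> C"
    using lit_X C(1) assms(2) by blast
qed

text \<open>The clauses of the core that are satisfied once \<open>x\<close> is false and exactly the first \<open>s\<close> literals of \<open>ws\<close>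
  are true, and the upper clauses that remain.\<close>

definition inactive :: "nat \<Rightarrow> clauseset" where
  "inactive s = {D \<in> F. x \<notin> D \<and> D - {comp x} \<in> core \<and> (comp x \<in> D \<or> (\<exists>i<s. ws ! i \<in> D))}"

definition avail :: "nat \<Rightarrow> clauseset" where
  "avail s = {A \<in> upper. (\<forall>i<s. ws ! i \<notin> A) \<and> (\<forall>i<length ws. s \<le> i \<longrightarrow> comp (ws ! i) \<notin> A)}"

text \<open>An assignment falsifying only the saturated version of \<open>D\<close> makes all of
  \<open>ws\<close> false. Make \<open>x\<close> false and the first \<open>s\<close> chain literals
  true. Other core clauses stay satisfied over \<open>X\<close>, chain clauses by their own unit or
  by an earlier literal (no clause of \<open>F\<close> is a unit), and \<open>D\<close> because it
  is inactive. So an upper clause is falsified.\<close>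

lemma avail_witness:
  assumes s: "s \<le> length ws" and D: "D \<in> inactive s"
  shows "\<exists>A \<tau>. A \<in> avail s \<and> (\<forall>l\<in>A. lvar l \<in> X \<longrightarrow> \<not> lit_true \<tau> l) \<and> falsif \<tau> (\<phi> (D - {comp x})) \<and>
    (\<forall>C\<in>F1. C \<noteq> D - {comp x} \<longrightarrow> \<not> falsif \<tau> (\<phi> C))"
proof -
  let ?D = "D - {comp x}"
  have D': "?D \<in> core" "D \<in> F" "x \<notin> D" "comp x \<in> D \<or> (\<exists>i<s. ws ! i \<in> D)"
    using D by (auto simp: inactive_def)
  then have DF1: "?D \<in> F1" "set ws \<subseteq> \<phi> ?D"
    by (auto simp: core_def)
  then obtain \<tau> where t: "falsif \<tau> (\<phi> ?D)" "\<And>C. C \<in> G \<Longrightarrow> C \<noteq> \<phi> ?D \<Longrightarrow> \<not> falsif \<tau> C"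
    using MU_private[OF G(1), of "\<phi> ?D"] by (auto simp: G_def)
  have t2: "\<not> falsif \<tau> (\<phi> C)" if "C \<in> F1" "C \<noteq> ?D" for C
    using t(2)[of "\<phi> C"] that inj_\<phi> DF1(1) by (auto simp: G_def F1_def inj_on_def)
  have ws_false: "\<not> lit_true \<tau> w" if "w \<in> set ws" for w
    using t(1) DF1(2) that by (auto simp: falsif_def)
  define \<gamma> where "\<gamma> = force (comp x) (\<lambda>v. if v \<in> lvar ` set (take s ws) then \<not> \<tau> v else \<tau> v)"
  have x_ws: "lvar x \<notin> lvar ` set ws"
    using ws_vars(2) F1(2) by auto
  have \<gamma>_x: "lit_true \<gamma> (comp x)"
    by (simp add: \<gamma>_def lit_true_force)
  have \<gamma>: "lit_true \<gamma> l = (if lvar l \<in> lvar ` set (take s ws) then \<not> lit_true \<tau> l else lit_true \<tau> l)"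
    if "lvar l \<noteq> lvar x" for l
    using that unfolding \<gamma>_def lit_true_force lit_true_flip by simp
  have \<gamma>_X: "lit_true \<gamma> l = lit_true \<tau> l" if "lvar l \<in> X" for l
  proof -
    have "lvar l \<notin> lvar ` set (take s ws)"
      using that set_take_subset[of s ws] by (auto simp: X_def)
    then show ?thesis
      using \<gamma>[of l] that F1(2) by (auto simp: X_def)
  qed
  have \<gamma>_ws: "lit_true \<gamma> (ws ! i) = (i < s)" if i: "i < length ws" for i
  proof -
    have "lvar (ws ! i) \<noteq> lvar x"
      using x_ws i by (metis image_eqI nth_mem)
    moreover have "lvar (ws ! i) \<in> lvar ` set (take s ws) \<longleftrightarrow> i < s"
    proof
      assume "lvar (ws ! i) \<in> lvar ` set (take s ws)"
      then obtain j where "j < s" "j < length ws" "lvar (ws ! i) = lvar (ws ! j)"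
        by (auto simp: in_set_conv_nth)
      then show "i < s"
        using ws_nth_eq[OF i] by simp
    next
      assume "i < s"
      then show "lvar (ws ! i) \<in> lvar ` set (take s ws)"
        using i by (auto simp: in_set_conv_nth intro!: imageI exI[of _ i])
    qed
    ultimately show ?thesis
      using \<gamma>[of "ws ! i"] ws_false[OF nth_mem[OF i]] by simp
  qed
  have sat: "\<not> falsif \<gamma> C" if C: "C \<in> F" "x \<notin> C" for C
  proof (cases "comp x \<in> C")
    case True
    then show ?thesis
      unfolding falsif_def using \<gamma>_x by blast
  next
    case nx: False
    then have CF1: "C \<in> F1"
      using C by (force simp: F1_def split_def)
    show ?thesis
    proof (cases "C \<in> core")
      case core: True
      show ?thesis
      proof (cases "C = ?D")
        case True
        have "D = ?D"
        proof (rule ccontr)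
          assume "D \<noteq> ?D"
          then show False
            using MU_antichain[OF MU C(1) D'(2)] True by auto
        qed
        then obtain i where i: "i < s" "ws ! i \<in> D"
          using D'(4) by auto
        then have "lit_true \<gamma> (ws ! i)"
          using \<gamma>_ws[of i] s by simp
        then show ?thesis
          using True \<open>D = ?D\<close> i(2) by (auto simp: falsif_def)
      next
        case False
        then obtain l where l: "l \<in> \<phi> C" "lit_true \<tau> l"
          using t2[OF CF1] by (auto simp: falsif_def)
        then have "lvar l \<in> X" "l \<in> C"
          using core_lits[OF core l(1)] ws_false by auto
        then show ?thesis
          using \<gamma>_X l(2) by (auto simp: falsif_def)
      qed
    next
      case False
      then obtain i where i: "i < length ws" "\<phi> C = chain_clause ws i" "comp (ws ! i) \<in> C"
        using not_core[OF CF1] by blast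
      show ?thesis
      proof (cases "i < s")
        case False
        then have "lit_true \<gamma> (comp (ws ! i))"
          using \<gamma>_ws[OF i(1)] by simp
        then show ?thesis
          unfolding falsif_def using i(3) by blast
      next
        case True
        have "C \<noteq> {comp (ws ! i)}"
          using no_unit C(1) by blast
        then obtain l where l: "l \<in> C" "l \<noteq> comp (ws ! i)"
          using i(3) by auto
        then have "l \<in> chain_clause ws i"
          using \<phi>_ge[of C] CF1 i(2) by (auto simp: F1_def)
        then obtain j where j: "j < i" "l = ws ! j"
          using l(2) i(1) by (auto simp: chain_clause_def in_set_conv_nth)
        then have "lit_true \<gamma> l"
          using \<gamma>_ws[of j] i(1) True by simp
        then show ?thesis
          using l(1) by (auto simp: falsif_def)
      qed
    qed
  qed
  obtain A where A: "A \<in> F" "falsif \<gamma> A"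
    using MU_falsified[OF MU] by blast
  then have "A \<in> upper"
    using sat by (auto simp: upper_def)
  moreover have "ws ! i \<notin> A" if "i < s" for i
    using \<gamma>_ws[of i] that s A(2) by (auto simp: falsif_def)
  moreover have "comp (ws ! i) \<notin> A" if "i < length ws" "s \<le> i" for i
  proof
    assume "comp (ws ! i) \<in> A"
    then have "\<not> lit_true \<gamma> (comp (ws ! i))"
      using A(2) unfolding falsif_def by blast
    then show False
      using \<gamma>_ws[of i] that by simp
  qed
  ultimately have "A \<in> avail s"
    by (simp add: avail_def)
  moreover have "\<forall>l\<in>A. lvar l \<in> X \<longrightarrow> \<not> lit_true \<tau> l"
    using A(2) \<gamma>_X by (auto simp: falsif_def)
  ultimately show ?thesis
    using t(1) t2 by blast
qed

text \<open>An upper clause contains all variables of \<open>X\<close>, so it determines the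
  falsifying assignment there. Core clauses all contain \<open>ws\<close>, which is false, so their
  truth depends on \<open>X\<close> only; different inactive clauses thus need different upper
  clauses.\<close>

lemma card_inactive_le:
  assumes s: "s \<le> length ws"
  shows "card (inactive s) \<le> card (avail s)"
proof -
  define P where "P = (\<lambda>D A \<tau>. A \<in> avail s \<and> (\<forall>l\<in>A. lvar l \<in> X \<longrightarrow> \<not> lit_true \<tau> l) \<and>
    falsif \<tau> (\<phi> (D - {comp x})) \<and> (\<forall>C\<in>F1. C \<noteq> D - {comp x} \<longrightarrow> \<not> falsif \<tau> (\<phi> C)))"
  have "\<forall>D\<in>inactive s. \<exists>A \<tau>. P D A \<tau>"
    using avail_witness[OF s] by (simp add: P_def)
  then obtain f \<tau> where P: "\<And>D. D \<in> inactive s \<Longrightarrow> P D (f D) (\<tau> D)"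
    by metis
  have f: "\<And>D. D \<in> inactive s \<Longrightarrow> f D \<in> avail s"
    and fX: "\<And>D l. D \<in> inactive s \<Longrightarrow> l \<in> f D \<Longrightarrow> lvar l \<in> X \<Longrightarrow> \<not> lit_true (\<tau> D) l"
    and t: "\<And>D. D \<in> inactive s \<Longrightarrow> falsif (\<tau> D) (\<phi> (D - {comp x}))"
      "\<And>D C. D \<in> inactive s \<Longrightarrow> C \<in> F1 \<Longrightarrow> C \<noteq> D - {comp x} \<Longrightarrow> \<not> falsif (\<tau> D) (\<phi> C)"
    using P by (simp_all add: P_def)
  have "inj_on f (inactive s)"
  proof (rule inj_onI, rule ccontr)
    fix C D assume C: "C \<in> inactive s" and D: "D \<in> inactive s" and e: "f C = f D" and "C \<noteq> D"
    let ?C = "C - {comp x}"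
    have cC: "?C \<in> core" "?C \<in> F1" "set ws \<subseteq> \<phi> ?C"
      using C by (auto simp: inactive_def core_def)
    have "?C \<noteq> D - {comp x}"
      using C D \<open>C \<noteq> D\<close> split_inj[OF MU, of x] by (auto simp: inactive_def inj_on_def)
    then obtain l where l: "l \<in> \<phi> ?C" "lit_true (\<tau> D) l"
      using t(2)[OF D cC(2)] by (auto simp: falsif_def)
    have "set ws \<subseteq> \<phi> (D - {comp x})"
      using D by (auto simp: inactive_def core_def)
    then have "l \<notin> set ws"
      using t(1)[OF D] l(2) by (auto simp: falsif_def)
    then have lX: "lvar l \<in> X"
      using core_lits[OF cC(1) l(1)] by blast
    have nC: "\<not> lit_true (\<tau> C) l"
      using t(1)[OF C] l(1) by (simp add: falsif_def)
    have "f C \<in> upper"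
      using f[OF C] by (simp add: avail_def)
    then have "lvar l \<in> var_cl (f C)"
      using upper_X(2)[OF lX] by blast
    then have "l \<in> f C \<or> comp l \<in> f C"
      by (auto simp: var_cl_def lvar_eq_iff)
    moreover have "l \<notin> f C"
      using fX[OF D, of l] e lX l(2) by auto
    moreover have "comp l \<notin> f C"
      using fX[OF C, of "comp l"] lX nC by auto
    ultimately show False
      by blast
  qed
  moreover have "finite (avail s)"
    using card_upper(2) by (simp add: avail_def)
  ultimately show ?thesis
    using f by (intro card_inj_on_le[of f]) auto
qed

text \<open>A clause of the split with this variable is either a core clause containing
  \<open>ws ! i\<close>, which is inactive at \<open>Suc i\<close>, or becomes a chain clause at a
  position from \<open>i\<close> on.\<close>

lemma degree_bound:
  assumes i: "i < length ws"
  shows "9 \<le> card {A \<in> upper. lvar (ws ! i) \<in> var_cl A} + card (inactive (Suc i)) + (length ws - i)"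
proof -
  let ?w = "ws ! i"
  let ?v = "lvar ?w"
  have v: "?v \<in> var F1"
    using ws_vars(2) i by auto
  then have vF: "?v \<in> var F" "?v \<noteq> lvar x"
    using F1(2) by auto
  have d: "deg F1 ?v + card {C \<in> F. x \<in> C \<and> ?v \<in> var_cl C} = deg F ?v"
    unfolding F1_def by (rule deg_split[OF MU vF(2)])
  have u: "{C \<in> F. x \<in> C \<and> ?v \<in> var_cl C} = {A \<in> upper. ?v \<in> var_cl A}"
    by (auto simp: upper_def)
  define J where "J = {C \<in> F1. \<exists>j. i \<le> j \<and> j < length ws \<and> \<phi> C = chain_clause ws j}"
  have "card J \<le> card {i..<length ws}"
  proof -
    have "\<forall>C\<in>J. \<exists>j. i \<le> j \<and> j < length ws \<and> \<phi> C = chain_clause ws j"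
      by (auto simp: J_def)
    then obtain g where g: "\<forall>C\<in>J. i \<le> g C \<and> g C < length ws \<and> \<phi> C = chain_clause ws (g C)"
      by metis
    have "inj_on g J"
    proof (rule inj_onI)
      fix C D assume "C \<in> J" "D \<in> J" "g C = g D"
      moreover from this have "\<phi> C = chain_clause ws (g C)" "\<phi> D = chain_clause ws (g D)"
        using g by blast+
      ultimately have "\<phi> C = \<phi> D" "C \<in> F1" "D \<in> F1"
        by (simp_all add: J_def)
      then show "C = D"
        using inj_\<phi> by (auto simp: F1_def inj_on_def)
    qed
    then show ?thesis
      using g by (intro card_inj_on_le[of g]) auto
  qed
  have sub: "{C \<in> F1. ?v \<in> var_cl C} \<subseteq> (\<lambda>D. D - {comp x}) ` inactive (Suc i) \<union> J"
  proof
    fix C assume "C \<in> {C \<in> F1. ?v \<in> var_cl C}"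
    then have C: "C \<in> F1" "?w \<in> C \<or> comp ?w \<in> C"
      by (auto simp: var_cl_def lvar_eq_iff)
    have C\<phi>: "C \<subseteq> \<phi> C"
      using \<phi>_ge C(1) by (simp add: F1_def)
    show "C \<in> (\<lambda>D. D - {comp x}) ` inactive (Suc i) \<union> J"
    proof (cases "C \<in> core")
      case True
      then have "?w \<in> \<phi> C"
        using i by (auto simp: core_def)
      then have "?w \<in> C"
        using C(2) C\<phi> \<phi>_clause[OF C(1)] by (auto simp: is_clause_iff)
      moreover obtain D where "D \<in> F" "x \<notin> D" "C = D - {comp x}"
        using C(1) by (auto simp: F1_def split_def)
      ultimately show ?thesis
        using True by (auto simp: inactive_def intro!: exI[of _ i])
    next
      case False
      then obtain j where j: "j < length ws" "\<phi> C = chain_clause ws j"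
        using not_core[OF C(1)] by blast
      have "i \<le> j"
      proof (rule ccontr)
        assume "\<not> i \<le> j"
        have "?w \<in> chain_clause ws j \<or> comp ?w \<in> chain_clause ws j"
          using C(2) C\<phi> j(2) by blast
        then obtain k where "k \<le> j" "lvar ?w = lvar (ws ! k)"
          using j(1) by (auto simp: chain_clause_def in_set_conv_nth)
            (metis less_imp_le lvar_comp order_refl)+
        then show False
          using ws_nth_eq[OF i, of k] j(1) \<open>\<not> i \<le> j\<close> by simp
      qed
      then show ?thesis
        using C(1) j by (auto simp: J_def)
    qed
  qed
  have finI: "finite (inactive (Suc i))" "finite J"
    using fin(1) MU_finite[OF F1(1)] by (auto simp: inactive_def J_def)
  have "deg F1 ?v \<le> card ((\<lambda>D. D - {comp x}) ` inactive (Suc i) \<union> J)"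
    unfolding deg_def using finI by (intro card_mono[OF _ sub]) auto
  also have "\<dots> \<le> card ((\<lambda>D. D - {comp x}) ` inactive (Suc i)) + card J"
    by (rule card_Un_le)
  also have "\<dots> \<le> card (inactive (Suc i)) + (length ws - i)"
    using card_image_le[OF finI(1), of "\<lambda>D. D - {comp x}"] \<open>card J \<le> card {i..<length ws}\<close> by simp
  finally show ?thesis
    using d deg_ge[OF vF(1)] unfolding u by linarith
qed

text \<open>The 4 clauses with \<open>comp x\<close> are inactive at 0 unless they become chain
  clauses.\<close>

lemma lower_in_core:
  "4 \<le> card (inactive 0) + length ws"
proof -
  define J where "J = {D \<in> F. comp x \<in> D \<and> D - {comp x} \<notin> core}"
  have low: "x \<notin> D" "D - {comp x} \<in> F1" if "D \<in> F" "comp x \<in> D" for D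
  proof -
    show "x \<notin> D"
      using MU_clause[OF MU that(1)] that(2) by (auto simp: is_clause_iff)
    then show "D - {comp x} \<in> F1"
      using that by (auto simp: F1_def split_def)
  qed
  have "card J \<le> card {..<length ws}"
  proof -
    have "\<exists>i. i < length ws \<and> \<phi> (D - {comp x}) = chain_clause ws i" if "D \<in> J" for D
      using not_core[of "D - {comp x}"] low[of D] that unfolding J_def by blast
    then obtain g where g: "\<And>D. D \<in> J \<Longrightarrow> g D < length ws"
      "\<And>D. D \<in> J \<Longrightarrow> \<phi> (D - {comp x}) = chain_clause ws (g D)"
      by metis
    have "inj_on g J"
    proof (rule inj_onI)
      fix C D assume CD: "C \<in> J" "D \<in> J" "g C = g D"
      then have "\<phi> (C - {comp x}) = \<phi> (D - {comp x})"
        using g(2) by simp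
      then have "C - {comp x} = D - {comp x}"
        using inj_\<phi> low CD by (auto simp: F1_def inj_on_def J_def)
      then show "C = D"
        using split_inj[OF MU, of x] CD by (auto simp: J_def inj_on_def)
    qed
    then show ?thesis
      using g(1) by (intro card_inj_on_le[of g]) auto
  qed
  moreover have "{D \<in> F. comp x \<in> D} = inactive 0 \<union> J"
    using low(1) by (auto simp: inactive_def J_def)
  then have "4 \<le> card (inactive 0) + card J"
    using x(3) card_Un_le[of "inactive 0" J] by (simp add: ld_def)
  ultimately show ?thesis
    by simp
qed

lemma inactive_mono: "card (inactive 0) \<le> card (inactive s)"
  using fin(1) by (intro card_mono) (auto simp: inactive_def)

text \<open>The degree bounds are exploited from the end of the chain. The last variable leaves at
  most 2 upper clauses available at earlier stages; the one before it forces its variable into every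
  upper clause, so nothing is available two stages before the end; the third from the end then has
  degree at most 8.\<close>

lemma ws_empty: "ws = []"
proof (rule ccontr)
  assume "ws \<noteq> []"
  define r where "r = length ws"
  have r: "0 < r"
    using \<open>ws \<noteq> []\<close> by (simp add: r_def)
  define d where "d = (\<lambda>i. card {A \<in> upper. lvar (ws ! i) \<in> var_cl A})"
  define a where "a = (\<lambda>s. card (avail s))"
  have deg: "9 \<le> d i + a (Suc i) + (r - i)" if "i < r" for i
    using degree_bound[of i] card_inactive_le[of "Suc i"] that by (simp add: r_def d_def a_def)
  have d5: "d i \<le> 5" for i
    using card_mono[OF card_upper(2), of "{A \<in> upper. lvar (ws ! i) \<in> var_cl A}"] card_upper(1)
    by (simp add: d_def)
  have t: "card (inactive 0) \<le> a s" if "s \<le> r" for s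
    using inactive_mono[of s] card_inactive_le[of s] that by (simp add: r_def a_def)
  have t4: "4 \<le> card (inactive 0) + r"
    using lower_in_core by (simp add: r_def)
  let ?w = "ws ! (r - 1)"
  let ?Pos = "{A \<in> upper. ?w \<in> A}" and ?Neg = "{A \<in> upper. comp ?w \<in> A}"
  have last: "r - 1 < length ws" "r - 1 < r"
    using r by (auto simp: r_def)
  have finU: "finite {A \<in> upper. P A}" for P
    using card_upper(2) by simp
  have compl: "card {A \<in> upper. P A} + card {A \<in> upper. \<not> P A} = 5" for P
  proof -
    have "card ({A \<in> upper. P A} \<union> {A \<in> upper. \<not> P A}) = card {A \<in> upper. P A} + card {A \<in> upper. \<not> P A}"
      using finU by (intro card_Un_disjoint) auto
    moreover have "{A \<in> upper. P A} \<union> {A \<in> upper. \<not> P A} = upper"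
      by auto
    ultimately show ?thesis
      using card_upper(1) by simp
  qed
  have "d (r - 1) \<le> card ?Pos + card ?Neg"
  proof -
    have "{A \<in> upper. lvar ?w \<in> var_cl A} = ?Pos \<union> ?Neg"
      by (auto simp: var_cl_def lvar_eq_iff image_iff intro: bexI[of _ "comp ?w"])
    then show ?thesis
      by (simp add: d_def card_Un_le)
  qed
  moreover have "a r \<le> card {A \<in> upper. ?w \<notin> A}"
    unfolding a_def using finU last(2) by (intro card_mono) (auto simp: avail_def)
  \<comment> \<open>An upper clause with the last literal counts for the degree but is lost from
    \<open>avail r\<close>. Both terms together are at most \<open>5 + card ?Neg\<close>, and the
    chain adds 1.\<close>
  ultimately have "3 \<le> card ?Neg"
    using deg[OF last(2)] compl[of "\<lambda>A. ?w \<in> A"] r by simp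
  then have two: "card {A \<in> upper. comp ?w \<notin> A} \<le> 2"
    using compl[of "\<lambda>A. comp ?w \<in> A"] by simp
  have av: "avail s \<subseteq> {A \<in> upper. comp ?w \<notin> A}" if "s < r" for s
    using that last(1) by (auto simp: avail_def)
  then have a2: "a s \<le> 2" if "s < r" for s
    using card_mono[OF finU av[OF that]] two by (simp add: a_def)
  \<comment> \<open>At most 2 of the 4 clauses with \<open>comp x\<close> are inactive at 0, so at
    least 2 went into the chain.\<close>
  have "2 \<le> r"
    using t[of 0] a2[OF r] t4 by simp
  have "9 \<le> d (r - 2) + a (r - 1) + 2"
    using deg[of "r - 2"] \<open>2 \<le> r\<close> by (simp add: Suc_diff_Suc numeral_2_eq_2)
  then have "d (r - 2) = 5" "a (r - 1) = 2"
    using d5[of "r - 2"] a2[of "r - 1"] r by linarith+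
  then have eq: "avail (r - 1) = {A \<in> upper. comp ?w \<notin> A}"
    using card_seteq[OF finU av[of "r - 1"]] two r by (simp add: a_def)
  have "{A \<in> upper. lvar (ws ! (r - 2)) \<in> var_cl A} = upper"
    using card_seteq[OF card_upper(2), of "{A \<in> upper. lvar (ws ! (r - 2)) \<in> var_cl A}"]
      \<open>d (r - 2) = 5\<close> card_upper(1) by (simp add: d_def)
  then have in_all: "ws ! (r - 2) \<in> A \<or> comp (ws ! (r - 2)) \<in> A" if "A \<in> upper" for A
  proof -
    have "A \<in> {A \<in> upper. lvar (ws ! (r - 2)) \<in> var_cl A}"
      using \<open>{A \<in> upper. lvar (ws ! (r - 2)) \<in> var_cl A} = upper\<close> that by simp
    then show ?thesis
      by (auto simp: var_cl_def lvar_eq_iff)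
  qed
  \<comment> \<open>An available clause would also be in \<open>avail (r - 1)\<close> and so contain
    neither sign of \<open>ws ! (r - 2)\<close>, a variable that all upper clauses contain.\<close>
  have "avail s = {}" if "s \<le> r - 2" for s
  proof -
    have "A \<notin> avail s" for A
    proof
      assume A: "A \<in> avail s"
      have "s < r"
        using that r by simp
      then have "A \<in> avail (r - 1)"
        using A av[of s] eq by blast
      then have "ws ! (r - 2) \<notin> A" "A \<in> upper"
        using \<open>2 \<le> r\<close> by (auto simp: avail_def)
      moreover have "comp (ws ! (r - 2)) \<notin> A"
        using A that r by (auto simp: avail_def r_def)
      ultimately show False
        using in_all by blast
    qed
    then show ?thesis
      by blast
  qed
  then have "a 0 = 0" "a (r - 2) = 0"
    by (simp_all add: a_def)
  then have "4 \<le> r"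
    using t[of 0] t4 by simp
  then have "9 \<le> d (r - 3) + a (r - 2) + 3"
    using deg[of "r - 3"] by (simp add: Suc_diff_Suc numeral_3_eq_3 numeral_2_eq_2)
  then show False
    using d5[of "r - 3"] \<open>a (r - 2) = 0\<close> by simp
qed

lemma upper_full: "v \<in> var F \<Longrightarrow> deg F v = 9" "v \<in> var F \<Longrightarrow> A \<in> F \<Longrightarrow> x \<in> A \<Longrightarrow> v \<in> var_cl A"
proof -
  assume v: "v \<in> var F"
  have X: "v \<in> X" if "v \<noteq> lvar x"
    unfolding X_def using v that F1(2) ws_empty by simp
  then show "deg F v = 9"
    using upper_X(1) deg_x by blast
  show "v \<in> var_cl A" if "A \<in> F" "x \<in> A"
    using upper_X(2) X that by (cases "v = lvar x") (auto simp: upper_def var_cl_def)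
qed

end

section \<open>Counting falsified clauses\<close>

context deficiency_six
begin

lemma five_full:
  assumes x: "five x" and v: "v \<in> var F"
  shows "deg F v = 9" "A \<in> F \<Longrightarrow> x \<in> A \<Longrightarrow> v \<in> var_cl A"
proof -
  have xF: "lvar x \<in> var F" "ld F x = 5" "ld F (comp x) = 4"
    using x by (auto simp: five_def)
  have dx: "deg F (lvar x) = 9"
    using deg_eq_ld[OF MU_clauseset[OF MU], of x] xF by simp
  have S: "split F x \<in> MU" "var (split F x) = var F - {lvar x}"
    "card (split F x) + ld F x = card (var (split F x)) + 6 + 1"
    using SMU_min_deg_ld(1,2,3)[OF SMU xF(1) _ card_F] deg_ge dx by auto
  obtain \<phi> where p: "inj_on \<phi> (split F x)" "\<phi> ` split F x \<in> SMU"
    "var (\<phi> ` split F x) = var (split F x)" "\<And>C. C \<in> split F x \<Longrightarrow> C \<subseteq> \<phi> C"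
    using saturation[OF S(1)] by metis
  have "\<exists>ws. unit_chain (\<phi> ` split F x) ws"
  proof (rule SMU_unit_chain[OF p(2)])
    show "card (\<phi> ` split F x) = card (var (\<phi> ` split F x)) + 2"
      using S(3) xF(2) p(1,3) by (simp add: card_image)
    fix w assume "w \<in> var (\<phi> ` split F x)"
    then have w: "w \<in> var F" "w \<noteq> lvar x"
      using p(3) S(2) by auto
    have "deg (split F x) w \<le> deg (\<phi> ` split F x) w"
      using deg_mono_image[OF p(1) MU_finite[OF S(1)] p(4)] .
    then show "4 \<le> deg (\<phi> ` split F x) w"
      using deg_split_le[OF MU w(2)] deg_ge[OF w(1)] xF(2) by simp
  qed
  then obtain ws where "unit_chain (\<phi> ` split F x) ws"
    by blast
  then interpret five_split F x \<phi> ws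
    using x p by unfold_locales auto
  show "deg F v = 9" "A \<in> F \<Longrightarrow> x \<in> A \<Longrightarrow> v \<in> var_cl A"
    using upper_full v by auto
qed

text \<open>Flip signs such that the literals in \<open>five\<close> are positive: a clause that is not full is then negative
  and has at least two literals, so each clause is falsified by at most one assignment with at most two
  true variables.\<close>

lemma contradiction: False
proof -
  have "var F \<noteq> {}"
    using MU_no_vars[OF MU] card_F by auto
  then obtain v0 where v0: "v0 \<in> var F" "deg F v0 \<le> 9"
    using low_degree_variable[OF MU _ card_F] N_values(6) by auto
  then have "deg F v0 = 9"
    using deg_ge[of v0] by simp
  then obtain x where x: "five x"
    using five_exists v0(1) by blast
  have "\<forall>v\<in>var F. \<exists>y. lvar y = v \<and> five y"
    using five_exists five_full(1)[OF x] by blast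
  then obtain p where p: "\<And>v. v \<in> var F \<Longrightarrow> lvar (p v) = v" "\<And>v. v \<in> var F \<Longrightarrow> five (p v)"
    by metis
  define V where "V = var F"
  have finV: "finite V"
    using fin(2) by (simp add: V_def)
  have full: "v \<in> var_cl A" if "A \<in> F" "p w \<in> A" "w \<in> V" "v \<in> V" for A v w
    using five_full(2)[OF p(2)] that by (simp add: V_def)
  define upper where "upper = {A \<in> F. p v0 \<in> A}"
  have v0V: "v0 \<in> V"
    using v0(1) by (simp add: V_def)
  have lits: "l = p (lvar l) \<or> l = comp (p (lvar l))" "lvar l \<in> V" if "A \<in> F" "l \<in> A" for A l
    using lvar_in_var[OF that] p(1)[of "lvar l"] lvar_eq_iff[of l "p (lvar l)"] by (auto simp: V_def)
  \<comment> \<open>These 5 clauses are full, so they differ in their signs on the variables other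
    than \<open>v0\<close>; as 5 exceeds \<open>2 ^ 2\<close>, there are at least 4
    variables.\<close>
  have "inj_on (\<lambda>A. {v \<in> V - {v0}. p v \<in> A}) upper"
  proof (rule inj_onI)
    fix A B assume A: "A \<in> upper" and B: "B \<in> upper"
      and e: "{v \<in> V - {v0}. p v \<in> A} = {v \<in> V - {v0}. p v \<in> B}"
    have AB: "A \<in> F" "B \<in> F" "p v0 \<in> A" "p v0 \<in> B"
      using A B by (auto simp: upper_def)
    have "C \<subseteq> D" if CD: "C \<in> F" "D \<in> F" "p v0 \<in> C" "p v0 \<in> D"
      "{v \<in> V - {v0}. p v \<in> C} = {v \<in> V - {v0}. p v \<in> D}" for C D
    proof
      fix l assume l: "l \<in> C"
      have lV: "lvar l \<in> V"
        using lits(2)[OF CD(1) l] .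
      have iff: "p (lvar l) \<in> C \<longleftrightarrow> p (lvar l) \<in> D"
        using CD(3-5) lV by (cases "lvar l = v0") auto
      have "lvar l \<in> var_cl D"
        using full[OF CD(2,4) v0V lV] .
      then have "l \<in> D \<or> comp l \<in> D"
        by (auto simp: var_cl_def lvar_eq_iff)
      moreover have "comp l \<notin> D"
      proof
        assume cl: "comp l \<in> D"
        then have "l \<notin> D" "comp l \<notin> C"
          using MU_clause[OF MU CD(1)] MU_clause[OF MU CD(2)] l by (auto simp: is_clause_iff)
        moreover have "p (lvar l) = l \<or> p (lvar l) = comp l"
          using lits(1)[OF CD(1) l] by (metis comp_comp)
        ultimately show False
          using iff l cl by auto
      qed
      ultimately show "l \<in> D"
        by blast
    qed
    then show "A = B"
      using AB e by blast
  qed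
  moreover have "card upper = 5"
    using p(2)[OF v0(1)] by (simp add: five_def upper_def ld_def)
  ultimately have "5 \<le> card (Pow (V - {v0}))"
    using finV by (metis (no_types, lifting) PowI card_image card_mono finite_Diff finite_Pow_iff
        image_subsetI mem_Collect_eq subsetI)
  then have "5 \<le> (2::nat) ^ (card V - 1)"
    using finV v0V by (simp add: card_Pow)
  then have n4: "4 \<le> card V"
  proof (rule contrapos_pp)
    assume "\<not> 4 \<le> card V"
    then have "(2::nat) ^ (card V - 1) \<le> 2 ^ 2"
      by (intro power_increasing) auto
    then show "\<not> 5 \<le> (2::nat) ^ (card V - 1)"
      by simp
  qed
  \<comment> \<open>The signs are flipped in the assignments, leaving \<open>F\<close> as it
    is.\<close>
  define \<beta> where "\<beta> = (\<lambda>S v. (p v = Pos v) = (v \<in> S))"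
  have \<beta>: "lit_true (\<beta> S) (p v) \<longleftrightarrow> v \<in> S" if "v \<in> V" for S v
  proof -
    have "p v = Pos v \<or> p v = Neg v"
      using p(1)[of v] that by (cases "p v") (auto simp: V_def)
    then show ?thesis
      by (auto simp: \<beta>_def)
  qed
  define \<S> where "\<S> = {S. S \<subseteq> V \<and> card S \<le> 2}"
  have "\<forall>S. \<exists>C\<in>F. falsif (\<beta> S) C"
    using MU_falsified[OF MU] by blast
  then obtain cl where cl: "\<And>S. cl S \<in> F" "\<And>S. falsif (\<beta> S) (cl S)"
    by metis
  have "inj_on cl \<S>"
  proof (rule inj_onI)
    fix S T assume S: "S \<in> \<S>" and T: "T \<in> \<S>" and e: "cl S = cl T"
    let ?C = "cl S"
    have f: "falsif (\<beta> S) ?C" "falsif (\<beta> T) ?C"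
      using cl(2)[of S] cl(2)[of T] e by auto
    have ST: "S \<subseteq> V" "T \<subseteq> V" "card S \<le> 2" "card T \<le> 2" "finite S" "finite T"
      using S T finV by (auto simp: \<S>_def intro: finite_subset)
    show "S = T"
    proof (cases "\<exists>w\<in>V. p w \<in> ?C")
      case True
      then obtain w where w: "w \<in> V" "p w \<in> ?C"
        by blast
      have "v \<in> S \<longleftrightarrow> v \<in> T" if v: "v \<in> V" for v
      proof -
        have "v \<in> var_cl ?C"
          using full[OF cl(1) w(2,1) v] .
        then have "p v \<in> ?C \<or> comp (p v) \<in> ?C"
          using p(1)[of v] v by (auto simp: var_cl_def V_def lvar_eq_iff)
        then show ?thesis
        proof
          assume "p v \<in> ?C"
          then show ?thesis
            using f \<beta>[OF v] by (auto simp: falsif_def)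
        next
          assume "comp (p v) \<in> ?C"
          then have "\<not> lit_true (\<beta> S) (comp (p v))" "\<not> lit_true (\<beta> T) (comp (p v))"
            using f unfolding falsif_def by blast+
          then show ?thesis
            using \<beta>[OF v] by simp
        qed
      qed
      then show ?thesis
        using ST by blast
    next
      case False
      have neg: "l = comp (p (lvar l))" "lvar l \<in> V" if "l \<in> ?C" for l
        using lits[OF cl(1) that] False that by auto
      have sub: "lvar ` ?C \<subseteq> U" if U: "falsif (\<beta> U) ?C" for U
      proof (rule image_subsetI)
        fix l assume l: "l \<in> ?C"
        then have "\<not> lit_true (\<beta> U) (comp (p (lvar l)))"
          using U neg(1)[OF l] unfolding falsif_def by metis
        then show "lvar l \<in> U"
          using \<beta>[OF neg(2)[OF l]] by simp
      qed
      have inj: "inj_on lvar ?C"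
        using neg(1) by (metis inj_onI)
      have "finite ?C"
        using MU_clause[OF MU cl(1)] by (simp add: is_clause_iff)
      have "card ?C \<noteq> 0"
      proof
        assume "card ?C = 0"
        then have "{} \<in> F"
          using \<open>finite ?C\<close> cl(1)[of S] by simp
        then have "F = {{}}"
          using MU_antichain[OF MU, of "{}"] by blast
        then show False
          using v0(1) by (simp add: var_def var_cl_def)
      qed
      moreover have "card ?C \<noteq> 1"
        using no_unit cl(1)[of S] by (metis card_1_singletonE)
      ultimately have "2 \<le> card (lvar ` ?C)"
        using card_image[OF inj] by simp
      then have "lvar ` ?C = S" "lvar ` ?C = T"
        using card_seteq[OF ST(5) sub[OF f(1)]] card_seteq[OF ST(6) sub[OF f(2)]] ST(3,4) by simp_all
      then show ?thesis
        by simp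
    qed
  qed
  then have le: "card \<S> \<le> card F"
    using cl(1) fin(1) by (intro card_inj_on_le[of cl]) auto
  have "card \<S> = 1 + card V + (card V choose 2)"
  proof -
    let ?P = "\<lambda>k. {S. S \<subseteq> V \<and> card S = k}"
    have fP: "finite (?P k)" for k
      using finV by simp
    have "\<S> = ?P 0 \<union> ?P 1 \<union> ?P 2"
      by (auto simp: \<S>_def)
    moreover have "card (?P 0 \<union> ?P 1 \<union> ?P 2) = card (?P 0 \<union> ?P 1) + card (?P 2)"
      using fP by (intro card_Un_disjoint finite_UnI) auto
    moreover have "card (?P 0 \<union> ?P 1) = card (?P 0) + card (?P 1)"
      using fP by (intro card_Un_disjoint) auto
    ultimately have "card \<S> = card (?P 0) + card (?P 1) + card (?P 2)"
      by simp
    then show ?thesis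
      using n_subsets[OF finV] by simp
  qed
  \<comment> \<open>By injectivity \<open>1 + card V + (card V choose 2)\<close> is at most
    \<open>card V + 6\<close>, which allows only 5 pairs.\<close>
  moreover have "6 \<le> card V choose 2"
  proof -
    have "4 * 3 \<le> card V * (card V - 1)"
      using n4 by (intro mult_le_mono) auto
    then show ?thesis
      unfolding choose_two by linarith
  qed
  ultimately show False
    using le card_F by (simp add: V_def)
qed

end

text \<open>Saturation only raises degrees, and splitting off a unit keeps the deficiency and the
  other degrees, so the induction reaches a set without unit clauses.\<close>

lemma MU_six_low_degree:
  assumes "F \<in> MU" "card F = card (var F) + 6"
  shows "\<exists>v\<in>var F. deg F v \<le> 8"
  using assms
proof (induction "card (var F)" arbitrary: F rule: less_induct)
  case less
  obtain \<phi> where p: "inj_on \<phi> F" "\<phi> ` F \<in> SMU" "var (\<phi> ` F) = var F" "\<And>C. C \<in> F \<Longrightarrow> C \<subseteq> \<phi> C"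
    using saturation[OF less.prems(1)] by metis
  define G where "G = \<phi> ` F"
  have G: "G \<in> SMU" "var G = var F" "card G = card (var G) + 6"
    using p less.prems(2) by (auto simp: G_def card_image)
  have "\<exists>v\<in>var G. deg G v \<le> 8"
  proof (rule ccontr)
    assume "\<not> ?thesis"
    then have big: "9 \<le> deg G v" if "v \<in> var G" for v
      using that by force
    show False
    proof (cases "\<exists>u. {u} \<in> G")
      case False
      then interpret deficiency_six G
        using G big by unfold_locales auto
      show False
        by (rule contradiction)
    next
      case True
      then obtain u where u: "{u} \<in> G"
        by blast
      note U = SMU_unit[OF G(1) u]
      have "finite (var G)" "lvar u \<in> var G"
        using finite_var MU_clauseset SMU_MU G(1) lvar_in_var[OF u] by auto
      then have c: "card (var (split G u)) + 1 = card (var G)"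
        unfolding U(4) by (metis Suc_eq_plus1 card_Suc_Diff1)
      then have "\<exists>v\<in>var (split G u). deg (split G u) v \<le> 8"
        using U(2,5) G(2,3) SMU_MU by (intro less.hyps) auto
      then show False
        using U(4,6) big by force
    qed
  qed
  moreover have "deg F v \<le> deg G v" for v
    unfolding G_def using deg_mono_image[OF p(1) MU_finite[OF less.prems(1)] p(4)] .
  ultimately show ?case
    using G(2) le_trans by blast
qed

section \<open>The extremal example and the theorem\<close>

text \<open>An assignment falsifying a clause satisfies every clause that clashes with it.\<close>

lemma UHIT_subset_MU: "UHIT \<subseteq> MU"
proof
  fix F assume F: "F \<in> UHIT"
  have "satisfiable (F - {C})" if C: "C \<in> F" for C
  proof -
    obtain \<beta> where b: "falsif \<beta> C"
      using falsifying_assignment[of C] F C by (auto simp: UHIT_def is_clauseset_def)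
    have "\<not> falsif \<beta> D" if "D \<in> F - {C}" for D
    proof -
      have "C \<inter> comp ` D \<noteq> {}"
        using F C that unfolding UHIT_def hitting_def by blast
      then obtain y where "y \<in> D" "comp y \<in> C"
        by auto
      then show ?thesis
        using b unfolding falsif_def by (metis lit_true_comp)
    qed
    then show ?thesis
      by (auto simp: satisfiable_falsif)
  qed
  then show "F \<in> MU"
    using F by (simp add: UHIT_def MU_def)
qed

lemma nfc_le_vdeg:
  assumes F: "is_clauseset F" and v: "v \<in> var F"
  shows "nfc F \<le> vdeg F v"
  unfolding vdeg_eq_deg[OF F] deg_def nfc_def
  using F v by (intro card_mono) (auto simp: is_clauseset_def)

definition lit_of :: "nat \<Rightarrow> bool \<Rightarrow> lit" where
  "lit_of v b = (if b then Pos v else Neg v)"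

definition full8 :: "clauseset" where
  "full8 = (\<lambda>(a, b, d). {lit_of 0 a, Neg 1, lit_of 2 b, lit_of 3 d}) ` UNIV"

text \<open>Setting variable 1 to true leaves all 8 clauses over three variables; setting it to
  false leaves two contradictory units on one of these three. Sharing that variable gives 10 clauses
  on 4 variables, with 8 of them full.\<close>

definition example8 :: "clauseset" where
  "example8 = insert {Pos 0, Pos 1} (insert {Neg 0, Pos 1} full8)"

lemma lit_of_simps [simp]:
  "lvar (lit_of v b) = v" "comp (lit_of v b) = lit_of v (\<not> b)"
  "lit_true \<beta> (lit_of v b) \<longleftrightarrow> \<beta> v = b"
  "lit_of v b = lit_of w d \<longleftrightarrow> v = w \<and> b = d"
  by (auto simp: lit_of_def)

lemma lit_of_cases [simp]:
  "Pos v = lit_of v b \<longleftrightarrow> b" "Neg v = lit_of v b \<longleftrightarrow> \<not> b"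
  "v \<noteq> w \<Longrightarrow> Pos v \<noteq> lit_of w b" "v \<noteq> w \<Longrightarrow> Neg v \<noteq> lit_of w b"
  "v \<noteq> w \<Longrightarrow> lit_of w b \<noteq> Neg v"
  by (auto simp: lit_of_def)

lemma card_full8: "card full8 = 8"
proof -
  have eq: "a = a' \<and> b = b' \<and> d = d'"
    if e: "{lit_of 0 a, Neg 1, lit_of 2 b, lit_of 3 d} = {lit_of 0 a', Neg 1, lit_of 2 b', lit_of 3 d'}"
    for a b d a' b' d'
  proof -
    have "Pos v \<in> {lit_of 0 a, Neg 1, lit_of 2 b, lit_of 3 d} \<longleftrightarrow>
        Pos v \<in> {lit_of 0 a', Neg 1, lit_of 2 b', lit_of 3 d'}" for v
      by (simp only: e)
    from this[of 0] this[of 2] this[of 3] show ?thesis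
      by simp
  qed
  have "inj (\<lambda>(a, b, d). {lit_of 0 a, Neg 1, lit_of 2 b, lit_of 3 d})"
  proof (rule injI)
    fix s t :: "bool \<times> bool \<times> bool"
    obtain a b d a' b' d' where st: "s = (a, b, d)" "t = (a', b', d')"
      by (metis surj_pair)
    assume "(case s of (a, b, d) \<Rightarrow> {lit_of 0 a, Neg 1, lit_of 2 b, lit_of 3 d}) =
      (case t of (a, b, d) \<Rightarrow> {lit_of 0 a, Neg 1, lit_of 2 b, lit_of 3 d})"
    then show "s = t"
      unfolding st case_prod_conv by (drule_tac eq) simp
  qed
  then show ?thesis
    unfolding full8_def by (subst card_image) (simp_all add: card_UNIV_bool flip: UNIV_Times_UNIV)
qed

lemma var_cl_full8: "C \<in> full8 \<Longrightarrow> var_cl C = {0, 1, 2, 3}"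
  by (auto simp: full8_def var_cl_def)

lemma var_example8: "var example8 = {0, 1, 2, 3}"
proof -
  have "full8 \<noteq> {}"
    using card_full8 by auto
  then show ?thesis
    using var_cl_full8 by (auto simp: var_def example8_def) (auto simp: var_cl_def)
qed

lemma example8: "example8 \<in> delta_eq UHIT 6" "8 \<le> nfc example8"
proof -
  have fin: "finite full8"
    using card_full8 by (metis card.infinite zero_neq_numeral)
  have cls: "is_clauseset example8"
    using fin by (auto simp: is_clauseset_def is_clause_iff example8_def full8_def)
  have "hitting example8"
    unfolding hitting_def
  proof (intro ballI impI)
    fix C D assume C: "C \<in> example8" and D: "D \<in> example8" and "C \<noteq> D"
    have "\<exists>l\<in>D. comp l \<in> C"
    proof -
      consider "C \<in> full8" "D \<in> full8" | "C \<in> full8" "D \<notin> full8" | "C \<notin> full8" "D \<in> full8"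
        | "C \<notin> full8" "D \<notin> full8"
        by blast
      then show ?thesis
      proof cases
        case 1
        then show ?thesis
          using \<open>C \<noteq> D\<close> by (auto simp: full8_def)
      next
        case 2
        then have "Neg 1 \<in> C" "Pos 1 \<in> D"
          using D by (auto simp: full8_def example8_def)
        then show ?thesis
          by (intro bexI[of _ "Pos 1"]) auto
      next
        case 3
        then have "Pos 1 \<in> C" "Neg 1 \<in> D"
          using C by (auto simp: full8_def example8_def)
        then show ?thesis
          by (intro bexI[of _ "Neg 1"]) auto
      next
        case 4
        then show ?thesis
          using C D \<open>C \<noteq> D\<close> by (auto simp: example8_def)
      qed
    qed
    then show "C \<inter> comp ` D \<noteq> {}"
      by auto
  qed
  moreover have "\<not> satisfiable example8"
  proof
    assume "satisfiable example8"
    then obtain \<beta> where b: "\<And>C. C \<in> example8 \<Longrightarrow> \<exists>l\<in>C. lit_true \<beta> l"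
      by (auto simp: satisfiable_def)
    have "{lit_of 0 (\<not> \<beta> 0), Neg 1, lit_of 2 (\<not> \<beta> 2), lit_of 3 (\<not> \<beta> 3)} \<in> example8"
      by (auto simp: example8_def full8_def)
    from b[OF this] have "\<not> \<beta> 1"
      by auto
    then show False
      using b[of "{Pos 0, Pos 1}"] b[of "{Neg 0, Pos 1}"] by (auto simp: example8_def)
  qed
  moreover have "card example8 = 10"
  proof -
    have "Neg 1 \<in> C" if "C \<in> full8" for C
      using that by (auto simp: full8_def)
    from this[of "{Pos 0, Pos 1}"] this[of "{Neg 0, Pos 1}"]
    have "{Pos 0, Pos 1} \<notin> full8" "{Neg 0, Pos 1} \<notin> full8"
      by auto
    moreover have "{Pos 0, Pos 1} \<noteq> {Neg 0, Pos 1 :: lit}"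
      by auto
    ultimately show ?thesis
      using fin card_full8 by (simp add: example8_def)
  qed
  ultimately show "example8 \<in> delta_eq UHIT 6"
    using cls by (simp add: delta_eq_def UHIT_def delta_def c_def n_def var_example8)
  have "full8 \<subseteq> {C \<in> example8. var_cl C = var example8}"
  proof
    fix C assume "C \<in> full8"
    then show "C \<in> {C \<in> example8. var_cl C = var example8}"
      using var_cl_full8[of C] by (simp add: var_example8) (simp add: example8_def)
  qed
  then have "card full8 \<le> nfc example8"
    unfolding nfc_def using fin by (intro card_mono) (auto simp: example8_def)
  then show "8 \<le> nfc example8"
    by (simp add: card_full8)
qed

theorem theorem14p4:
  shows "nfc_max (delta_eq UHIT 6) = 8
       \<and> nfc_max (delta_eq MU 6) = 8
       \<and> minvdeg_class (delta_eq UHIT 6) = 8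
       \<and> minvdeg_class (delta_eq MU 6) = 8
       \<and> N 6 - 1 = 8"
proof -
  let ?U = "delta_eq UHIT 6" and ?M = "delta_eq MU 6"
  have UM: "?U \<subseteq> ?M"
    using UHIT_subset_MU by (auto simp: delta_eq_def)
  have M: "F \<in> MU" "card F = card (var F) + 6" "0 < n F" "finite (var F)" "var F \<noteq> {}" if "F \<in> ?M" for F
  proof -
    show F: "F \<in> MU" "card F = card (var F) + 6"
      using that by (auto simp: delta_eq_def delta_def c_def n_def)
    \<comment> \<open>Without variables \<open>F\<close> would be \<open>{{}}\<close>, of deficiency
      1; so every member of the class counts for \<open>minvdeg_class\<close>.\<close>
    show "finite (var F)" "var F \<noteq> {}"
      using F finite_var MU_clauseset MU_no_vars[OF F(1)] by auto
    then show "0 < n F"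
      by (simp add: n_def card_gt_0_iff)
  qed
  have le: "minvdeg F \<le> 8" if F: "F \<in> ?M" for F
  proof -
    obtain v where v: "v \<in> var F" "deg F v \<le> 8"
      using MU_six_low_degree[OF M(1)[OF F] M(2)[OF F]] by blast
    then have "minvdeg F \<le> vdeg F v"
      unfolding minvdeg_def using M(4)[OF that] by (intro Min_le) auto
    then show ?thesis
      using v(2) vdeg_eq_deg[OF MU_clauseset[OF M(1)[OF that]]] by simp
  qed
  have nm: "nfc F \<le> minvdeg F" if "F \<in> ?M" for F
    unfolding minvdeg_def using M[OF that] nfc_le_vdeg MU_clauseset by (subst Min_ge_iff) auto
  \<comment> \<open>All four values lie between \<open>nfc_max ?U\<close> and
    \<open>minvdeg_class ?M\<close>, so a lower bound for the former and an upper bound for the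
    latter suffice.\<close>
  have "8 \<le> nfc_max ?U"
  proof -
    have "enat 8 \<le> enat (nfc example8)"
      using example8(2) by simp
    also have "\<dots> \<le> nfc_max ?U"
      unfolding nfc_max_def using example8(1) by (intro Sup_upper) auto
    finally show ?thesis
      by (simp add: numeral_eq_enat)
  qed
  moreover have "nfc_max ?U \<le> nfc_max ?M"
    unfolding nfc_max_def using UM by (intro Sup_subset_mono) auto
  moreover have nmc: "nfc_max D \<le> minvdeg_class D" if "D \<subseteq> ?M" for D
    unfolding nfc_max_def minvdeg_class_def
  proof (rule Sup_mono)
    fix a assume "a \<in> (\<lambda>F. enat (nfc F)) ` D"
    then obtain F where "F \<in> D" "a = enat (nfc F)"
      by blast
    then show "\<exists>b\<in>(\<lambda>F. enat (minvdeg F)) ` {F \<in> D. 0 < n F}. a \<le> b"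
      using nm[of F] M(3)[of F] that by auto
  qed
  moreover have "minvdeg_class ?U \<le> minvdeg_class ?M"
    unfolding minvdeg_class_def using UM by (intro Sup_subset_mono) auto
  moreover have "minvdeg_class ?M \<le> 8"
    unfolding minvdeg_class_def using le by (intro Sup_least) (auto simp: numeral_eq_enat)
  ultimately have "nfc_max ?U = 8" "nfc_max ?M = 8" "minvdeg_class ?U = 8" "minvdeg_class ?M = 8"
    using nmc[OF UM] nmc[OF order_refl] by (meson antisym order_trans)+
  then show ?thesis
    using N_values(6) by simp
qed

end
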